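(* Let $d\ge 1$ and let $f\in C_0(\mathbb R^d)$. Suppose that $f$ and its partial derivatives $D^\eta f$, for all $\eta\in\{0,1\}^d$ with $\eta\ne\mathbf 1$, are locally absolutely continuous on $(\mathbb R\setminus\{0\})^d$ in each variable. Let $f\in L_{p_{\mathbf 0}}(\mathbb R^d)$ with $1\le p_{\mathbf 0}<\infty$, and for each $\eta\in\{0,1\}^d$, $\eta\neq\mathbf 0$, let $D^\eta f\in L_{p_\eta}(\mathbb R^d)$ with $1<p_\eta<\infty$. If for all $\eta\in\{0,1\}^d$, $\eta\ne\mathbf 0$, $$\frac{1}{p_{\mathbf 0}}+\frac{1}{p_\eta}>1,$$ then $f\in A(\mathbb R^d)$.
   Context: $A(\mathbb R^d)$ is the set of functions $f$ on $\mathbb R^d$ representable as $f(y)=\int_{\mathbb R^d} g(x)e^{i(x,y)}\,dx$ for some $g\in L_1(\mathbb R^d)$. $C_0(\mathbb R^d)$ is the set of continuous functions on $\mathbb R^d$ tending to $0$ as $|x|\to\infty$. $\eta=(\eta_1,\dots,\eta_d)$ denotes a vector with entries $0$ or $1$ only; $\mathbf 0=(0,\dots,0)$, $\mathbf 1=(1,\dots,1)$. $D^\eta f=\left(\prod_{j:\,\eta_j=1}\frac{\partial}{\partial x_j}\right)f$, with $D^{\mathbf 0}f=f$. "Locally absolutely continuous on $(\mathbb R\setminus\{0\})^d$ in each variable" means absolutely continuous in each variable on compact intervals of $\mathbb R\setminus\{0\}$, the other variables being fixed in $\mathbb R\setminus\{0\}$. *)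

theory Defs
  imports "HOL-Analysis.Analysis"
begin

text \<open>
  The dimension \<open>d \<ge> 1\<close> is \<open>CARD('n)\<close>, and functions are complex-valued.
  A 0-1 vector \<open>\<eta>\<close> is encoded by its support \<open>{j. \<eta>\<^sub>j = 1} :: 'n set\<close>, so that
  the zero vector is \<open>{}\<close> and the all-ones vector is \<open>UNIV\<close>.
\<close>

definition L_space :: "real \<Rightarrow> (real ^ 'n \<Rightarrow> complex) set" where
  "L_space p = {f. f \<in> borel_measurable lebesgue \<and>
                   integrable lebesgue (\<lambda>x. norm (f x) powr p)}"

definition wiener_A :: "(real ^ 'n \<Rightarrow> complex) set" where
  "wiener_A = {f. \<exists>g :: real ^ 'n \<Rightarrow> complex. integrable lebesgue g \<and>
     (\<forall>y. f y = (LINT x|lebesgue. g x * exp (\<i> * complex_of_real (x \<bullet> y))))}"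

definition C0_space :: "(real ^ 'n \<Rightarrow> complex) set" where
  "C0_space = {f. continuous_on UNIV f \<and> (f \<longlongrightarrow> 0) at_infinity}"

text \<open>
  Absolute continuity on a set \<open>I\<close> of reals: \<open>\<D> division_of S\<close> says that \<open>\<D>\<close> is a finite
  family of nonempty compact intervals \<open>{Inf K..Sup K}\<close> with pairwise disjoint interiors and
  union \<open>S\<close>.
\<close>

definition abs_continuous_on :: "real set \<Rightarrow> (real \<Rightarrow> complex) \<Rightarrow> bool" where
  "abs_continuous_on I h \<longleftrightarrow>
     (\<forall>\<epsilon>>0. \<exists>\<delta>>0. \<forall>\<D> S. \<D> division_of S \<longrightarrow> S \<subseteq> I \<longrightarrow> (\<Sum>K\<in>\<D>. Sup K - Inf K) < \<delta> \<longrightarrow>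
        (\<Sum>K\<in>\<D>. norm (h (Sup K) - h (Inf K))) < \<epsilon>)"

definition coord_upd :: "real ^ 'n \<Rightarrow> 'n \<Rightarrow> real \<Rightarrow> real ^ 'n" where
  "coord_upd x j t = (\<chi> i. if i = j then t else x $ i)"

definition locally_AC_off_axes :: "(real ^ 'n \<Rightarrow> complex) \<Rightarrow> bool" where
  "locally_AC_off_axes f \<longleftrightarrow>
     (\<forall>j x a b. (\<forall>i. i \<noteq> j \<longrightarrow> x $ i \<noteq> 0) \<longrightarrow> a \<le> b \<longrightarrow> 0 \<notin> {a..b} \<longrightarrow>
        abs_continuous_on {a..b} (\<lambda>t. f (coord_upd x j t)))"

definition partial :: "'n \<Rightarrow> (real ^ 'n \<Rightarrow> complex) \<Rightarrow> real ^ 'n \<Rightarrow> complex" where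
  "partial j f x = vector_derivative (\<lambda>t. f (coord_upd x j t)) (at (x $ j))"

text \<open>
  \<open>mixed_partial js \<eta> f\<close> is \<open>D\<^sup>\<eta> f\<close>, where the partial derivatives are composed in the order in
  which the coordinates are listed in \<open>js\<close> (the first one in \<open>js\<close> outermost).  Here \<open>js\<close> is
  meant to be an enumeration of all coordinates.

  \<open>partial\<close> is a total function with an unspecified constant value where the derivative does
  not exist.  This is harmless when both \<open>g\<close> and \<open>partial j g\<close> are locally absolutely
  continuous off the axes: then \<open>g\<close> is, in the \<open>j\<close>-th variable, an integral of the continuous
  function \<open>partial j g\<close>, so the classical partial derivative exists at every point with
  nonzero coordinates.  If only \<open>g\<close> is (the case of the derivative of full order), it exists
  at almost every point.
\<close>

definition mixed_partial ::
    "'n list \<Rightarrow> 'n set \<Rightarrow> (real ^ 'n \<Rightarrow> complex) \<Rightarrow> real ^ 'n \<Rightarrow> complex" where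
  "mixed_partial js \<eta> f = foldr partial (filter (\<lambda>j. j \<in> \<eta>) js) f"

end

theory Submission
  imports Defs "HOL-Probability.Characteristic_Functions"
begin

text \<open>
  The proof decomposes \<open>f\<close> into pieces whose norms in the Wiener algebra can be estimated, and
  sums the estimates.

  Averaging over a box with sides \<open>2\<^sup>-\<^sup>k\<close> tends to the identity when all sides shrink; since \<open>f\<close>
  vanishes at infinity, it tends to \<open>0\<close> as soon as one side grows.  Telescoping in each
  coordinate therefore writes \<open>f\<close> as the sum over all integer vectors \<open>k\<close> of Haar blocks
  (\<open>haar_expansion\<close>).  The Haar kernel is the difference of two translates of an indicator
  function, so the block at the scales \<open>h\<close> is the convolution of the mixed difference
  \<open>\<Delta>\<^sub>h f\<close> with a multiple of the indicator function of a box (\<open>haar_block_eq\<close>).  A convolution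
  of two square-integrable functions is the Fourier transform of the product of two
  square-integrable functions, which bounds the norm of the block in the Wiener algebra by
  the product of the two \<open>L\<^sub>2\<close> norms (\<open>wiener_bound_convolution\<close>).  What remains is to see that
  the square integral of \<open>\<Delta>\<^sub>h f\<close> is at most a constant times the product of the factors
  \<open>h\<^sub>i min(h\<^sub>i, 1/h\<^sub>i)\<^sup>\<delta>\<close> with some \<open>\<delta> > 0\<close>, for then the norms of the blocks form a product of
  geometric series (\<open>wiener_bound_if_diffs_decay\<close>).

  This bound follows by interpolation from three facts.  The integral of \<open>\<bar>\<Delta>\<^sub>h f\<bar>\<close> to the power
  \<open>p\<^sub>0\<close> is bounded.  The \<open>L\<^sub>p\<close> norm for the exponent \<open>p\<^sub>\<eta>\<close> is at most a constant times the product
  of the \<open>h\<^sub>i\<close> with \<open>i \<in> \<eta>\<close>.  The supremum is at most a constant times the product of all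
  \<open>h\<^sub>i\<close> to the power \<open>1 - 1/p\<^sub>1\<close>, where \<open>p\<^sub>1\<close> belongs to the derivative of full order.  For \<open>\<eta>\<close>
  one takes the set of the coordinates with \<open>h\<^sub>i \<le> 1\<close>; the condition \<open>1/p\<^sub>0 + 1/p\<^sub>\<eta> > 1\<close> is
  exactly what makes the resulting exponents of the small steps larger than \<open>1\<close> and those of
  the large steps smaller than \<open>1\<close> (\<open>L2_bound\<close>).

  The second and third fact need the derivatives to control differences across the coordinate
  hyperplanes, where no regularity of the derivatives is assumed.  A slab of width \<open>2e\<close> around
  each hyperplane is cut out of the difference (\<open>cut_diff\<close>).  The cut difference is an iterated
  integral of the derivative by the fundamental theorem of calculus on each side of the
  hyperplanes.  It is estimated uniformly in \<open>e\<close>, and it converges to the full difference as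
  \<open>e \<rightarrow> 0\<close>, because \<open>f\<close> itself is continuous (\<open>cut_diffs_tendsto\<close>).

  The fundamental theorem of calculus for absolutely continuous functions is proved first; its
  core is that such functions are differentiable almost everywhere.
\<close>

section \<open>Almost everywhere differentiability\<close>

text \<open>
  The subdivision consists of the endpoints \<open>a\<close>, \<open>b\<close> and the list of the points strictly between
  them.  With the endpoints kept apart from the list, joining two subdivisions at a common
  point is list concatenation.
\<close>
fun variation :: "(real \<Rightarrow> 'a::real_normed_vector) \<Rightarrow> real \<Rightarrow> real list \<Rightarrow> real \<Rightarrow> real" where
  "variation h a [] b = norm (h b - h a)"
| "variation h a (x # xs) b = norm (h x - h a) + variation h x xs b"

fun subdivides :: "real \<Rightarrow> real list \<Rightarrow> real \<Rightarrow> bool" where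
  "subdivides a [] b \<longleftrightarrow> a < b"
| "subdivides a (x # xs) b \<longleftrightarrow> a < x \<and> subdivides x xs b"

lemma variation_append:
  "variation h a (xs @ m # ys) b = variation h a xs m + variation h m ys b"
  by (induction xs arbitrary: a) auto

lemma subdivides_append:
  "subdivides a (xs @ m # ys) b \<longleftrightarrow> subdivides a xs m \<and> subdivides m ys b"
  by (induction xs arbitrary: a) auto

lemma subdivides_less: "subdivides a xs b \<Longrightarrow> a < b"
  by (induction xs arbitrary: a) force+

lemma variation_uminus: "variation (\<lambda>x. - h x) a xs b = variation h a xs b"
  by (induction xs arbitrary: a) (auto simp: norm_minus_commute)

lemma variation_add_linear:
  fixes h :: "real \<Rightarrow> real"
  assumes "subdivides a xs b"
  shows "variation (\<lambda>x. h x - m * x) a xs b \<le> variation h a xs b + \<bar>m\<bar> * (b - a)"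
  using assms
proof (induction xs arbitrary: a)
  case Nil
  have "\<bar>h b - h a - m * (b - a)\<bar> \<le> \<bar>h b - h a\<bar> + \<bar>m * (b - a)\<bar>" by linarith
  also have "\<bar>m * (b - a)\<bar> = \<bar>m\<bar> * (b - a)" using Nil by (simp add: abs_mult)
  finally show ?case by (simp add: algebra_simps)
next
  case (Cons x xs)
  then have "a < x" and IH: "variation (\<lambda>x. h x - m * x) x xs b \<le> variation h x xs b + \<bar>m\<bar> * (b - x)"
    by auto
  have "\<bar>h x - h a - m * (x - a)\<bar> \<le> \<bar>h x - h a\<bar> + \<bar>m * (x - a)\<bar>" by linarith
  also have "\<bar>m * (x - a)\<bar> = \<bar>m\<bar> * (x - a)" using \<open>a < x\<close> by (simp add: abs_mult)
  finally show ?case using IH by (simp add: algebra_simps)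
qed

lemma subdivides_division:
  assumes "subdivides a xs b"
  obtains \<D> where "\<D> division_of {a..b}" "(\<Sum>K\<in>\<D>. norm (h (Sup K) - h (Inf K))) = variation h a xs b"
    "(\<Sum>K\<in>\<D>. Sup K - Inf K) = b - a"
proof -
  have "\<exists>\<D>. \<D> division_of {a..b} \<and> (\<Sum>K\<in>\<D>. norm (h (Sup K) - h (Inf K))) = variation h a xs b \<and>
    (\<Sum>K\<in>\<D>. Sup K - Inf K) = b - a"
    using assms
  proof (induction xs arbitrary: a)
    case Nil
    then show ?case
      using division_of_self[of a b] by (intro exI[of _ "{{a..b}}"]) auto
  next
    case (Cons x xs)
    then have ax: "a < x" and xb: "x < b" using subdivides_less by auto
    obtain \<D> where D: "\<D> division_of {x..b}"
      "(\<Sum>K\<in>\<D>. norm (h (Sup K) - h (Inf K))) = variation h x xs b"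
      "(\<Sum>K\<in>\<D>. Sup K - Inf K) = b - x"
      using Cons by auto
    have "{a..x} \<notin> \<D>"
    proof
      assume "{a..x} \<in> \<D>"
      then have "{a..x} \<subseteq> {x..b}" using D(1) division_ofD(2) by blast
      then have "a \<in> {x..b}" using ax by auto
      then show False using ax by auto
    qed
    moreover have "finite \<D>" using D(1) by blast
    moreover have "({{a..x}} \<union> \<D>) division_of ({a..x} \<union> {x..b})"
      using ax xb D(1) division_of_self[of a x] by (intro division_disjoint_union) (auto simp: cbox_interval)
    moreover have "{a..x} \<union> {x..b} = {a..b}" using ax xb by auto
    ultimately show ?case
      using D ax by (intro exI[of _ "insert {a..x} \<D>"]) auto
  qed
  then show thesis using that by blast
qed

text \<open>
  The variation of a real function is its total increment plus twice the sum of the decreases.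
  Any disjoint intervals can be made cells of a subdivision, so twice the drops over them can
  be added to the total increment.
\<close>
lemma variation_ge_drops:
  fixes h :: "real \<Rightarrow> real"
  assumes "finite F" "\<And>u v. (u, v) \<in> F \<Longrightarrow> a < u \<and> u < v \<and> v < b"
    and "\<And>u v u' v'. (u, v) \<in> F \<Longrightarrow> (u', v') \<in> F \<Longrightarrow> (u, v) \<noteq> (u', v') \<Longrightarrow> v < u' \<or> v' < u"
    and "a < b"
  shows "\<exists>xs. subdivides a xs b \<and> h b - h a + 2 * (\<Sum>(u, v)\<in>F. h u - h v) \<le> variation h a xs b"
  using assms
proof (induction "card F" arbitrary: F a b rule: less_induct)
  case less
  show ?case
  proof (cases "F = {}")
    case True
    with less.prems show ?thesis by (intro exI[of _ "[]"]) auto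
  next
    case False
    then obtain u v where uv: "(u, v) \<in> F" by auto
    define F1 where "F1 = {p \<in> F. snd p < u}"
    define F2 where "F2 = {p \<in> F. v < fst p}"
    have F: "F = insert (u, v) (F1 \<union> F2)"
      using less.prems(3)[OF uv] uv unfolding F1_def F2_def by force
    have uvlt: "a < u" "u < v" "v < b" using less.prems(2)[OF uv] by auto
    have nin: "(u, v) \<notin> F1" "(u, v) \<notin> F2" using uvlt by (auto simp: F1_def F2_def)
    have dj: "F1 \<inter> F2 = {}"
      using less.prems(2) uvlt by (fastforce simp: F1_def F2_def)
    have fin: "finite F1" "finite F2" using less.prems(1) by (auto simp: F1_def F2_def)
    have "F1 \<subseteq> F" "F2 \<subseteq> F" by (auto simp: F1_def F2_def)
    then have "F1 \<subset> F" "F2 \<subset> F" using nin uv by blast+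
    then have lt: "card F1 < card F" "card F2 < card F"
      using less.prems(1) by (auto intro: psubset_card_mono)
    have "\<exists>xs. subdivides a xs u \<and> h u - h a + 2 * (\<Sum>(u, v)\<in>F1. h u - h v) \<le> variation h a xs u"
      using less.prems uvlt(1) by (intro less.hyps lt fin) (auto simp: F1_def)
    then obtain xs where xs: "subdivides a xs u"
      "h u - h a + 2 * (\<Sum>(u, v)\<in>F1. h u - h v) \<le> variation h a xs u" by blast
    have "\<exists>xs. subdivides v xs b \<and> h b - h v + 2 * (\<Sum>(u, v)\<in>F2. h u - h v) \<le> variation h v xs b"
      using less.prems uvlt(3) by (intro less.hyps lt fin) (auto simp: F2_def)
    then obtain ys where ys: "subdivides v ys b"
      "h b - h v + 2 * (\<Sum>(u, v)\<in>F2. h u - h v) \<le> variation h v ys b" by blast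
    have "(\<Sum>(u, v)\<in>F. h u - h v) = (h u - h v) + ((\<Sum>(u, v)\<in>F1. h u - h v) + (\<Sum>(u, v)\<in>F2. h u - h v))"
      using nin fin dj unfolding F by (subst sum.insert) (auto simp: sum.union_disjoint)
    moreover have "h v - h u + 2 * (h u - h v) \<le> \<bar>h v - h u\<bar>" by (simp add: abs_if)
    ultimately show ?thesis
      using xs ys uvlt
      by (intro exI[of _ "xs @ u # v # ys"]) (auto simp: variation_append subdivides_append)
  qed
qed

text \<open>
  If arbitrarily short intervals with a drop of slope at least \<open>c\<close> occur around every point of
  \<open>S\<close>, Vitali's covering theorem selects disjoint ones covering almost all of \<open>S\<close>, and finitely
  many of them already have half of the measure of \<open>S\<close>.
\<close>
lemma variation_ge_vitali:
  fixes h :: "real \<Rightarrow> real"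
  assumes "a < b" and S: "S \<in> lmeasurable" "S \<subseteq> {a<..<b}" and "c \<ge> 0"
    and drop: "\<And>x d. x \<in> S \<Longrightarrow> 0 < d \<Longrightarrow> \<exists>u v. u \<le> x \<and> x \<le> v \<and> u < v \<and> v - u < d \<and> c * (v - u) \<le> h u - h v"
  shows "\<exists>xs. subdivides a xs b \<and> h b - h a + c * measure lebesgue S \<le> variation h a xs b"
proof (cases "measure lebesgue S = 0")
  case True
  then show ?thesis using \<open>a < b\<close> by (intro exI[of _ "[]"]) auto
next
  case False
  then have mpos: "0 < measure lebesgue S" using measure_nonneg[of lebesgue S] by linarith
  define K where "K = {(u, v). a < u \<and> u < v \<and> v < b \<and> c * (v - u) \<le> h u - h v}"
  have cb: "cball ((fst i + snd i) / 2) ((snd i - fst i) / 2) = {fst i..snd i}" for i :: "real \<times> real"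
    unfolding cball_eq_atLeastAtMost by (intro arg_cong2[where f=atLeastAtMost]) (simp_all add: field_simps)
  have cover: "\<exists>i. i \<in> K \<and> x \<in> cball ((fst i + snd i) / 2) ((snd i - fst i) / 2) \<and> (snd i - fst i) / 2 < d"
    if xd: "x \<in> S" "0 < d" for x d
  proof -
    have x: "a < x" "x < b" using xd S by auto
    obtain u v where "u \<le> x" "x \<le> v" "u < v" "v - u < min d (min (x - a) (b - x))" "c * (v - u) \<le> h u - h v"
      using drop[OF xd(1), of "min d (min (x - a) (b - x))"] x xd by auto
    then show ?thesis unfolding cb K_def by (intro exI[of _ "(u, v)"]) auto
  qed
  have "\<And>i. i \<in> K \<Longrightarrow> 0 < (snd i - fst i) / 2" by (auto simp: K_def)
  from Vitali_covering_theorem_cballs[where a = "\<lambda>i. (fst i + snd i) / 2", OF this cover]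
  obtain C where C: "countable C" "C \<subseteq> K"
    "pairwise (\<lambda>i j. disjnt {fst i..snd i} {fst j..snd j}) C"
    "negligible (S - (\<Union>i\<in>C. {fst i..snd i}))"
    unfolding cb by blast
  let ?I = "\<lambda>i::real\<times>real. {fst i..snd i}"
  have bnd: "measure lebesgue (\<Union>\<D>) \<le> b - a" if "\<D> \<subseteq> ?I ` C" "finite \<D>" for \<D>
  proof -
    have "\<Union>\<D> \<subseteq> {a..b}" using that C(2) by (force simp: K_def)
    moreover have "\<Union>\<D> \<in> lmeasurable" using that by (intro fmeasurable.finite_Union) auto
    ultimately have "measure lebesgue (\<Union>\<D>) \<le> measure lebesgue {a..b}"
      by (intro measure_mono_fmeasurable) auto
    then show ?thesis using \<open>a < b\<close> by simp
  qed
  obtain \<D> where D: "\<D> \<subseteq> ?I ` C" "finite \<D>" "measure lebesgue (\<Union>(?I ` C)) - measure lebesgue S / 2 < measure lebesgue (\<Union>\<D>)"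
    using measure_countable_Union_approachable[of "?I ` C" "measure lebesgue S / 2" "b - a"] C(1) bnd mpos
    by (auto; blast)
  obtain F where F: "F \<subseteq> C" "finite F" "\<D> = ?I ` F"
    using finite_subset_image[OF D(2,1)] by auto
  have UC: "\<Union>(?I ` C) \<in> lmeasurable"
  proof (rule bounded_set_imp_lmeasurable)
    have "\<Union>(?I ` C) \<subseteq> {a..b}" using C(2) by (force simp: K_def)
    then show "bounded (\<Union>(?I ` C))" using bounded_subset bounded_closed_interval by metis
    show "\<Union>(?I ` C) \<in> sets lebesgue" using C(1) by (intro sets.countable_UN') auto
  qed
  have FK: "a < u \<and> u < v \<and> v < b \<and> c * (v - u) \<le> h u - h v" if "(u, v) \<in> F" for u v
    using that F(1) C(2) unfolding K_def by blast
  have "measure lebesgue S \<le> measure lebesgue (\<Union>(?I ` C) \<union> (S - \<Union>(?I ` C)))"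
    using UC C(4) S by (intro measure_mono_fmeasurable) (auto intro: negligible_imp_measurable)
  also have "\<dots> \<le> measure lebesgue (\<Union>(?I ` C)) + measure lebesgue (S - \<Union>(?I ` C))"
    using UC C(4) by (intro measure_Un_le) (auto intro: negligible_imp_sets)
  also have "measure lebesgue (S - \<Union>(?I ` C)) = 0" using C(4) negligible_imp_measure0 by auto
  finally have "measure lebesgue S \<le> measure lebesgue (\<Union>(?I ` C))" by simp
  then have "measure lebesgue S / 2 < measure lebesgue (\<Union>i\<in>F. ?I i)" using D(3) unfolding F(3) by linarith
  also have "\<dots> \<le> (\<Sum>i\<in>F. measure lebesgue (?I i))"
    using F(2) by (intro measure_UNION_le) auto
  also have "\<dots> = (\<Sum>(u, v)\<in>F. v - u)"
    by (intro sum.cong) (auto dest!: FK)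
  finally have "c * measure lebesgue S \<le> 2 * (\<Sum>(u, v)\<in>F. c * (v - u))"
    using \<open>c \<ge> 0\<close> mult_left_mono[of "measure lebesgue S / 2" "\<Sum>(u, v)\<in>F. v - u" c]
    by (simp add: sum_distrib_left case_prod_unfold sum_distrib_right mult_ac)
  also have "(\<Sum>(u, v)\<in>F. c * (v - u)) \<le> (\<Sum>(u, v)\<in>F. h u - h v)"
    by (intro sum_mono) (auto dest!: FK)
  finally have le: "c * measure lebesgue S \<le> 2 * (\<Sum>(u, v)\<in>F. h u - h v)" by simp
  have "v < u' \<or> v' < u" if uv: "(u, v) \<in> F" "(u', v') \<in> F" "(u, v) \<noteq> (u', v')" for u v u' v'
  proof -
    have "u < v" "u' < v'" using uv FK by blast+
    moreover have "disjnt {u..v} {u'..v'}"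
      using C(3) uv F(1) unfolding pairwise_def by force
    ultimately show ?thesis unfolding disjnt_def Int_atLeastAtMost atLeastatMost_empty_iff
      by linarith
  qed
  moreover have "a < u \<and> u < v \<and> v < b" if "(u, v) \<in> F" for u v using FK[OF that] by blast
  ultimately have "\<exists>xs. subdivides a xs b \<and> h b - h a + 2 * (\<Sum>(u, v)\<in>F. h u - h v) \<le> variation h a xs b"
    using variation_ge_drops[of F a b h] F(2) \<open>a < b\<close> by blast
  with le show ?thesis by (meson add_left_mono order_trans)
qed

text \<open>
  A cell over which \<open>h\<close> increases is refined with the drops, a cell over which it decreases with
  the rises.  In both cases the intervals used run against the increment of the cell, so that
  the variation grows by an amount proportional to the part of \<open>S\<close> in the cell.
\<close>
lemma variation_refine:
  fixes h :: "real \<Rightarrow> real"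
  assumes S: "S \<in> sets lebesgue" and "c \<ge> 0"
    and drop: "\<And>x d. x \<in> S \<Longrightarrow> 0 < d \<Longrightarrow> \<exists>u v. u \<le> x \<and> x \<le> v \<and> u < v \<and> v - u < d \<and> c * (v - u) \<le> h u - h v"
    and rise: "\<And>x d. x \<in> S \<Longrightarrow> 0 < d \<Longrightarrow> \<exists>u v. u \<le> x \<and> x \<le> v \<and> u < v \<and> v - u < d \<and> c * (v - u) \<le> h v - h u"
    and "subdivides a xs b"
  shows "\<exists>ys. subdivides a ys b \<and> variation h a xs b + c * measure lebesgue (S \<inter> {a<..<b}) \<le> variation h a ys b"
  using assms(5)
proof (induction xs arbitrary: a)
  have lm: "S \<inter> {u<..<v} \<in> lmeasurable" for u v
    by (rule bounded_set_imp_lmeasurable) (use S bounded_Int in auto)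
  have one: "\<exists>ys. subdivides a ys b \<and> \<bar>h b - h a\<bar> + c * measure lebesgue (S \<inter> {a<..<b}) \<le> variation h a ys b"
    if "a < b" for a b
  proof (cases "h a \<le> h b")
    case True
    have "\<exists>xs. subdivides a xs b \<and> h b - h a + c * measure lebesgue (S \<inter> {a<..<b}) \<le> variation h a xs b"
      using lm drop by (intro variation_ge_vitali that \<open>c \<ge> 0\<close>) blast+
    with True show ?thesis by simp
  next
    case False
    have "\<exists>xs. subdivides a xs b \<and> - h b - - h a + c * measure lebesgue (S \<inter> {a<..<b}) \<le> variation (\<lambda>x. - h x) a xs b"
    proof (intro variation_ge_vitali that \<open>c \<ge> 0\<close> lm Int_lower2)
      fix x d :: real assume "x \<in> S \<inter> {a<..<b}" "0 < d"
      then show "\<exists>u v. u \<le> x \<and> x \<le> v \<and> u < v \<and> v - u < d \<and> c * (v - u) \<le> - h u - - h v"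
        using rise[of x d] by simp
    qed
    with False show ?thesis by (simp add: variation_uminus)
  qed
  {
    case Nil
    then show ?case using one by simp
  next
    case (Cons x xs)
    then have lt: "a < x" "x < b" using subdivides_less by auto
    obtain ys where ys: "subdivides a ys x" "\<bar>h x - h a\<bar> + c * measure lebesgue (S \<inter> {a<..<x}) \<le> variation h a ys x"
      using one[OF lt(1)] by blast
    obtain zs where zs: "subdivides x zs b" "variation h x xs b + c * measure lebesgue (S \<inter> {x<..<b}) \<le> variation h x zs b"
      using Cons by auto
    have "measure lebesgue (S \<inter> {a<..<b}) \<le> measure lebesgue ((S \<inter> {a<..<x} \<union> S \<inter> {x<..<b}) \<union> {x})"
      using lmeasurable_cbox[of x x]
      by (intro measure_mono_fmeasurable fmeasurable.Un lm) (auto intro: fmeasurableD lm)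
    also have "\<dots> \<le> measure lebesgue (S \<inter> {a<..<x} \<union> S \<inter> {x<..<b}) + measure lebesgue {x}"
      using lm by (intro measure_Un_le) auto
    also have "\<dots> \<le> measure lebesgue (S \<inter> {a<..<x}) + measure lebesgue (S \<inter> {x<..<b})"
      using lm measure_Un_le[of "S \<inter> {a<..<x}" lebesgue "S \<inter> {x<..<b}"] by auto
    finally have "c * measure lebesgue (S \<inter> {a<..<b}) \<le> c * measure lebesgue (S \<inter> {a<..<x}) + c * measure lebesgue (S \<inter> {x<..<b})"
      using \<open>c \<ge> 0\<close> by (metis mult_left_mono distrib_left)
    then show ?case using ys zs
      by (intro exI[of _ "ys @ x # zs"]) (auto simp: variation_append subdivides_append)
  }
qed

text \<open>
  The refinement can be repeated indefinitely, and each repetition adds \<open>c\<close> times the measure of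
  \<open>S\<close> to the variation.  Bounded variation forces this measure to vanish.
\<close>
lemma oscillating_slopes_null:
  fixes h :: "real \<Rightarrow> real"
  assumes "a < b" and S: "S \<in> sets lebesgue" and "c > 0"
    and drop: "\<And>x d. x \<in> S \<Longrightarrow> 0 < d \<Longrightarrow> \<exists>u v. u \<le> x \<and> x \<le> v \<and> u < v \<and> v - u < d \<and> c * (v - u) \<le> h u - h v"
    and rise: "\<And>x d. x \<in> S \<Longrightarrow> 0 < d \<Longrightarrow> \<exists>u v. u \<le> x \<and> x \<le> v \<and> u < v \<and> v - u < d \<and> c * (v - u) \<le> h v - h u"
    and B: "\<And>xs. subdivides a xs b \<Longrightarrow> variation h a xs b \<le> B"
  shows "S \<inter> {a<..<b} \<in> null_sets lebesgue"
proof -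
  have lm: "S \<inter> {a<..<b} \<in> lmeasurable"
    by (rule bounded_set_imp_lmeasurable) (use S bounded_Int in auto)
  define m where "m = measure lebesgue (S \<inter> {a<..<b})"
  have "\<exists>ys. subdivides a ys b \<and> real n * (c * m) \<le> variation h a ys b" for n
  proof (induction n)
    case 0
    show ?case using \<open>a < b\<close> by (intro exI[of _ "[]"]) auto
  next
    case (Suc n)
    then obtain ys where ys: "subdivides a ys b" "real n * (c * m) \<le> variation h a ys b" by blast
    from variation_refine[OF S less_imp_le[OF \<open>c > 0\<close>] drop rise ys(1)]
    obtain zs where "subdivides a zs b" "variation h a ys b + c * m \<le> variation h a zs b"
      unfolding m_def by blast
    with ys show ?case by (intro exI[of _ zs]) (auto simp: algebra_simps)
  qed
  then have le: "real n * (c * m) \<le> B" for n using B by (meson order_trans)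
  have "\<not> c * m > 0"
  proof
    assume pos: "c * m > 0"
    obtain n where "B < real n * (c * m)" using reals_Archimedean3[OF pos] by blast
    with le[of n] show False by linarith
  qed
  then have "m = 0" using \<open>c > 0\<close> measure_nonneg[of lebesgue "S \<inter> {a<..<b}"] unfolding m_def
    by (simp add: zero_less_mult_iff)
  then show ?thesis using lm unfolding m_def by (metis negligible_iff_measure negligible_iff_null_sets)
qed

text \<open>
  The slope \<open>n\<close> can be taken as large as desired, so that a single refinement already makes the
  variation arbitrarily large.
\<close>
lemma infinite_slopes_null:
  fixes h :: "real \<Rightarrow> real"
  assumes "a < b" and S: "S \<in> sets lebesgue"
    and drop: "\<And>x d n. x \<in> S \<Longrightarrow> 0 < d \<Longrightarrow> \<exists>u v. u \<le> x \<and> x \<le> v \<and> u < v \<and> v - u < d \<and> real n * (v - u) \<le> h u - h v"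
    and B: "\<And>xs. subdivides a xs b \<Longrightarrow> variation h a xs b \<le> B"
  shows "S \<inter> {a<..<b} \<in> null_sets lebesgue"
proof -
  have lm: "S \<inter> {a<..<b} \<in> lmeasurable"
    by (rule bounded_set_imp_lmeasurable) (use S bounded_Int in auto)
  define m where "m = measure lebesgue (S \<inter> {a<..<b})"
  have le: "h b - h a + real n * m \<le> B" for n
  proof -
    have "\<exists>xs. subdivides a xs b \<and> h b - h a + real n * m \<le> variation h a xs b"
      unfolding m_def using lm drop by (intro variation_ge_vitali \<open>a < b\<close>) auto
    with B show ?thesis by force
  qed
  have "\<not> m > 0"
  proof
    assume pos: "m > 0"
    obtain n where "B - (h b - h a) < real n * m" using reals_Archimedean3[OF pos] by blast
    with le[of n] show False by linarith
  qed
  then have "m = 0" using measure_nonneg[of lebesgue "S \<inter> {a<..<b}"] unfolding m_def by linarith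
  then show ?thesis using lm unfolding m_def by (metis negligible_iff_measure negligible_iff_null_sets)
qed

text \<open>
  The bound on \<open>t\<close> runs through the numbers \<open>1 / (n + 1)\<close>, so that the set is a countable
  intersection of sets that are open for continuous \<open>h\<close>, hence a Borel set.
\<close>
definition steep :: "(real \<Rightarrow> real) \<Rightarrow> real \<Rightarrow> real set" where
  "steep h r = {x. \<forall>n::nat. \<exists>t. t \<noteq> 0 \<and> \<bar>t\<bar> < inverse (Suc n) \<and> r < (h (x + t) - h x) / t}"

lemma steep_borel:
  assumes "continuous_on UNIV h"
  shows "steep h r \<in> sets borel"
proof -
  have "open (\<Union>t\<in>{t. t \<noteq> 0 \<and> \<bar>t\<bar> < inverse (Suc n)}. {x. r < (h (x + t) - h x) / t})" for n
    by (intro open_UN ballI open_Collect_less continuous_intros continuous_on_compose2[OF assms]) auto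
  then have "(\<Inter>n::nat. \<Union>t\<in>{t. t \<noteq> 0 \<and> \<bar>t\<bar> < inverse (Suc n)}. {x. r < (h (x + t) - h x) / t}) \<in> sets borel"
    by (intro sets.countable_INT) auto
  also have "(\<Inter>n::nat. \<Union>t\<in>{t. t \<noteq> 0 \<and> \<bar>t\<bar> < inverse (Suc n)}. {x. r < (h (x + t) - h x) / t}) = steep h r"
    by (auto simp: steep_def)
  finally show ?thesis .
qed

lemma steep_iff_frequently: "x \<in> steep h r \<longleftrightarrow> (\<exists>\<^sub>F t in at 0. r < (h (x + t) - h x) / t)"
proof -
  have "\<exists>t. t \<noteq> 0 \<and> \<bar>t\<bar> < d \<and> r < (h (x + t) - h x) / t" if x: "x \<in> steep h r" and d: "0 < d" for d
  proof -
    obtain n where n: "inverse (Suc n) < d" using reals_Archimedean[OF d] by blast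
    obtain t where "t \<noteq> 0" "\<bar>t\<bar> < inverse (Suc n)" "r < (h (x + t) - h x) / t"
      using x unfolding steep_def by blast
    with n show ?thesis using less_trans by blast
  qed
  moreover have "x \<in> steep h r" if "\<forall>d>0. \<exists>t. t \<noteq> 0 \<and> \<bar>t\<bar> < d \<and> r < (h (x + t) - h x) / t"
    unfolding steep_def
  proof (intro CollectI allI)
    fix n
    show "\<exists>t. t \<noteq> 0 \<and> \<bar>t\<bar> < inverse (real (Suc n)) \<and> r < (h (x + t) - h x) / t"
      using that[rule_format, of "inverse (real (Suc n))"] by simp
  qed
  ultimately have "x \<in> steep h r \<longleftrightarrow> (\<forall>d>0. \<exists>t. t \<noteq> 0 \<and> \<bar>t\<bar> < d \<and> r < (h (x + t) - h x) / t)"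
    by blast
  then show ?thesis by (simp add: frequently_at dist_real_def)
qed

lemma steep_interval:
  assumes "x \<in> steep h r" "0 < d"
  shows "\<exists>u v. u \<le> x \<and> x \<le> v \<and> u < v \<and> v - u < d \<and> r * (v - u) \<le> h v - h u"
proof -
  obtain t where t: "t \<noteq> 0" "\<bar>t\<bar> < d" "r < (h (x + t) - h x) / t"
    using assms unfolding steep_iff_frequently frequently_at by (auto simp: dist_real_def)
  show ?thesis
  proof (cases "t > 0")
    case True
    with t show ?thesis by (intro exI[of _ x] exI[of _ "x + t"]) (auto simp: field_simps)
  next
    case False
    with t show ?thesis by (intro exI[of _ "x + t"] exI[of _ x]) (auto simp: field_simps)
  qed
qed

text \<open>
  If the lower limit of the quotients were below the upper limit, two rational numbers would fit
  in between.  The first two conditions exclude infinite limits.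
\<close>
lemma quotient_limit_if_not_steep:
  assumes "x \<notin> (\<Inter>n::nat. steep h (real n))" "x \<notin> (\<Inter>n::nat. steep (\<lambda>x. - h x) (real n))"
    and "x \<notin> (\<Union>r\<in>\<rat>. \<Union>s\<in>{s\<in>\<rat>. r < s}. steep h s \<inter> steep (\<lambda>x. - h x) (- r))"
  shows "\<exists>l. (h has_field_derivative l) (at x)"
proof -
  define q where "q t = (h (x + t) - h x) / t" for t
  have steep: "x \<in> steep h r \<longleftrightarrow> (\<exists>\<^sub>F t in at 0. r < q t)" for r
    by (simp add: steep_iff_frequently q_def)
  have steep': "x \<in> steep (\<lambda>x. - h x) (- r) \<longleftrightarrow> (\<exists>\<^sub>F t in at 0. q t < r)" for r
  proof -
    have "(- h (x + t) - - h x) / t = - q t" for t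
      by (simp add: q_def minus_divide_left)
    then show ?thesis by (simp add: steep_iff_frequently)
  qed
  define L where "L = Liminf (at 0) (\<lambda>t. ereal (q t))"
  define U where "U = Limsup (at 0) (\<lambda>t. ereal (q t))"
  obtain n where "x \<notin> steep h (real n)" using assms(1) by blast
  then have up: "\<forall>\<^sub>F t in at 0. ereal (q t) \<le> ereal (real n)"
    unfolding steep not_frequently by (simp add: not_less)
  obtain m where "x \<notin> steep (\<lambda>x. - h x) (- (- real m))" using assms(2) by auto
  then have lo: "\<forall>\<^sub>F t in at 0. ereal (- real m) \<le> ereal (q t)"
    unfolding steep' not_frequently by (simp add: not_less)
  have LU: "L \<le> U" unfolding L_def U_def by (intro Liminf_le_Limsup) simp
  have U: "U \<le> ereal (real n)" unfolding U_def by (rule Limsup_bounded[OF up])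
  have L: "ereal (- real m) \<le> L" unfolding L_def by (rule Liminf_bounded[OF lo])
  have "L = U"
  proof (rule ccontr)
    assume "L \<noteq> U"
    with LU have "L < U" by simp
    then obtain y where y: "L < ereal y" "ereal y < U" using ereal_dense2 by blast
    then obtain z where z: "L < ereal z" "ereal z < ereal y" using ereal_dense2 by blast
    obtain r where r: "r \<in> \<rat>" "z < r" "r < y" using Rats_dense_in_real z(2) by auto
    then have "ereal z < ereal r" "ereal r < ereal y" by auto
    then have "L < ereal r" "ereal r < U" using y z less_trans by blast+
    then obtain w where w: "ereal r < ereal w" "ereal w < U" using ereal_dense2 by blast
    obtain s where s: "s \<in> \<rat>" "r < s" "s < w" using Rats_dense_in_real w(1) by auto
    then have "ereal s < ereal w" by simp
    then have "ereal s < U" using w less_trans by blast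
    have "\<exists>\<^sub>F t in at 0. s < q t"
    proof (rule ccontr)
      assume "\<not> ?thesis"
      then have "\<forall>\<^sub>F t in at 0. ereal (q t) \<le> ereal s" by (simp add: frequently_def not_less)
      then have "U \<le> ereal s" unfolding U_def by (rule Limsup_bounded)
      with \<open>ereal s < U\<close> show False by simp
    qed
    moreover have "\<exists>\<^sub>F t in at 0. q t < r"
    proof (rule ccontr)
      assume "\<not> ?thesis"
      then have "\<forall>\<^sub>F t in at 0. ereal r \<le> ereal (q t)" by (simp add: frequently_def not_less)
      then have "ereal r \<le> L" unfolding L_def by (rule Liminf_bounded)
      with \<open>L < ereal r\<close> show False by simp
    qed
    ultimately have "x \<in> steep h s \<inter> steep (\<lambda>x. - h x) (- r)" unfolding Int_iff steep steep' by blast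
    with assms(3) r s show False by blast
  qed
  moreover obtain l where "U = ereal l" using U L LU by (cases U) auto
  ultimately have "((\<lambda>t. ereal (q t)) \<longlongrightarrow> ereal l) (at 0)"
    unfolding L_def U_def by (intro Liminf_eq_Limsup) auto
  then have "(q \<longlongrightarrow> l) (at 0)" by simp
  then show ?thesis unfolding DERIV_def q_def by blast
qed

text \<open>
  Subtracting the linear function with slope \<open>(r + s) / 2\<close> turns quotients above \<open>s\<close> and below \<open>r\<close>
  into slopes of both signs of size at least \<open>(s - r) / 2\<close>.
\<close>
lemma bounded_variation_AE_differentiable:
  fixes h :: "real \<Rightarrow> real"
  assumes "a < b" "continuous_on UNIV h"
    and B: "\<And>xs. subdivides a xs b \<Longrightarrow> variation h a xs b \<le> B"
  shows "negligible {x \<in> {a<..<b}. \<not> (\<exists>l. (h has_field_derivative l) (at x))}"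
proof -
  have cm: "continuous_on UNIV (\<lambda>x. - h x)" using assms(2) by (intro continuous_intros)
  have B': "variation (\<lambda>x. - h x) a xs b \<le> B" if "subdivides a xs b" for xs
    using B[OF that] by (simp add: variation_uminus)
  have leb: "S \<in> sets borel \<Longrightarrow> S \<in> sets lebesgue" for S :: "real set" by (simp add: sets_completionI_sets)
  have N1: "(\<Inter>n::nat. steep h (real n)) \<inter> {a<..<b} \<in> null_sets lebesgue"
  proof (rule infinite_slopes_null[OF assms(1) _ _ B'])
    show "(\<Inter>n::nat. steep h (real n)) \<in> sets lebesgue"
      by (intro leb sets.countable_INT) (auto intro: steep_borel assms)
    show "\<exists>u v. u \<le> x \<and> x \<le> v \<and> u < v \<and> v - u < d \<and> real n * (v - u) \<le> - h u - - h v"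
      if "x \<in> (\<Inter>n::nat. steep h (real n))" "0 < d" for x d n
      using steep_interval[of x h "real n" d] that by auto
  qed
  have N2: "(\<Inter>n::nat. steep (\<lambda>x. - h x) (real n)) \<inter> {a<..<b} \<in> null_sets lebesgue"
  proof (rule infinite_slopes_null[OF assms(1) _ _ B])
    show "(\<Inter>n::nat. steep (\<lambda>x. - h x) (real n)) \<in> sets lebesgue"
      by (intro leb sets.countable_INT) (auto intro: steep_borel cm)
    show "\<exists>u v. u \<le> x \<and> x \<le> v \<and> u < v \<and> v - u < d \<and> real n * (v - u) \<le> h u - h v"
      if "x \<in> (\<Inter>n::nat. steep (\<lambda>x. - h x) (real n))" "0 < d" for x d n
      using steep_interval[of x "\<lambda>x. - h x" "real n" d] that by auto
  qed
  have N3: "steep h s \<inter> steep (\<lambda>x. - h x) (- r) \<inter> {a<..<b} \<in> null_sets lebesgue" if "r < s" for r s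
  proof -
    define k where "k x = h x - (r + s) / 2 * x" for x
    define c where "c = (s - r) / 2"
    show ?thesis
    proof (rule oscillating_slopes_null[OF assms(1), where h = k and c = c])
      show "steep h s \<inter> steep (\<lambda>x. - h x) (- r) \<in> sets lebesgue"
        by (intro leb sets.Int steep_borel assms cm)
      show "c > 0" using that by (simp add: c_def)
      show "variation k a xs b \<le> B + \<bar>(r + s) / 2\<bar> * (b - a)" if "subdivides a xs b" for xs
        unfolding k_def using variation_add_linear[OF that, of h "(r + s) / 2"] B[OF that] by linarith
      fix x d :: real assume x: "x \<in> steep h s \<inter> steep (\<lambda>x. - h x) (- r)" "0 < d"
      have *: "c * (v - u) + (r + s) / 2 * (v - u) = s * (v - u)" for u v
        by (simp add: c_def field_simps)
      have **: "c * (v - u) - (r + s) / 2 * (v - u) = - r * (v - u)" for u v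
        by (simp add: c_def field_simps)
      obtain u v where "u \<le> x" "x \<le> v" "u < v" "v - u < d" "s * (v - u) \<le> h v - h u"
        using steep_interval[of x h s d] x by blast
      moreover have "c * (v - u) \<le> k v - k u"
        using calculation(5) unfolding *[symmetric] k_def by (simp add: right_diff_distrib)
      ultimately show "\<exists>u v. u \<le> x \<and> x \<le> v \<and> u < v \<and> v - u < d \<and> c * (v - u) \<le> k v - k u"
        by blast
      obtain u v where "u \<le> x" "x \<le> v" "u < v" "v - u < d" "- r * (v - u) \<le> - h v - - h u"
        using steep_interval[of x "\<lambda>x. - h x" "- r" d] x by blast
      moreover have "c * (v - u) \<le> k u - k v"
        using calculation(5) unfolding **[symmetric] k_def by (simp add: right_diff_distrib)
      ultimately show "\<exists>u v. u \<le> x \<and> x \<le> v \<and> u < v \<and> v - u < d \<and> c * (v - u) \<le> k u - k v"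
        by blast
    qed
  qed
  have cs: "countable {s \<in> \<rat>. r < s}" for r :: real by (rule countable_subset[OF _ countable_rat]) auto
  have "(\<Union>r\<in>\<rat>. \<Union>s\<in>{s\<in>\<rat>. r < s}. steep h s \<inter> steep (\<lambda>x. - h x) (- r) \<inter> {a<..<b}) \<in> null_sets lebesgue"
    by (intro null_sets_UN' countable_rat cs N3) auto
  then have "((\<Inter>n::nat. steep h (real n)) \<inter> {a<..<b}) \<union> ((\<Inter>n::nat. steep (\<lambda>x. - h x) (real n)) \<inter> {a<..<b})
    \<union> (\<Union>r\<in>\<rat>. \<Union>s\<in>{s\<in>\<rat>. r < s}. steep h s \<inter> steep (\<lambda>x. - h x) (- r) \<inter> {a<..<b}) \<in> null_sets lebesgue"
    using N1 N2 by (intro null_sets.Un) auto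
  then show ?thesis unfolding negligible_iff_null_sets[symmetric]
  proof (rule negligible_subset, intro subsetI)
    fix x assume "x \<in> {x \<in> {a<..<b}. \<not> (\<exists>l. (h has_field_derivative l) (at x))}"
    then have x: "x \<in> {a<..<b}" and "\<not> (\<exists>l. (h has_field_derivative l) (at x))" by blast+
    then have "x \<in> (\<Inter>n::nat. steep h (real n)) \<or> x \<in> (\<Inter>n::nat. steep (\<lambda>x. - h x) (real n))
      \<or> x \<in> (\<Union>r\<in>\<rat>. \<Union>s\<in>{s\<in>\<rat>. r < s}. steep h s \<inter> steep (\<lambda>x. - h x) (- r))"
      using quotient_limit_if_not_steep[of x h] by metis
    with x show "x \<in> ((\<Inter>n::nat. steep h (real n)) \<inter> {a<..<b}) \<union> ((\<Inter>n::nat. steep (\<lambda>x. - h x) (real n)) \<inter> {a<..<b})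
    \<union> (\<Union>r\<in>\<rat>. \<Union>s\<in>{s\<in>\<rat>. r < s}. steep h s \<inter> steep (\<lambda>x. - h x) (- r) \<inter> {a<..<b})"
      by (elim disjE UN_E) blast+
  qed
qed

section \<open>Absolutely continuous functions\<close>

lemma division_of_real_interval:
  assumes "\<D> division_of S" "K \<in> \<D>"
  obtains c e :: real where "K = {c..e}" "c \<le> e"
proof -
  obtain c e where K: "K = cbox c e" using division_ofD(4)[OF assms] by blast
  then have "c \<le> e" using division_ofD(3)[OF assms] by auto
  with K show thesis using that by simp
qed

lemma abs_continuous_on_subset:
  "abs_continuous_on I h \<Longrightarrow> J \<subseteq> I \<Longrightarrow> abs_continuous_on J h"
  unfolding abs_continuous_on_def by (meson order_trans)

lemma abs_continuous_onD1:
  assumes "abs_continuous_on I h" "0 < e"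
  obtains d where "0 < d" "\<And>\<D> S. \<D> division_of S \<Longrightarrow> S \<subseteq> I \<Longrightarrow> (\<Sum>K\<in>\<D>. Sup K - Inf K) < d \<Longrightarrow>
    (\<Sum>K\<in>\<D>. norm (h (Sup K) - h (Inf K))) < e"
  using assms unfolding abs_continuous_on_def by blast

lemma abs_continuous_imp_continuous:
  assumes "abs_continuous_on {a..b} h"
  shows "continuous_on {a..b} h"
  unfolding continuous_on_iff
proof (intro ballI allI impI)
  fix x e :: real assume x: "x \<in> {a..b}" and e: "0 < e"
  obtain d where d: "0 < d" "\<And>\<D> S. \<D> division_of S \<Longrightarrow> S \<subseteq> {a..b} \<Longrightarrow> (\<Sum>K\<in>\<D>. Sup K - Inf K) < d \<Longrightarrow>
    (\<Sum>K\<in>\<D>. norm (h (Sup K) - h (Inf K))) < e"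
    using abs_continuous_onD1[OF assms e] by blast
  have *: "norm (h v - h u) < e" if "u \<le> v" "a \<le> u" "v \<le> b" "v - u < d" for u v
    using d(2)[of "{{u..v}}" "{u..v}"] division_of_self[of u v] that by auto
  have "dist (h y) (h x) < e" if y: "y \<in> {a..b}" "dist y x < d" for y
    using *[of x y] *[of y x] x y by (cases "x \<le> y") (auto simp: dist_norm norm_minus_commute)
  with d(1) show "\<exists>d>0. \<forall>x'\<in>{a..b}. dist x' x < d \<longrightarrow> dist (h x') (h x) < e" by blast
qed

text \<open>
  On an interval shorter than the \<open>\<delta>\<close> that belongs to \<open>\<epsilon> = 1\<close> the variation is at most \<open>1\<close>, and
  negligibility is a local property.  The function is continued by constants beyond \<open>{a..b}\<close>
  in order to have a continuous function on the whole line.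
\<close>
lemma abs_continuous_AE_differentiable:
  fixes h :: "real \<Rightarrow> complex"
  assumes ac: "abs_continuous_on {a..b} h"
  shows "negligible {x \<in> {a<..<b}. \<not> h differentiable (at x)}" (is "negligible ?N")
proof -
  obtain d where d: "0 < d" "\<And>\<D> S. \<D> division_of S \<Longrightarrow> S \<subseteq> {a..b} \<Longrightarrow> (\<Sum>K\<in>\<D>. Sup K - Inf K) < d \<Longrightarrow>
    (\<Sum>K\<in>\<D>. norm (h (Sup K) - h (Inf K))) < 1"
    using abs_continuous_onD1[OF ac zero_less_one] by blast
  define k where "k x = h (max a (min b x))" for x
  have ck: "continuous_on UNIV k" if "a \<le> b"
    unfolding k_def
    by (rule continuous_on_compose2[OF abs_continuous_imp_continuous[OF ac]]) (use that in \<open>auto intro!: continuous_intros\<close>)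
  have local: "negligible {x \<in> {u<..<v}. \<not> h differentiable (at x)}"
    if uv: "a \<le> u" "u < v" "v \<le> b" "v - u < d" for u v
  proof -
    have neg: "negligible {x \<in> {u<..<v}. \<not> (\<exists>l. ((\<lambda>x. g (k x)) has_field_derivative l) (at x))}"
      if g: "bounded_linear g" "\<And>z. \<bar>g z\<bar> \<le> norm z" for g :: "complex \<Rightarrow> real"
    proof (rule bounded_variation_AE_differentiable[OF uv(2)])
      show "continuous_on UNIV (\<lambda>x. g (k x))"
        using bounded_linear.continuous_on[OF g(1) ck] uv by simp
      fix xs assume xs: "subdivides u xs v"
      obtain \<D> where D: "\<D> division_of {u..v}" "(\<Sum>K\<in>\<D>. norm (g (k (Sup K)) - g (k (Inf K)))) = variation (\<lambda>x. g (k x)) u xs v"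
          "(\<Sum>K\<in>\<D>. Sup K - Inf K) = v - u"
        by (rule subdivides_division[OF xs])
      have "(\<Sum>K\<in>\<D>. norm (g (k (Sup K)) - g (k (Inf K)))) \<le> (\<Sum>K\<in>\<D>. norm (h (Sup K) - h (Inf K)))"
      proof (rule sum_mono)
        fix K assume K: "K \<in> \<D>"
        obtain c e where ce: "K = {c..e}" "c \<le> e" using division_of_real_interval[OF D(1) K] .
        then have "u \<le> c" "e \<le> v" using division_ofD(2)[OF D(1) K] by auto
        then have "max a (min b c) = c" "max a (min b e) = e" using uv ce(2) by linarith+
        then have "k (Sup K) = h (Sup K)" "k (Inf K) = h (Inf K)" using ce by (simp_all add: k_def)
        then show "norm (g (k (Sup K)) - g (k (Inf K))) \<le> norm (h (Sup K) - h (Inf K))"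
          using g(2)[of "h (Sup K) - h (Inf K)"] by (simp add: linear_diff[OF bounded_linear.linear[OF g(1)]])
      qed
      also have "\<dots> < 1" using D uv by (intro d(2)[OF D(1)]) auto
      finally show "variation (\<lambda>x. g (k x)) u xs v \<le> 1" using D(2) by simp
    qed
    have "negligible ({x \<in> {u<..<v}. \<not> (\<exists>l. ((\<lambda>x. Re (k x)) has_field_derivative l) (at x))} \<union>
      {x \<in> {u<..<v}. \<not> (\<exists>l. ((\<lambda>x. Im (k x)) has_field_derivative l) (at x))})"
      by (intro negligible_Un neg bounded_linear_Re bounded_linear_Im abs_Re_le_cmod abs_Im_le_cmod)
    then show ?thesis
    proof (rule negligible_subset, intro subsetI)
      fix x assume x: "x \<in> {x \<in> {u<..<v}. \<not> h differentiable (at x)}"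
      have False if "((\<lambda>x. Re (k x)) has_field_derivative l) (at x)" "((\<lambda>x. Im (k x)) has_field_derivative m) (at x)" for l m
      proof -
        have "(k has_vector_derivative Complex l m) (at x)"
          unfolding has_vector_derivative_complex_iff using that by simp
        then have "(h has_vector_derivative Complex l m) (at x)"
        proof (rule has_vector_derivative_transform_within_open[where S = "{u<..<v}"])
          show "x \<in> {u<..<v}" using x by simp
          fix y assume "y \<in> {u<..<v}"
          then have "max a (min b y) = y" using uv by simp
          then show "k y = h y" by (simp add: k_def)
        qed simp
        then show False using x by (auto simp: has_vector_derivative_def differentiable_def)
      qed
      with x show "x \<in> {x \<in> {u<..<v}. \<not> (\<exists>l. ((\<lambda>x. Re (k x)) has_field_derivative l) (at x))} \<union>
      {x \<in> {u<..<v}. \<not> (\<exists>l. ((\<lambda>x. Im (k x)) has_field_derivative l) (at x))}" by blast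
    qed
  qed
  show ?thesis
  proof (rule locally_negligible_alt[THEN iffD2], rule ballI)
    fix x assume x: "x \<in> ?N"
    define u v where "u = max a (x - d / 3)" and "v = min b (x + d / 3)"
    have "negligible {x \<in> {u<..<v}. \<not> h differentiable (at x)}"
      using x d(1) by (intro local) (auto simp: u_def v_def)
    then have "negligible (?N \<inter> {u<..<v})" by (rule negligible_subset) auto
    moreover have "x \<in> ?N \<inter> {u<..<v}" using x d(1) by (auto simp: u_def v_def)
    ultimately show "\<exists>U. openin (top_of_set ?N) U \<and> x \<in> U \<and> negligible U"
      by (intro exI[of _ "?N \<inter> {u<..<v}"]) (auto intro: openin_open_Int)
  qed
qed

lemma sum_division_le_measure:
  fixes \<D> :: "real set set"
  assumes D: "\<D> division_of S" and "S \<subseteq> U" "U \<in> lmeasurable"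
  shows "(\<Sum>K\<in>\<D>. Sup K - Inf K) \<le> measure lebesgue U"
proof -
  have int: "\<exists>c e. K = {c..e} \<and> c \<le> e" if "K \<in> \<D>" for K
    using division_of_real_interval[OF D that] by metis
  have "(\<Sum>K\<in>\<D>. Sup K - Inf K) = (\<Sum>K\<in>\<D>. measure lebesgue K)"
    using int by (intro sum.cong) force+
  also have "\<dots> = measure lebesgue (\<Union>\<D>)"
  proof (rule measure_negligible_finite_Union[symmetric])
    show "finite \<D>" using D by blast
    show "S \<in> lmeasurable" if "S \<in> \<D>" for S using int[OF that] by auto
    show "pairwise (\<lambda>S T. negligible (S \<inter> T)) \<D>"
    proof (rule pairwiseI)
      fix K L assume KL: "K \<in> \<D>" "L \<in> \<D>" "K \<noteq> L"
      have "convex (K \<inter> L)" using int[OF KL(1)] int[OF KL(2)] by auto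
      then show "negligible (K \<inter> L)"
        using division_ofD(5)[OF D KL] by (subst negligible_convex_interior) auto
    qed
  qed
  also have "\<Union>\<D> = S" using D by blast
  also have "measure lebesgue S \<le> measure lebesgue U"
  proof (rule measure_mono_fmeasurable[OF assms(2) _ assms(3)])
    have "K \<in> sets lebesgue" if "K \<in> \<D>" for K using int[OF that] by auto
    then have "\<Union>\<D> \<in> sets lebesgue" using D by (intro sets.finite_Union) auto
    then show "S \<in> sets lebesgue" using D by (metis division_ofD(6))
  qed
  finally show ?thesis .
qed

text \<open>
  A Henstock-Kurzweil argument.  Cells tagged outside the exceptional null set are handled by
  differentiability at the tag.  Cells tagged in the null set lie in an open set of small
  measure, so their increments have a small sum by absolute continuity.
\<close>
theorem abs_continuous_FTC:
  fixes h :: "real \<Rightarrow> complex"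
  assumes ac: "abs_continuous_on {a..b} h" and "a \<le> b"
  shows "((\<lambda>t. vector_derivative h (at t)) has_integral (h b - h a)) {a..b}"
proof -
  define N where "N = {a, b} \<union> {x \<in> {a<..<b}. \<not> h differentiable (at x)}"
  have N: "negligible N" unfolding N_def
    by (intro negligible_Un abs_continuous_AE_differentiable[OF ac]) (auto intro: negligible_finite)
  define D where "D t = (if t \<in> N then 0 else vector_derivative h (at t))" for t
  have "(D has_integral (h b - h a)) (cbox a b)"
    unfolding has_integral
  proof (intro allI impI)
    fix e :: real assume "0 < e"
    define e1 where "e1 = e / (2 * (b - a + 1))"
    have "0 < e1" using \<open>0 < e\<close> \<open>a \<le> b\<close> by (simp add: e1_def)
    obtain d where d: "0 < d" "\<And>\<D> S. \<D> division_of S \<Longrightarrow> S \<subseteq> {a..b} \<Longrightarrow> (\<Sum>K\<in>\<D>. Sup K - Inf K) < d \<Longrightarrow>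
      (\<Sum>K\<in>\<D>. norm (h (Sup K) - h (Inf K))) < e / 2"
      using abs_continuous_onD1[OF ac, of "e / 2"] \<open>0 < e\<close> by auto
    (* an open neighbourhood of the null set, so small that absolute continuity applies in it *)
    obtain U where U: "open U" "N \<subseteq> U" "U \<in> lmeasurable" "measure lebesgue U < d"
    proof -
      obtain U where U: "open U" "N \<subseteq> U" "U - N \<in> lmeasurable" "emeasure lebesgue (U - N) < ennreal d"
        using sets_lebesgue_outer_open[OF negligible_imp_sets[OF N] \<open>0 < d\<close>] by blast
      have "U = (U - N) \<union> N" using U by auto
      then have "U \<in> lmeasurable" using U(3) negligible_imp_measurable[OF N] by (metis fmeasurable.Un)
      moreover have "measure lebesgue U < d"
      proof -
        have "measure lebesgue U \<le> measure lebesgue (U - N) + measure lebesgue N"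
          using measure_Un_le[of "U - N" lebesgue N] U(3) negligible_imp_sets[OF N] \<open>U = (U - N) \<union> N\<close> by auto
        also have "measure lebesgue N = 0" using N by (rule negligible_imp_measure0)
        finally show ?thesis using U(4) \<open>0 < d\<close> emeasure_eq_measure2[OF U(3)]
          by (simp add: ennreal_less_iff)
      qed
      ultimately show thesis using that U by blast
    qed
    have "\<exists>r>0. \<forall>y. dist y x < r \<longrightarrow> norm (h y - h x - (y - x) *\<^sub>R D x) \<le> e1 * \<bar>y - x\<bar>"
      if "x \<in> {a..b}" "x \<notin> N" for x
    proof -
      have "(h has_vector_derivative D x) (at x)"
        using that unfolding D_def N_def by (auto simp: vector_derivative_works[symmetric])
      then show ?thesis
        unfolding has_vector_derivative_def has_derivative_at_alt
        using \<open>0 < e1\<close> by (auto simp: dist_real_def)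
    qed
    then obtain r where r: "\<And>x. x \<in> {a..b} \<Longrightarrow> x \<notin> N \<Longrightarrow> r x > 0"
      "\<And>x y. x \<in> {a..b} \<Longrightarrow> x \<notin> N \<Longrightarrow> dist y x < r x \<Longrightarrow> norm (h y - h x - (y - x) *\<^sub>R D x) \<le> e1 * \<bar>y - x\<bar>"
      by metis
    (* every cell tagged in N is contained in U *)
    define \<gamma> where "\<gamma> x = (if x \<in> N then U else if x \<in> {a..b} then ball x (r x) else ball x 1)" for x
    have gauge: "gauge \<gamma>" unfolding gauge_def \<gamma>_def using U r(1) by auto
    have close: "norm ((\<Sum>(x,K)\<in>p. measure lborel K *\<^sub>R D x) - (h b - h a)) < e"
      if p: "p tagged_division_of (cbox a b)" "\<gamma> fine p" for p
    proof -
      have p': "p tagged_division_of {a..b}" using p by simp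
      have int: "\<exists>c e. K = {c..e} \<and> c \<le> x \<and> x \<le> e \<and> a \<le> c \<and> e \<le> b" if xK: "(x, K) \<in> p" for x K
      proof -
        obtain c e where K: "K = cbox c e" using tagged_division_ofD(4)[OF p' xK] by blast
        have "x \<in> K" "K \<subseteq> {a..b}" using tagged_division_ofD(2,3)[OF p' xK] by blast+
        with K show ?thesis by (intro exI[of _ c] exI[of _ e]) auto
      qed
      have fin: "finite p" using p by blast
      define q where "q = {(x, K) \<in> p. x \<in> N}"
      have qp: "q \<subseteq> p" by (auto simp: q_def)
      have "(\<Sum>(x,K)\<in>p. measure lborel K *\<^sub>R D x) - (h b - h a)
        = (\<Sum>(x,K)\<in>p. measure lborel K *\<^sub>R D x - (h (Sup K) - h (Inf K)))"
        using additive_tagged_division_1[OF \<open>a \<le> b\<close> p', of h] by (simp add: sum_subtractf case_prod_unfold)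
      also have "norm \<dots> \<le> (\<Sum>(x,K)\<in>p. norm (measure lborel K *\<^sub>R D x - (h (Sup K) - h (Inf K))))"
        by (intro order_trans[OF norm_sum]) (simp add: case_prod_unfold)
      also have "\<dots> = (\<Sum>(x,K)\<in>q. norm (measure lborel K *\<^sub>R D x - (h (Sup K) - h (Inf K)))) +
          (\<Sum>(x,K)\<in>p - q. norm (measure lborel K *\<^sub>R D x - (h (Sup K) - h (Inf K))))"
        using sum.subset_diff[OF qp fin] by (simp add: add.commute)
      also have "(\<Sum>(x,K)\<in>q. norm (measure lborel K *\<^sub>R D x - (h (Sup K) - h (Inf K)))) < e / 2"
      proof -
        have tp: "q tagged_partial_division_of {a..b}"
          using tagged_partial_division_subset[OF _ qp] p' tagged_division_of_def by blast
        have "(\<Sum>(x,K)\<in>q. norm (measure lborel K *\<^sub>R D x - (h (Sup K) - h (Inf K))))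
          = (\<Sum>(x,K)\<in>q. if K = {} then 0 else norm (h (Sup K) - h (Inf K)))"
          using int by (intro sum.cong) (fastforce simp: q_def D_def norm_minus_commute)+
        also have "\<dots> = (\<Sum>K\<in>snd ` q. if K = {} then 0 else norm (h (Sup K) - h (Inf K)))"
        proof (rule sum.over_tagged_division_lemma[OF tagged_partial_division_of_Union_self[OF tp]])
          fix u v :: real assume "box u v = {}"
          then have "v \<le> u" by simp
          then show "(if cbox u v = {} then 0 else norm (h (Sup (cbox u v)) - h (Inf (cbox u v)))) = 0"
            by (cases "u = v") auto
        qed
        also have "\<dots> = (\<Sum>K\<in>snd ` q. norm (h (Sup K) - h (Inf K)))"
          using int qp by (intro sum.cong) fastforce+
        also have "\<dots> < e / 2"
        proof (rule d(2)[OF partial_division_of_tagged_division[OF tp]])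
          show "\<Union> (snd ` q) \<subseteq> {a..b}" using qp tagged_division_ofD(3)[OF p'] by fastforce
          have "\<Union> (snd ` q) \<subseteq> U" using p(2) qp unfolding fine_def q_def \<gamma>_def by fastforce
          then have "(\<Sum>K\<in>snd ` q. Sup K - Inf K) \<le> measure lebesgue U"
            using U(3) by (intro sum_division_le_measure[OF partial_division_of_tagged_division[OF tp]])
          then show "(\<Sum>K\<in>snd ` q. Sup K - Inf K) < d" using U(4) by linarith
        qed
        finally show ?thesis .
      qed
      also have "(\<Sum>(x,K)\<in>p - q. norm (measure lborel K *\<^sub>R D x - (h (Sup K) - h (Inf K))))
        \<le> (\<Sum>(x,K)\<in>p - q. e1 * measure lborel K)"
      proof (rule sum_mono)
        fix z assume z: "z \<in> p - q"
        obtain x K where zxK: "z = (x, K)" by (cases z)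
        with z have xK: "(x, K) \<in> p" "(x, K) \<notin> q" by auto
        then have nx: "x \<notin> N" by (auto simp: q_def)
        obtain c f where cf: "K = {c..f}" "c \<le> x" "x \<le> f" "a \<le> c" "f \<le> b" using int[OF xK(1)] by blast
        have x: "x \<in> {a..b}" using cf by auto
        have "{c..f} \<subseteq> ball x (r x)" using p(2) xK(1) nx x cf(1) unfolding fine_def \<gamma>_def by fastforce
        moreover have "c \<in> {c..f}" "f \<in> {c..f}" using cf by auto
        ultimately have "c \<in> ball x (r x)" "f \<in> ball x (r x)" by blast+
        then have near: "dist c x < r x" "dist f x < r x" by (simp_all add: dist_commute)
        have "norm (measure lborel K *\<^sub>R D x - (h (Sup K) - h (Inf K)))
          = norm ((h c - h x - (c - x) *\<^sub>R D x) - (h f - h x - (f - x) *\<^sub>R D x))"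
          using cf by (simp add: algebra_simps)
        also have "\<dots> \<le> norm (h c - h x - (c - x) *\<^sub>R D x) + norm (h f - h x - (f - x) *\<^sub>R D x)"
          by (rule norm_triangle_ineq4)
        also have "\<dots> \<le> e1 * \<bar>c - x\<bar> + e1 * \<bar>f - x\<bar>"
          by (intro add_mono r(2)[OF x nx] near)
        also have "\<dots> = e1 * measure lborel K" using cf by (simp add: algebra_simps)
        finally show "(case z of (x, K) \<Rightarrow> norm (measure lborel K *\<^sub>R D x - (h (Sup K) - h (Inf K))))
            \<le> (case z of (x, K) \<Rightarrow> e1 * measure lborel K)" unfolding zxK by simp
      qed
      also have "(\<Sum>(x,K)\<in>p - q. e1 * measure lborel K) \<le> (\<Sum>(x,K)\<in>p. e1 * measure lborel K)"
        using fin \<open>0 < e1\<close> by (intro sum_mono2) auto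
      also have "\<dots> = e1 * (b - a)"
        using additive_content_tagged_division[OF p(1)] \<open>a \<le> b\<close>
        by (simp add: sum_distrib_left[symmetric] case_prod_unfold)
      also have "\<dots> \<le> e / 2" using \<open>0 < e\<close> \<open>a \<le> b\<close> by (simp add: e1_def field_simps)
      finally show ?thesis by simp
    qed
    show "\<exists>\<gamma>. gauge \<gamma> \<and> (\<forall>p. p tagged_division_of (cbox a b) \<and> \<gamma> fine p \<longrightarrow>
        norm ((\<Sum>(x,K)\<in>p. measure lborel K *\<^sub>R D x) - (h b - h a)) < e)"
      by (intro exI[of _ \<gamma>] conjI gauge allI impI close) (elim conjE, assumption)+
  qed
  then have "((\<lambda>t. vector_derivative h (at t)) has_integral (h b - h a)) (cbox a b)"
    by (rule has_integral_spike[OF N, rotated]) (auto simp: D_def)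
  then show ?thesis by simp
qed

text \<open>
  On short intervals the increments of the indefinite integral have bounded sums; a long
  interval is a finite union of short ones.
\<close>
theorem abs_continuous_derivative_absolutely_integrable:
  fixes h :: "real \<Rightarrow> complex"
  assumes ac: "abs_continuous_on {a..b} h"
  shows "(\<lambda>t. vector_derivative h (at t)) absolutely_integrable_on {a..b}"
proof -
  obtain d where d: "0 < d" "\<And>\<D> S. \<D> division_of S \<Longrightarrow> S \<subseteq> {a..b} \<Longrightarrow> (\<Sum>K\<in>\<D>. Sup K - Inf K) < d \<Longrightarrow>
    (\<Sum>K\<in>\<D>. norm (h (Sup K) - h (Inf K))) < 1"
    using abs_continuous_onD1[OF ac zero_less_one] by blast
  let ?D = "\<lambda>t. vector_derivative h (at t)"
  have small: "?D absolutely_integrable_on {u..v}" if uv: "a \<le> u" "u \<le> v" "v \<le> b" "v - u < d" for u v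
  proof -
    have "?D absolutely_integrable_on cbox u v"
    proof (rule bounded_variation_absolutely_integrable_interval)
      show "?D integrable_on cbox u v"
        using abs_continuous_FTC[OF abs_continuous_on_subset[OF ac]] uv by (auto simp: integrable_on_def)
      fix \<D> assume D: "\<D> division_of cbox u v"
      have "(\<Sum>K\<in>\<D>. norm (integral K ?D)) = (\<Sum>K\<in>\<D>. norm (h (Sup K) - h (Inf K)))"
      proof (rule sum.cong[OF refl])
        fix K assume K: "K \<in> \<D>"
        obtain c e where ce: "K = {c..e}" "c \<le> e" using division_of_real_interval[OF D K] .
        then have "u \<le> c" "e \<le> v" using division_ofD(2)[OF D K] by auto
        then have "(?D has_integral h e - h c) {c..e}"
          using uv ce by (intro abs_continuous_FTC abs_continuous_on_subset[OF ac]) auto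
        then show "norm (integral K ?D) = norm (h (Sup K) - h (Inf K))"
          using ce by (simp add: integral_unique)
      qed
      also have "\<dots> < 1"
      proof (rule d(2)[OF D])
        show "cbox u v \<subseteq> {a..b}" using uv by auto
        have "(\<Sum>K\<in>\<D>. Sup K - Inf K) \<le> measure lebesgue (cbox u v)"
          by (intro sum_division_le_measure[OF D]) auto
        then show "(\<Sum>K\<in>\<D>. Sup K - Inf K) < d" using uv by simp
      qed
      finally show "(\<Sum>K\<in>\<D>. norm (integral K ?D)) \<le> 1" by simp
    qed
    then show ?thesis by simp
  qed
  have "?D absolutely_integrable_on {u..v}" if "a \<le> u" "v \<le> b" "v - u < real n * (d / 2)" for u v n
    using that
  proof (induction n arbitrary: v)
    case 0
    then have "{u..v} = {}" by simp
    then show ?case using absolutely_integrable_on_null[of u v ?D] by simp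
  next
    case (Suc n)
    show ?case
    proof (cases "v - u < d")
      case True
      then show ?thesis using Suc.prems small[of u v] absolutely_integrable_on_null[of u v ?D]
        by (cases "u \<le> v") simp_all
    next
      case False
      define w where "w = v - d / 2"
      have "?D absolutely_integrable_on {u..w}"
        using Suc.prems d(1) by (intro Suc.IH) (auto simp: w_def algebra_simps)
      moreover have "?D absolutely_integrable_on {w..v}"
        using Suc.prems d(1) False by (intro small) (auto simp: w_def)
      ultimately have "?D absolutely_integrable_on ({u..w} \<union> {w..v})" by (rule absolutely_integrable_Un)
      moreover have "{u..w} \<union> {w..v} = {u..v}" using False d(1) by (auto simp: w_def)
      ultimately show ?thesis by simp
    qed
  qed
  moreover obtain n where "b - a < real n * (d / 2)"
    using reals_Archimedean3[of "d / 2"] d(1) by (metis half_gt_zero)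
  ultimately show ?thesis by blast
qed

section \<open>Fourier transforms of square-integrable functions\<close>

lemma nn_integral_lborel_affine:
  fixes F :: "'a::euclidean_space \<Rightarrow> ennreal"
  assumes [measurable]: "F \<in> borel_measurable borel" and "c \<noteq> 0"
  shows "(\<integral>\<^sup>+x. F x \<partial>lborel) = ennreal (\<bar>c\<bar> ^ DIM('a)) * (\<integral>\<^sup>+x. F (t + c *\<^sub>R x) \<partial>lborel)"
  by (subst lborel_affine[OF \<open>c \<noteq> 0\<close>, of t])
     (simp add: nn_integral_density nn_integral_distr nn_integral_cmult)

lemma integrable_lborel_affine:
  fixes F :: "'a::euclidean_space \<Rightarrow> 'b::{banach, second_countable_topology}"
  assumes "integrable lborel F" and "c \<noteq> 0"
  shows "integrable lborel (\<lambda>x. F (t + c *\<^sub>R x))"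
proof -
  have [measurable]: "F \<in> borel_measurable borel" using assms(1) by auto
  have "ennreal (\<bar>c\<bar> ^ DIM('a)) * (\<integral>\<^sup>+x. ennreal (norm (F (t + c *\<^sub>R x))) \<partial>lborel) < \<infinity>"
    using assms(1) nn_integral_lborel_affine[of "\<lambda>x. ennreal (norm (F x))" c t] \<open>c \<noteq> 0\<close>
    by (simp add: integrable_iff_bounded)
  then have "(\<integral>\<^sup>+x. ennreal (norm (F (t + c *\<^sub>R x))) \<partial>lborel) < \<infinity>"
    using \<open>c \<noteq> 0\<close> by (auto simp: ennreal_mult_less_top)
  then show ?thesis by (simp add: integrable_iff_bounded)
qed

lemma integral_lborel_affine:
  fixes F :: "'a::euclidean_space \<Rightarrow> 'b::{banach, second_countable_topology}"
  assumes [measurable]: "F \<in> borel_measurable borel" and "c \<noteq> 0"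
  shows "(\<integral>x. F x \<partial>lborel) = (\<bar>c\<bar> ^ DIM('a)) *\<^sub>R (\<integral>x. F (t + c *\<^sub>R x) \<partial>lborel)"
  by (subst lborel_affine[OF \<open>c \<noteq> 0\<close>, of t])
     (simp add: integral_density integral_distr)

definition fourier :: "('a::euclidean_space \<Rightarrow> complex) \<Rightarrow> 'a \<Rightarrow> complex" where
  "fourier u \<xi> = (\<integral>t. u t * cis (- (\<xi> \<bullet> t)) \<partial>lborel)"

lemma measurable_cis[measurable (raw)]:
  assumes "g \<in> borel_measurable M"
  shows "(\<lambda>x. cis (g x)) \<in> borel_measurable M"
proof -
  have "cis \<in> borel_measurable borel" by (intro borel_measurable_continuous_onI continuous_intros)
  from measurable_compose[OF assms this] show ?thesis .
qed

lemma measurable_cnj[measurable (raw)]: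
  assumes "g \<in> borel_measurable M"
  shows "(\<lambda>x. cnj (g x)) \<in> borel_measurable M"
proof -
  have "cnj \<in> borel_measurable borel" by (intro borel_measurable_continuous_onI continuous_intros)
  from measurable_compose[OF assms this] show ?thesis .
qed

lemma integrable_mult_cis:
  assumes "integrable M u" "g \<in> borel_measurable M"
  shows "integrable M (\<lambda>t. u t * cis (g t))"
  by (rule Bochner_Integration.integrable_bound[OF assms(1)])
     (use assms in \<open>auto simp: norm_mult\<close>)

lemma integrable_mult_bounded:
  fixes u w :: "'a \<Rightarrow> complex"
  assumes "integrable M u" "w \<in> borel_measurable M" "\<And>x. norm (w x) \<le> B"
  shows "integrable M (\<lambda>t. u t * w t)"
proof (rule Bochner_Integration.integrable_bound)
  show "integrable M (\<lambda>t. B * norm (u t))" using assms(1) by auto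
  have "B \<ge> 0" using assms(3) norm_ge_zero order_trans by blast
  then show "AE x in M. norm (u x * w x) \<le> norm (B * norm (u x))"
    using assms(3) by (auto simp: norm_mult mult.commute[of B] intro!: mult_left_mono)
qed (use assms in auto)

lemma fourier_measurable[measurable]:
  assumes "integrable lborel u"
  shows "fourier u \<in> borel_measurable borel"
proof -
  have [measurable]: "u \<in> borel_measurable borel" using assms by auto
  show ?thesis unfolding fourier_def by measurable
qed

lemma norm_fourier_le:
  assumes "integrable lborel u"
  shows "norm (fourier u \<xi>) \<le> (\<integral>t. norm (u t) \<partial>lborel)"
  unfolding fourier_def
  by (rule order_trans[OF integral_norm_bound]) (simp add: norm_mult)

text \<open>
  The multiplication formula.  It is used with a Gaussian for \<open>\<Phi>\<close>, which gives damped Fourier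
  inversion, and with a damped Fourier transform for \<open>\<Phi>\<close>, which gives Bessel's inequality and
  the inversion formula for convolutions.
\<close>
lemma fourier_fubini:
  fixes \<Phi> v :: "'a::euclidean_space \<Rightarrow> complex"
  assumes \<Phi>: "integrable lborel \<Phi>" and v: "integrable lborel v"
  shows "(\<integral>t. v t * (\<integral>\<xi>. \<Phi> \<xi> * cis (\<xi> \<bullet> (x - t)) \<partial>lborel) \<partial>lborel)
    = (\<integral>\<xi>. \<Phi> \<xi> * fourier v \<xi> * cis (\<xi> \<bullet> x) \<partial>lborel)"
proof -
  have [measurable]: "\<Phi> \<in> borel_measurable borel" "v \<in> borel_measurable borel" using assms by auto
  have int: "integrable (lborel \<Otimes>\<^sub>M lborel) (\<lambda>(\<xi>, t). \<Phi> \<xi> * v t * cis (\<xi> \<bullet> (x - t)))"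
  proof (rule lborel_pair.Fubini_integrable)
    show "integrable lborel (\<lambda>\<xi>. \<integral>t. norm (case (\<xi>, t) of (\<xi>, t) \<Rightarrow> \<Phi> \<xi> * v t * cis (\<xi> \<bullet> (x - t))) \<partial>lborel)"
      using \<Phi> by (simp add: norm_mult)
    show "AE \<xi> in lborel. integrable lborel (\<lambda>t. case (\<xi>, t) of (\<xi>, t) \<Rightarrow> \<Phi> \<xi> * v t * cis (\<xi> \<bullet> (x - t)))"
      using v by (auto intro!: integrable_mult_cis)
  qed measurable
  have "(\<integral>t. v t * (\<integral>\<xi>. \<Phi> \<xi> * cis (\<xi> \<bullet> (x - t)) \<partial>lborel) \<partial>lborel)
    = (\<integral>t. \<integral>\<xi>. \<Phi> \<xi> * v t * cis (\<xi> \<bullet> (x - t)) \<partial>lborel \<partial>lborel)"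
    by (simp flip: integral_mult_right_zero add: mult_ac)
  also have "\<dots> = (\<integral>\<xi>. \<integral>t. \<Phi> \<xi> * v t * cis (\<xi> \<bullet> (x - t)) \<partial>lborel \<partial>lborel)"
    using lborel_pair.Fubini_integral[OF int] by simp
  also have "\<dots> = (\<integral>\<xi>. \<Phi> \<xi> * fourier v \<xi> * cis (\<xi> \<bullet> x) \<partial>lborel)"
  proof (rule Bochner_Integration.integral_cong[OF refl])
    fix \<xi>
    have "\<Phi> \<xi> * v t * cis (\<xi> \<bullet> (x - t)) = \<Phi> \<xi> * cis (\<xi> \<bullet> x) * (v t * cis (- (\<xi> \<bullet> t)))" for t
      using cis_mult[of "\<xi> \<bullet> x" "- (\<xi> \<bullet> t)"] by (simp add: inner_diff_right mult_ac)
    then have "(\<integral>t. \<Phi> \<xi> * v t * cis (\<xi> \<bullet> (x - t)) \<partial>lborel)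
      = (\<integral>t. \<Phi> \<xi> * cis (\<xi> \<bullet> x) * (v t * cis (- (\<xi> \<bullet> t))) \<partial>lborel)"
      by (simp only:)
    then show "(\<integral>t. \<Phi> \<xi> * v t * cis (\<xi> \<bullet> (x - t)) \<partial>lborel) = \<Phi> \<xi> * fourier v \<xi> * cis (\<xi> \<bullet> x)"
      by (simp only: fourier_def integral_mult_right_zero) (simp add: mult_ac)
  qed
  finally show ?thesis .
qed

definition gauss :: "'a::euclidean_space \<Rightarrow> real" where
  "gauss x = (\<Prod>b\<in>Basis. std_normal_density (x \<bullet> b))"

lemma lborel_prod:
  fixes f :: "'a::euclidean_space \<Rightarrow> real \<Rightarrow> complex"
  assumes "\<And>b. b \<in> Basis \<Longrightarrow> integrable lborel (f b)"
  shows "integrable lborel (\<lambda>x::'a. \<Prod>b\<in>Basis. f b (x \<bullet> b))"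
    "integral\<^sup>L lborel (\<lambda>x::'a. \<Prod>b\<in>Basis. f b (x \<bullet> b)) = (\<Prod>b\<in>Basis. \<integral>x. f b x \<partial>lborel)"
proof -
  interpret product_sigma_finite "\<lambda>_. lborel :: real measure" ..
  have m[measurable]: "f b \<in> borel_measurable borel" if "b \<in> Basis" for b using assms[OF that] by auto
  have e: "(\<Prod>b\<in>Basis. f b ((\<Sum>c\<in>Basis. w c *\<^sub>R c) \<bullet> b)) = (\<Prod>b\<in>Basis. f b (w b))" for w :: "'a \<Rightarrow> real"
    by (intro prod.cong) auto
  have mp: "(\<lambda>x::'a. \<Prod>b\<in>Basis. f b (x \<bullet> b)) \<in> borel_measurable borel"
    by (intro borel_measurable_prod measurable_compose[OF _ m]) auto
  have mT: "(\<lambda>w. \<Sum>c\<in>Basis. w c *\<^sub>R c) \<in> measurable (\<Pi>\<^sub>M b\<in>(Basis::'a set). lborel) borel"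
    by measurable
  show "integrable lborel (\<lambda>x::'a. \<Prod>b\<in>Basis. f b (x \<bullet> b))"
    by (subst lborel_eq, subst integrable_distr_eq[OF mT mp]) (use assms in \<open>simp add: e product_integrable_prod\<close>)
  show "integral\<^sup>L lborel (\<lambda>x::'a. \<Prod>b\<in>Basis. f b (x \<bullet> b)) = (\<Prod>b\<in>Basis. \<integral>x. f b x \<partial>lborel)"
    by (subst lborel_eq, subst integral_distr[OF mT mp]) (use assms in \<open>simp add: e product_integral_prod\<close>)
qed

lemma gauss_nonneg[simp]: "gauss x \<ge> 0" unfolding gauss_def by (intro prod_nonneg) auto

lemma gauss_measurable[measurable]: "gauss \<in> borel_measurable borel"
  unfolding gauss_def by measurable

lemma gauss_eq: "gauss (x::'a::euclidean_space) = exp (- (norm x)\<^sup>2 / 2) / (sqrt (2 * pi)) ^ DIM('a)"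
proof -
  have "gauss x = (\<Prod>b\<in>(Basis::'a set). 1 / sqrt (2 * pi)) * (\<Prod>b\<in>Basis. exp (- (x \<bullet> b)\<^sup>2 / 2))"
    by (simp only: gauss_def std_normal_density_def prod.distrib)
  also have "(\<Prod>b\<in>(Basis::'a set). exp (- (x \<bullet> b)\<^sup>2 / 2)) = exp (\<Sum>b\<in>Basis. - (x \<bullet> b)\<^sup>2 / 2)"
    by (simp add: exp_sum)
  also have "(\<Sum>b\<in>Basis. - (x \<bullet> b)\<^sup>2 / 2) = - (norm x)\<^sup>2 / 2"
    unfolding power2_norm_eq_inner euclidean_inner[of x x]
    by (simp add: power2_eq_square sum_divide_distrib[symmetric] sum_negf)
  also have "(\<Prod>b\<in>(Basis::'a set). 1 / sqrt (2 * pi)) = 1 / sqrt (2 * pi) ^ DIM('a)"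
    by (simp only: prod_constant power_one_over)
  finally show ?thesis by (simp only: times_divide_eq_left mult_1_left)
qed

lemma integrable_gauss: "integrable lborel (\<lambda>x::'a::euclidean_space. complex_of_real (gauss x))"
proof -
  have "integrable lborel (\<lambda>x. complex_of_real (std_normal_density x))"
    using integrable_std_normal_moment[of 0] by simp
  from lborel_prod(1)[where f="\<lambda>_ x. complex_of_real (std_normal_density x)", OF this]
  show ?thesis by (simp add: gauss_def)
qed

lemma gauss_transform:
  "integral\<^sup>L lborel (\<lambda>x::'a::euclidean_space. complex_of_real (gauss x) * cis (x \<bullet> z))
    = complex_of_real (exp (- (norm z)\<^sup>2 / 2))"
proof -
  have int1: "integrable lborel (\<lambda>x. complex_of_real (std_normal_density x))"
    using integrable_std_normal_moment[of 0] by simp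
  have one: "(\<integral>x. complex_of_real (std_normal_density x) * cis (x * t) \<partial>lborel) = complex_of_real (exp (- t\<^sup>2 / 2))" for t
  proof -
    have "complex_of_real (exp (- t\<^sup>2 / 2)) = char std_normal_distribution t"
      by (simp add: char_std_normal_distribution)
    also have "\<dots> = (\<integral>x. std_normal_density x *\<^sub>R iexp (t * x) \<partial>lborel)"
      unfolding char_def by (subst integral_density) auto
    finally show ?thesis by (simp add: scaleR_conv_of_real cis_conv_exp mult.commute)
  qed
  have e: "complex_of_real (gauss x) * cis (x \<bullet> z) = (\<Prod>b\<in>Basis. complex_of_real (std_normal_density (x \<bullet> b)) * cis ((x \<bullet> b) * (z \<bullet> b)))" for x
    unfolding gauss_def euclidean_inner[of x z] by (simp add: prod.distrib cis_conv_exp exp_sum sum_distrib_left)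
  have "integral\<^sup>L lborel (\<lambda>x::'a. complex_of_real (gauss x) * cis (x \<bullet> z))
    = (\<Prod>b\<in>Basis. \<integral>x. complex_of_real (std_normal_density x) * cis (x * (z \<bullet> b)) \<partial>lborel)"
    unfolding e by (intro lborel_prod(2) integrable_mult_cis int1) auto
  also have "\<dots> = complex_of_real (exp (\<Sum>b\<in>Basis. - (z \<bullet> b)\<^sup>2 / 2))"
    unfolding one by (simp add: exp_sum)
  also have "(\<Sum>b\<in>Basis. - (z \<bullet> b)\<^sup>2 / 2) = - (norm z)\<^sup>2 / 2"
    unfolding power2_norm_eq_inner euclidean_inner[of z z]
    by (simp add: power2_eq_square sum_divide_distrib[symmetric] sum_negf)
  finally show ?thesis .
qed

lemma nn_integral_gauss: "integral\<^sup>N lborel (\<lambda>x::'a::euclidean_space. ennreal (gauss x)) = 1"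
proof -
  have "complex_of_real (integral\<^sup>L lborel (\<lambda>x::'a. gauss x)) = integral\<^sup>L lborel (\<lambda>x::'a. complex_of_real (gauss x))" by simp
  also have "\<dots> = 1" using gauss_transform[of "0::'a"] by simp
  finally have "integral\<^sup>L lborel (\<lambda>x::'a. gauss x) = 1" by (simp only: of_real_eq_1_iff)
  moreover have "integrable lborel (gauss :: 'a \<Rightarrow> real)"
    using integrable_gauss integrable_Re by force
  ultimately show ?thesis by (subst nn_integral_eq_integral) auto
qed

text \<open>
  The Gaussian factor that makes transforms integrable; it tends to \<open>1\<close> as \<open>e \<rightarrow> 0\<close>.
\<close>
definition damping :: "real \<Rightarrow> 'a::euclidean_space \<Rightarrow> complex" where
  "damping e \<xi> = complex_of_real (exp (- (e * norm \<xi>)\<^sup>2 / 2))"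

text \<open>
  The integral of \<open>exp (- \<bar>x\<bar>\<^sup>2 / 2)\<close>.  Its square is the constant in Plancherel's theorem.
\<close>
definition gauss_const :: "'a::euclidean_space itself \<Rightarrow> real" where
  "gauss_const _ = sqrt (2 * pi) ^ DIM('a)"

lemma gauss_const_pos: "gauss_const TYPE('a::euclidean_space) > 0" unfolding gauss_const_def by simp

lemma damping_eq: "damping e (\<xi>::'a::euclidean_space) = gauss_const TYPE('a) * gauss (e *\<^sub>R \<xi>)"
  unfolding damping_def gauss_eq gauss_const_def by (simp add: power_mult_distrib)

lemma damping_measurable[measurable]: "damping e \<in> borel_measurable borel"
  unfolding damping_def by measurable

lemma norm_damping: "norm (damping e \<xi>) \<le> 1" unfolding damping_def by simp

lemma integrable_damping:
  assumes "e > 0" shows "integrable lborel (damping e)"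
  unfolding damping_eq using integrable_lborel_affine[OF integrable_gauss, of e 0] assms
  by (simp only: of_real_mult) (intro integrable_mult_right, simp)

text \<open>
  The transform of a wide Gaussian is a narrow one.  It is nonnegative, and by the next lemma its
  integral does not depend on \<open>e\<close>; these two properties give Bessel's inequality.
\<close>
lemma transform_damping:
  fixes z :: "'a::euclidean_space"
  assumes "e > 0"
  shows "(\<integral>\<xi>. damping e \<xi> * cis (\<xi> \<bullet> z) \<partial>lborel)
    = complex_of_real ((gauss_const TYPE('a))\<^sup>2 * (inverse e ^ DIM('a) * gauss (inverse e *\<^sub>R z)))"
proof -
  let ?F = "\<lambda>x::'a. complex_of_real (gauss x) * cis (x \<bullet> (inverse e *\<^sub>R z))"
  have "(\<integral>x. ?F x \<partial>lborel) = e ^ DIM('a) *\<^sub>R (\<integral>x. ?F (0 + e *\<^sub>R x) \<partial>lborel)"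
    using assms by (subst integral_lborel_affine[of ?F e 0]) auto
  also have "(\<lambda>x. ?F (0 + e *\<^sub>R x)) = (\<lambda>x. complex_of_real (gauss (e *\<^sub>R x)) * cis (x \<bullet> z))"
    using assms by (auto simp: field_simps)
  finally have "(\<integral>x. complex_of_real (gauss (e *\<^sub>R x)) * cis (x \<bullet> z) \<partial>lborel) = inverse e ^ DIM('a) *\<^sub>R (\<integral>x. ?F x \<partial>lborel)"
    using assms by (simp add: field_simps power_inverse)
  also have "(\<integral>x. ?F x \<partial>lborel) = complex_of_real (exp (- (norm (inverse e *\<^sub>R z))\<^sup>2 / 2))"
    by (rule gauss_transform)
  also have "exp (- (norm (inverse e *\<^sub>R z))\<^sup>2 / 2) = gauss_const TYPE('a) * gauss (inverse e *\<^sub>R z)"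
    unfolding gauss_eq gauss_const_def by simp
  finally show ?thesis
    unfolding damping_eq
    by (simp add: scaleR_conv_of_real power2_eq_square mult.assoc)
qed

lemma nn_integral_kernel:
  fixes a :: "'a::euclidean_space"
  assumes "e > 0" "\<bar>c\<bar> = 1"
  shows "(\<integral>\<^sup>+z. ennreal (inverse e ^ DIM('a) * gauss (inverse e *\<^sub>R (a + c *\<^sub>R z))) \<partial>lborel) = 1"
proof -
  let ?G = "\<lambda>x::'a. ennreal (gauss x)"
  have c: "c \<noteq> 0" using assms by auto
  have "1 = (\<integral>\<^sup>+x. ?G x \<partial>lborel)" by (simp add: nn_integral_gauss)
  also have "\<dots> = ennreal (\<bar>inverse e * c\<bar> ^ DIM('a)) * (\<integral>\<^sup>+x. ?G (inverse e *\<^sub>R a + (inverse e * c) *\<^sub>R x) \<partial>lborel)"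
    using assms c by (intro nn_integral_lborel_affine) auto
  also have "\<dots> = (\<integral>\<^sup>+z. ennreal (inverse e ^ DIM('a)) * ennreal (gauss (inverse e *\<^sub>R (a + c *\<^sub>R z))) \<partial>lborel)"
    using assms by (simp add: nn_integral_cmult abs_mult scaleR_add_right)
  finally show ?thesis using assms by (simp add: ennreal_mult)
qed

lemma damped_transform_fourier:
  fixes u :: "'a::euclidean_space \<Rightarrow> complex"
  assumes u: "integrable lborel u" and "e > 0"
  shows "(\<integral>\<xi>. damping e \<xi> * fourier u \<xi> * cis (\<xi> \<bullet> z) \<partial>lborel)
    = (\<integral>s. u s * complex_of_real ((gauss_const TYPE('a))\<^sup>2 * (inverse e ^ DIM('a) * gauss (inverse e *\<^sub>R (z - s)))) \<partial>lborel)"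
  unfolding fourier_fubini[OF integrable_damping[OF \<open>e > 0\<close>] u, of z, symmetric] transform_damping[OF \<open>e > 0\<close>] ..

text \<open>
  Makes the squared modulus of a transform a product of two transforms.
\<close>
lemma fourier_cnj_reflect:
  assumes "integrable lborel u"
  shows "fourier (\<lambda>t. cnj (u (- t))) \<xi> = cnj (fourier u \<xi>)"
proof -
  have [measurable]: "u \<in> borel_measurable borel" using assms by auto
  have "fourier (\<lambda>t. cnj (u (- t))) \<xi> = (\<integral>t. cnj (u t) * cis (\<xi> \<bullet> t) \<partial>lborel)"
  proof -
    have "(\<lambda>t. cnj (u t) * cis (\<xi> \<bullet> t)) \<in> borel_measurable borel" by measurable
    from integral_lborel_affine[OF this, of "-1" 0] show ?thesis unfolding fourier_def by simp
  qed
  also have "\<dots> = (\<integral>t. cnj (u t * cis (- (\<xi> \<bullet> t))) \<partial>lborel)" by (simp add: cis_cnj)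
  also have "\<dots> = cnj (fourier u \<xi>)" unfolding fourier_def by (simp del: complex_cnj_mult)
  finally show ?thesis .
qed

lemma norm_integral_le_nn_integral:
  fixes f :: "'a \<Rightarrow> 'b::{banach, second_countable_topology}"
  shows "ennreal (norm (integral\<^sup>L M f)) \<le> (\<integral>\<^sup>+x. ennreal (norm (f x)) \<partial>M)"
  by (cases "integrable M f") (auto simp: integral_norm_bound_ennreal not_integrable_integral_eq)

lemma half_sum_squares: "x * y \<le> (x\<^sup>2 + y\<^sup>2) / (2::real)"
  using sum_squares_bound[of x y] by simp

text \<open>
  The damped square integral of the transform equals the double integral of \<open>u(s)\<close>, the conjugate
  of \<open>u(t)\<close> and a nonnegative kernel depending on \<open>s - t\<close> with constant total mass.
  The inequality \<open>xy \<le> (x\<^sup>2 + y\<^sup>2) / 2\<close> separates the two factors (Schur's test).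
\<close>
lemma bessel_damped:
  fixes u :: "'a::euclidean_space \<Rightarrow> complex"
  assumes u: "integrable lborel u" and u2: "(\<integral>\<^sup>+t. ennreal ((norm (u t))\<^sup>2) \<partial>lborel) \<le> ennreal B"
    and "e > 0" "B \<ge> 0"
  shows "(\<integral>\<^sup>+\<xi>. ennreal (norm (damping e \<xi>) * (norm (fourier u \<xi>))\<^sup>2) \<partial>lborel) \<le> ennreal ((gauss_const TYPE('a))\<^sup>2 * B)"
proof -
  have [measurable]: "u \<in> borel_measurable borel" using u by auto
  note [measurable] = fourier_measurable[OF u]
  define c where "c = (gauss_const TYPE('a))\<^sup>2"
  have c: "c \<ge> 0" by (simp add: c_def)
  define K where "K z = inverse e ^ DIM('a) * gauss (inverse e *\<^sub>R z)" for z :: 'a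
  have K[simp]: "K z \<ge> 0" for z using \<open>e > 0\<close> by (simp add: K_def)
  have [measurable]: "K \<in> borel_measurable borel" unfolding K_def by measurable
  have K1: "(\<integral>\<^sup>+s. ennreal (K (a - s)) \<partial>lborel) = 1" for a
    using nn_integral_kernel[OF \<open>e > 0\<close>, of "-1" a] by (simp add: K_def)
  have "integrable lborel (\<lambda>t. cnj (u (0 + (-1) *\<^sub>R t)))"
    by (intro integrable_lborel_affine integrable_cnj u) auto
  then have v: "integrable lborel (\<lambda>t. cnj (u (- t)))" by simp
  have iD: "integrable lborel (\<lambda>\<xi>. damping e \<xi> * fourier u \<xi>)"
    by (intro integrable_mult_bounded[OF integrable_damping[OF \<open>e > 0\<close>] _ norm_fourier_le[OF u]]) simp
  have "integrable lborel (\<lambda>\<xi>. damping e \<xi> * fourier u \<xi> * cnj (fourier u \<xi>))"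
    by (intro integrable_mult_bounded[OF iD]) (auto intro: norm_fourier_le[OF u])
  from integrable_norm[OF this] have iN: "integrable lborel (\<lambda>\<xi>. norm (damping e \<xi>) * (norm (fourier u \<xi>))\<^sup>2)"
    by (simp add: norm_mult power2_eq_square mult.assoc)
  have "(\<integral>\<xi>. norm (damping e \<xi>) * (norm (fourier u \<xi>))\<^sup>2 \<partial>lborel)
     = norm (\<integral>\<xi>. complex_of_real (norm (damping e \<xi>) * (norm (fourier u \<xi>))\<^sup>2) \<partial>lborel)"
    by (simp only: integral_complex_of_real norm_of_real abs_of_nonneg integral_nonneg_AE) (simp add: integral_nonneg_AE)
  also have "(\<lambda>\<xi>. complex_of_real (norm (damping e \<xi>) * (norm (fourier u \<xi>))\<^sup>2))
     = (\<lambda>\<xi>. damping e \<xi> * fourier u \<xi> * fourier (\<lambda>t. cnj (u (- t))) \<xi> * cis (\<xi> \<bullet> 0))"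
    unfolding fourier_cnj_reflect[OF u] damping_def
    by (auto simp: complex_norm_square[symmetric] mult.assoc)
  also have "integral\<^sup>L lborel \<dots> = (\<integral>t. cnj (u (- t)) * (\<integral>\<xi>. damping e \<xi> * fourier u \<xi> * cis (\<xi> \<bullet> (0 - t)) \<partial>lborel) \<partial>lborel)"
    by (rule fourier_fubini[OF iD v, symmetric])
  also have "\<dots> = (\<integral>t. cnj (u (- t)) * (\<integral>s. u s * complex_of_real (c * K (- t - s)) \<partial>lborel) \<partial>lborel)"
    unfolding damped_transform_fourier[OF u \<open>e > 0\<close>] by (simp add: c_def K_def)
  finally have eq: "(\<integral>\<xi>. norm (damping e \<xi>) * (norm (fourier u \<xi>))\<^sup>2 \<partial>lborel) =
     norm (\<integral>t. cnj (u (- t)) * (\<integral>s. u s * complex_of_real (c * K (- t - s)) \<partial>lborel) \<partial>lborel)" .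
  have "ennreal (norm (\<integral>t. cnj (u (- t)) * (\<integral>s. u s * complex_of_real (c * K (- t - s)) \<partial>lborel) \<partial>lborel))
     \<le> (\<integral>\<^sup>+t. ennreal (norm (cnj (u (- t)) * (\<integral>s. u s * complex_of_real (c * K (- t - s)) \<partial>lborel))) \<partial>lborel)"
    by (rule norm_integral_le_nn_integral)
  also have "\<dots> \<le> (\<integral>\<^sup>+t. \<integral>\<^sup>+s. ennreal (c * (((norm (u (- t)))\<^sup>2 + (norm (u s))\<^sup>2) / 2 * K (- t - s))) \<partial>lborel \<partial>lborel)"
  proof (rule nn_integral_mono)
    fix t
    have "ennreal (norm (cnj (u (- t)) * (\<integral>s. u s * complex_of_real (c * K (- t - s)) \<partial>lborel)))
      = ennreal (norm (u (- t))) * ennreal (norm (\<integral>s. u s * complex_of_real (c * K (- t - s)) \<partial>lborel))"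
      by (simp add: norm_mult ennreal_mult)
    also have "\<dots> \<le> ennreal (norm (u (- t))) * (\<integral>\<^sup>+s. ennreal (norm (u s * complex_of_real (c * K (- t - s)))) \<partial>lborel)"
      by (intro mult_left_mono norm_integral_le_nn_integral) auto
    also have "\<dots> = (\<integral>\<^sup>+s. ennreal (norm (u (- t)) * norm (u s) * (c * K (- t - s))) \<partial>lborel)"
      using c by (simp add: nn_integral_cmult[symmetric] norm_mult ennreal_mult'[symmetric] mult_ac)
    also have "\<dots> \<le> (\<integral>\<^sup>+s. ennreal (c * (((norm (u (- t)))\<^sup>2 + (norm (u s))\<^sup>2) / 2 * K (- t - s))) \<partial>lborel)"
    proof (intro nn_integral_mono ennreal_leI)
      fix s
      have "norm (u (- t)) * norm (u s) * (c * K (- t - s)) \<le> ((norm (u (- t)))\<^sup>2 + (norm (u s))\<^sup>2) / 2 * (c * K (- t - s))"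
        using c by (intro mult_right_mono half_sum_squares) auto
      then show "norm (u (- t)) * norm (u s) * (c * K (- t - s)) \<le> c * (((norm (u (- t)))\<^sup>2 + (norm (u s))\<^sup>2) / 2 * K (- t - s))"
        by (simp add: mult_ac)
    qed
    finally show "ennreal (norm (cnj (u (- t)) * (\<integral>s. u s * complex_of_real (c * K (- t - s)) \<partial>lborel)))
      \<le> (\<integral>\<^sup>+s. ennreal (c * (((norm (u (- t)))\<^sup>2 + (norm (u s))\<^sup>2) / 2 * K (- t - s))) \<partial>lborel)" .
  qed
  also have "\<dots> = (\<integral>\<^sup>+t. \<integral>\<^sup>+s. ennreal (c / 2) * (ennreal ((norm (u (- t)))\<^sup>2) * ennreal (K (- t - s)))
      + ennreal (c / 2) * (ennreal ((norm (u s))\<^sup>2) * ennreal (K (- t - s))) \<partial>lborel \<partial>lborel)"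
  proof (intro nn_integral_cong)
    fix t s
    have "c * (((norm (u (- t)))\<^sup>2 + (norm (u s))\<^sup>2) / 2 * K (- t - s))
      = c / 2 * ((norm (u (- t)))\<^sup>2 * K (- t - s)) + c / 2 * ((norm (u s))\<^sup>2 * K (- t - s))"
      by (simp add: field_simps)
    then show "ennreal (c * (((norm (u (- t)))\<^sup>2 + (norm (u s))\<^sup>2) / 2 * K (- t - s)))
      = ennreal (c / 2) * (ennreal ((norm (u (- t)))\<^sup>2) * ennreal (K (- t - s)))
      + ennreal (c / 2) * (ennreal ((norm (u s))\<^sup>2) * ennreal (K (- t - s)))"
      using c by (simp only: ennreal_plus ennreal_mult K zero_le_power2 mult_nonneg_nonneg divide_nonneg_nonneg zero_le_numeral)
  qed
  also have "\<dots> = ennreal (c / 2) * (\<integral>\<^sup>+t. ennreal ((norm (u (- t)))\<^sup>2) * (\<integral>\<^sup>+s. ennreal (K (- t - s)) \<partial>lborel) \<partial>lborel)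
    + ennreal (c / 2) * (\<integral>\<^sup>+t. \<integral>\<^sup>+s. ennreal ((norm (u s))\<^sup>2) * ennreal (K (- t - s)) \<partial>lborel \<partial>lborel)"
    by (simp add: nn_integral_add nn_integral_cmult)
  also have "(\<integral>\<^sup>+t. \<integral>\<^sup>+s. ennreal ((norm (u s))\<^sup>2) * ennreal (K (- t - s)) \<partial>lborel \<partial>lborel)
     = (\<integral>\<^sup>+s. \<integral>\<^sup>+t. ennreal ((norm (u s))\<^sup>2) * ennreal (K (- t - s)) \<partial>lborel \<partial>lborel)"
    by (rule lborel_pair.Fubini') measurable
  also have "\<dots> = (\<integral>\<^sup>+s. ennreal ((norm (u s))\<^sup>2) * (\<integral>\<^sup>+t. ennreal (K (- s - t)) \<partial>lborel) \<partial>lborel)"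
  proof (rule nn_integral_cong)
    fix s
    have sw: "K (- t - s) = K (- s - t)" for t by (rule arg_cong[of _ _ K]) simp
    show "(\<integral>\<^sup>+t. ennreal ((norm (u s))\<^sup>2) * ennreal (K (- t - s)) \<partial>lborel)
      = ennreal ((norm (u s))\<^sup>2) * (\<integral>\<^sup>+t. ennreal (K (- s - t)) \<partial>lborel)"
      unfolding sw by (rule nn_integral_cmult) measurable
  qed
  also have "(\<integral>\<^sup>+t. ennreal ((norm (u (- t)))\<^sup>2) * (\<integral>\<^sup>+s. ennreal (K (- t - s)) \<partial>lborel) \<partial>lborel) = (\<integral>\<^sup>+t. ennreal ((norm (u t))\<^sup>2) \<partial>lborel)"
    unfolding K1 using nn_integral_lborel_affine[of "\<lambda>t. ennreal ((norm (u t))\<^sup>2)" "-1" 0] by simp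
  also have "(\<integral>\<^sup>+s. ennreal ((norm (u s))\<^sup>2) * (\<integral>\<^sup>+t. ennreal (K (- s - t)) \<partial>lborel) \<partial>lborel) = (\<integral>\<^sup>+t. ennreal ((norm (u t))\<^sup>2) \<partial>lborel)"
    unfolding K1 by simp
  also have "ennreal (c / 2) * (\<integral>\<^sup>+t. ennreal ((norm (u t))\<^sup>2) \<partial>lborel) + ennreal (c / 2) * (\<integral>\<^sup>+t. ennreal ((norm (u t))\<^sup>2) \<partial>lborel)
     \<le> ennreal (c / 2) * ennreal B + ennreal (c / 2) * ennreal B"
    by (intro add_mono mult_left_mono u2) auto
  also have "\<dots> = ennreal (c * B)"
  proof -
    have "c * B = c / 2 * B + c / 2 * B" by simp
    then show ?thesis
      using c \<open>B \<ge> 0\<close> by (simp only: ennreal_plus ennreal_mult mult_nonneg_nonneg divide_nonneg_nonneg zero_le_numeral)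
  qed
  finally have fin: "ennreal (\<integral>\<xi>. norm (damping e \<xi>) * (norm (fourier u \<xi>))\<^sup>2 \<partial>lborel) \<le> ennreal (c * B)"
    unfolding eq .
  show ?thesis
    by (subst nn_integral_eq_integral[OF iN]) (use fin in \<open>simp_all add: c_def\<close>)
qed

text \<open>
  One half of Plancherel's theorem; Fatou's lemma removes the damping.
\<close>
lemma bessel:
  fixes u :: "'a::euclidean_space \<Rightarrow> complex"
  assumes u: "integrable lborel u" and u2: "(\<integral>\<^sup>+t. ennreal ((norm (u t))\<^sup>2) \<partial>lborel) \<le> ennreal B"
    and "B \<ge> 0"
  shows "(\<integral>\<^sup>+\<xi>. ennreal ((norm (fourier u \<xi>))\<^sup>2) \<partial>lborel) \<le> ennreal ((gauss_const TYPE('a))\<^sup>2 * B)"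
proof -
  note [measurable] = fourier_measurable[OF u]
  let ?f = "\<lambda>n \<xi>. ennreal (norm (damping (inverse (real (Suc n))) \<xi>) * (norm (fourier u \<xi>))\<^sup>2)"
  have lim: "(\<lambda>n. ?f n \<xi>) \<longlonglongrightarrow> ennreal ((norm (fourier u \<xi>))\<^sup>2)" for \<xi>
  proof (intro tendsto_ennrealI)
    have "(\<lambda>n. exp (- (inverse (real (Suc n)) * norm \<xi>)\<^sup>2 / 2) * (norm (fourier u \<xi>))\<^sup>2) \<longlonglongrightarrow> exp (- (0 * norm \<xi>)\<^sup>2 / 2) * (norm (fourier u \<xi>))\<^sup>2"
      by (intro tendsto_intros LIMSEQ_inverse_real_of_nat) simp
    then show "(\<lambda>n. norm (damping (inverse (real (Suc n))) \<xi>) * (norm (fourier u \<xi>))\<^sup>2) \<longlonglongrightarrow> (norm (fourier u \<xi>))\<^sup>2"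
      by (simp add: damping_def del: of_nat_Suc)
  qed
  have "(\<integral>\<^sup>+\<xi>. ennreal ((norm (fourier u \<xi>))\<^sup>2) \<partial>lborel) = (\<integral>\<^sup>+\<xi>. liminf (\<lambda>n. ?f n \<xi>) \<partial>lborel)"
    by (intro nn_integral_cong lim_imp_Liminf[symmetric] lim) simp
  also have "\<dots> \<le> liminf (\<lambda>n. \<integral>\<^sup>+\<xi>. ?f n \<xi> \<partial>lborel)"
    by (intro nn_integral_liminf) measurable
  also have "\<dots> \<le> liminf (\<lambda>n::nat. ennreal ((gauss_const TYPE('a))\<^sup>2 * B))"
    using assms by (intro Liminf_mono always_eventually allI bessel_damped) auto
  also have "\<dots> = ennreal ((gauss_const TYPE('a))\<^sup>2 * B)" by (simp add: Liminf_const)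
  finally show ?thesis .
qed

section \<open>Norm bounds in the Wiener algebra\<close>

text \<open>
  Membership in the Wiener algebra with an explicit bound of the norm, for Borel measure instead
  of Lebesgue measure.
\<close>
definition wiener_bound :: "('a::euclidean_space \<Rightarrow> complex) \<Rightarrow> real \<Rightarrow> bool" where
  "wiener_bound f c \<longleftrightarrow> (\<exists>g. integrable lborel g \<and> (\<integral>x. norm (g x) \<partial>lborel) \<le> c \<and>
     (\<forall>y. f y = (\<integral>x. g x * cis (x \<bullet> y) \<partial>lborel)))"

lemma wiener_bound_mono: "wiener_bound f c \<Longrightarrow> c \<le> d \<Longrightarrow> wiener_bound f d"
  unfolding wiener_bound_def by (meson order_trans)

lemma wiener_bound_zero: "wiener_bound (\<lambda>_. 0) 0"
  unfolding wiener_bound_def by (intro exI[of _ "\<lambda>_. 0"]) auto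

lemma wiener_bound_add:
  assumes "wiener_bound f c" "wiener_bound g d"
  shows "wiener_bound (\<lambda>x. f x + g x) (c + d)"
proof -
  obtain F where F: "integrable lborel F" "(\<integral>x. norm (F x) \<partial>lborel) \<le> c"
     "\<And>y. f y = (\<integral>x. F x * cis (x \<bullet> y) \<partial>lborel)" using assms(1) unfolding wiener_bound_def by blast
  obtain G where G: "integrable lborel G" "(\<integral>x. norm (G x) \<partial>lborel) \<le> d"
     "\<And>y. g y = (\<integral>x. G x * cis (x \<bullet> y) \<partial>lborel)" using assms(2) unfolding wiener_bound_def by blast
  have "(\<integral>x. norm (F x + G x) \<partial>lborel) \<le> (\<integral>x. norm (F x) + norm (G x) \<partial>lborel)"
    using F(1) G(1) by (intro integral_mono norm_triangle_ineq) auto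
  also have "\<dots> \<le> c + d" using F G by simp
  finally show ?thesis unfolding wiener_bound_def
    using F G by (intro exI[of _ "\<lambda>x. F x + G x"]) (auto simp: distrib_right integrable_mult_cis)
qed

lemma wiener_bound_sum:
  assumes "finite I" "\<And>i. i \<in> I \<Longrightarrow> wiener_bound (f i) (c i)"
  shows "wiener_bound (\<lambda>x. \<Sum>i\<in>I. f i x) (\<Sum>i\<in>I. c i)"
  using assms by (induction I rule: finite_induct) (auto intro: wiener_bound_zero wiener_bound_add)

text \<open>
  Completeness of the algebra: the representing functions form a series that converges absolutely
  in \<open>L\<^sub>1\<close>.
\<close>
lemma wiener_bound_series:
  assumes f: "\<And>n. wiener_bound (f n) (c n)" and c: "summable c" and S: "\<And>y. (\<lambda>n. f n y) sums F y"
  shows "wiener_bound F (\<Sum>n. c n)"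
proof -
  obtain g where g: "\<And>n. integrable lborel (g n)" "\<And>n. (\<integral>x. norm (g n x) \<partial>lborel) \<le> c n"
     "\<And>n y. f n y = (\<integral>x. g n x * cis (x \<bullet> y) \<partial>lborel)" using f unfolding wiener_bound_def by metis
  have [measurable]: "g n \<in> borel_measurable borel" for n using g(1)[of n] by auto
  have sc: "summable (\<lambda>n. \<integral>x. norm (g n x) \<partial>lborel)"
    by (rule summable_comparison_test'[OF c]) (use g(2) in auto)
  have "(\<integral>\<^sup>+x. ennreal (norm (g n x)) \<partial>lborel) = ennreal (\<integral>x. norm (g n x) \<partial>lborel)" for n
    by (rule nn_integral_eq_integral[OF integrable_norm[OF g(1)]]) simp
  then have "(\<integral>\<^sup>+x. (\<Sum>n. ennreal (norm (g n x))) \<partial>lborel) = (\<Sum>n. ennreal (\<integral>x. norm (g n x) \<partial>lborel))"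
    by (subst nn_integral_suminf) simp_all
  also have "\<dots> = ennreal (\<Sum>n. \<integral>x. norm (g n x) \<partial>lborel)" by (rule suminf_ennreal2[OF _ sc]) auto
  finally have "(\<integral>\<^sup>+x. (\<Sum>n. ennreal (norm (g n x))) \<partial>lborel) \<noteq> \<infinity>" by simp
  then have "AE x in lborel. (\<Sum>n. ennreal (norm (g n x))) \<noteq> \<infinity>" by (intro nn_integral_PInf_AE) auto
  then have sA: "AE x in lborel. summable (\<lambda>n. norm (g n x))"
    by eventually_elim (rule summable_suminf_not_top, simp_all)
  define G where "G x = (\<Sum>n. g n x)" for x
  have iG: "integrable lborel G"
    unfolding G_def by (rule integrable_suminf[OF g(1) sA sc])
  have "norm (G x) \<le> (\<Sum>n. norm (g n x))" if "summable (\<lambda>n. norm (g n x))" for x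
    unfolding G_def by (rule summable_norm[OF that])
  then have "AE x in lborel. norm (G x) \<le> (\<Sum>n. norm (g n x))" using sA by (rule eventually_mono[rotated])
  moreover have "integrable lborel (\<lambda>x. \<Sum>n. norm (g n x))"
    by (rule integrable_suminf) (use sA sc g(1) in simp_all)
  ultimately have "(\<integral>x. norm (G x) \<partial>lborel) \<le> (\<integral>x. (\<Sum>n. norm (g n x)) \<partial>lborel)"
    using iG by (intro integral_mono_AE) simp_all
  also have "\<dots> = (\<Sum>n. \<integral>x. norm (g n x) \<partial>lborel)"
    by (rule integral_suminf) (use sA sc g(1) in simp_all)
  also have "\<dots> \<le> (\<Sum>n. c n)" using g(2) sc c by (intro suminf_le)
  finally have 1: "(\<integral>x. norm (G x) \<partial>lborel) \<le> (\<Sum>n. c n)" .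
  have 2: "F y = (\<integral>x. G x * cis (x \<bullet> y) \<partial>lborel)" for y
  proof -
    have [measurable]: "G \<in> borel_measurable borel" using iG by auto
    have "AE x in lborel. G x * cis (x \<bullet> y) = (\<Sum>n. g n x * cis (x \<bullet> y))"
      using sA by eventually_elim (unfold G_def, rule suminf_mult2, rule summable_norm_cancel)
    then have "(\<integral>x. G x * cis (x \<bullet> y) \<partial>lborel) = (\<integral>x. (\<Sum>n. g n x * cis (x \<bullet> y)) \<partial>lborel)"
      by (intro integral_cong_AE) measurable
    also have "\<dots> = (\<Sum>n. \<integral>x. g n x * cis (x \<bullet> y) \<partial>lborel)"
      by (rule integral_suminf) (use sA sc g(1) in \<open>simp_all add: norm_mult integrable_mult_cis\<close>)
    also have "\<dots> = F y" using S[of y] g(3) by (simp add: sums_iff)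
    finally show ?thesis by simp
  qed
  show ?thesis unfolding wiener_bound_def using iG 1 2 by blast
qed

lemma integral_le_if_nn_integral_le:
  assumes "(\<integral>\<^sup>+x. ennreal (F x) \<partial>M) \<le> ennreal B" "F \<in> borel_measurable M" "\<And>x. F x \<ge> 0" "B \<ge> 0"
  shows "integrable M F" "(\<integral>x. F x \<partial>M) \<le> B"
proof -
  show i: "integrable M F"
    using assms by (intro integrableI_nonneg) (auto intro: le_less_trans)
  show "(\<integral>x. F x \<partial>M) \<le> B"
    using assms nn_integral_eq_integral[OF i] by (simp add: ennreal_le_iff)
qed

text \<open>
  The transform of a convolution is the product of the transforms, and this product is integrable
  by Bessel's inequality and Cauchy-Schwarz.  Damped inversion recovers the convolution itself
  because \<open>u\<close> is continuous and bounded.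
\<close>
lemma wiener_bound_convolution_L1:
  fixes u v :: "'a::euclidean_space \<Rightarrow> complex"
  assumes u: "integrable lborel u" and cu: "continuous_on UNIV u" and bu: "\<And>x. norm (u x) \<le> M"
    and u2: "(\<integral>\<^sup>+t. ennreal ((norm (u t))\<^sup>2) \<partial>lborel) \<le> ennreal (U\<^sup>2)"
    and v: "integrable lborel v" and v2: "(\<integral>\<^sup>+t. ennreal ((norm (v t))\<^sup>2) \<partial>lborel) \<le> ennreal (V\<^sup>2)"
    and pos: "U > 0" "V > 0"
  shows "wiener_bound (\<lambda>x. \<integral>t. v t * u (x - t) \<partial>lborel) (U * V)"
proof -
  have [measurable]: "u \<in> borel_measurable borel" "v \<in> borel_measurable borel" using u v by auto
  note [measurable] = fourier_measurable[OF u] fourier_measurable[OF v]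
  define c where "c = (gauss_const TYPE('a))\<^sup>2"
  have c: "c > 0" using gauss_const_pos[where 'a='a] by (simp add: c_def)
  note U2 = integral_le_if_nn_integral_le[OF bessel[OF u u2]]
  note V2 = integral_le_if_nn_integral_le[OF bessel[OF v v2]]
  have iU: "integrable lborel (\<lambda>\<xi>. (norm (fourier u \<xi>))\<^sup>2)" "(\<integral>\<xi>. (norm (fourier u \<xi>))\<^sup>2 \<partial>lborel) \<le> c * U\<^sup>2"
    using U2 by (auto simp: c_def)
  have iV: "integrable lborel (\<lambda>\<xi>. (norm (fourier v \<xi>))\<^sup>2)" "(\<integral>\<xi>. (norm (fourier v \<xi>))\<^sup>2 \<partial>lborel) \<le> c * V\<^sup>2"
    using V2 by (auto simp: c_def)
  have ptw: "norm (fourier u \<xi> * fourier v \<xi>) \<le> (V / U * (norm (fourier u \<xi>))\<^sup>2 + U / V * (norm (fourier v \<xi>))\<^sup>2) / 2" for \<xi>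
  proof -
    have "sqrt (V / U) * norm (fourier u \<xi>) * (sqrt (U / V) * norm (fourier v \<xi>)) \<le>
      ((sqrt (V / U) * norm (fourier u \<xi>))\<^sup>2 + (sqrt (U / V) * norm (fourier v \<xi>))\<^sup>2) / 2"
      by (rule half_sum_squares)
    moreover have "sqrt (V / U) * sqrt (U / V) = 1" using pos by (simp add: real_sqrt_mult[symmetric])
    then have "sqrt (V / U) * norm (fourier u \<xi>) * (sqrt (U / V) * norm (fourier v \<xi>)) = norm (fourier u \<xi> * fourier v \<xi>)"
      by (simp add: norm_mult mult_ac)
    ultimately show ?thesis using pos by (simp add: power_mult_distrib)
  qed
  have iR: "integrable lborel (\<lambda>\<xi>. (V / U * (norm (fourier u \<xi>))\<^sup>2 + U / V * (norm (fourier v \<xi>))\<^sup>2) / 2)"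
    using iU iV by auto
  have iP: "integrable lborel (\<lambda>\<xi>. fourier u \<xi> * fourier v \<xi>)"
  proof (rule Bochner_Integration.integrable_bound[OF iR])
    show "AE \<xi> in lborel. norm (fourier u \<xi> * fourier v \<xi>)
        \<le> norm ((V / U * (norm (fourier u \<xi>))\<^sup>2 + U / V * (norm (fourier v \<xi>))\<^sup>2) / 2)"
      by (intro AE_I2 order_trans[OF ptw]) (simp only: real_norm_def abs_ge_self)
  qed measurable
  have nP: "(\<integral>\<xi>. norm (fourier u \<xi> * fourier v \<xi>) \<partial>lborel) \<le> c * (U * V)"
  proof -
    have "(\<integral>\<xi>. norm (fourier u \<xi> * fourier v \<xi>) \<partial>lborel) \<le> (\<integral>\<xi>. (V / U * (norm (fourier u \<xi>))\<^sup>2 + U / V * (norm (fourier v \<xi>))\<^sup>2) / 2 \<partial>lborel)"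
      using iP iR ptw by (intro integral_mono) auto
    also have "\<dots> = (V / U * (\<integral>\<xi>. (norm (fourier u \<xi>))\<^sup>2 \<partial>lborel) + U / V * (\<integral>\<xi>. (norm (fourier v \<xi>))\<^sup>2 \<partial>lborel)) / 2"
      using iU(1) iV(1) by simp
    also have "\<dots> \<le> (V / U * (c * U\<^sup>2) + U / V * (c * V\<^sup>2)) / 2"
      using iU(2) iV(2) pos by (intro divide_right_mono add_mono mult_left_mono) auto
    also have "\<dots> = c * (U * V)" using pos by (simp add: power2_eq_square field_simps)
    finally show ?thesis .
  qed
  have key: "(\<integral>\<xi>. fourier u \<xi> * fourier v \<xi> * cis (\<xi> \<bullet> x) \<partial>lborel) = c * (\<integral>t. v t * u (x - t) \<partial>lborel)" for x
  proof -
    define e where "e n = inverse (real (Suc n))" for n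
    have e: "e n > 0" "e \<longlonglongrightarrow> 0" for n
      unfolding e_def using LIMSEQ_inverse_real_of_nat by auto
    define L where "L n = (\<integral>\<xi>. damping (e n) \<xi> * fourier u \<xi> * fourier v \<xi> * cis (\<xi> \<bullet> x) \<partial>lborel)" for n
    have L1: "L \<longlonglongrightarrow> (\<integral>\<xi>. fourier u \<xi> * fourier v \<xi> * cis (\<xi> \<bullet> x) \<partial>lborel)"
      unfolding L_def
    proof (rule integral_dominated_convergence)
      show "integrable lborel (\<lambda>\<xi>. norm (fourier u \<xi> * fourier v \<xi>))" using iP by auto
      show "AE \<xi> in lborel. (\<lambda>n. damping (e n) \<xi> * fourier u \<xi> * fourier v \<xi> * cis (\<xi> \<bullet> x)) \<longlonglongrightarrow> fourier u \<xi> * fourier v \<xi> * cis (\<xi> \<bullet> x)"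
      proof (rule AE_I2)
        fix \<xi> :: 'a
        have "(\<lambda>n. complex_of_real (exp (- (e n * norm \<xi>)\<^sup>2 / 2)) * fourier u \<xi> * fourier v \<xi> * cis (\<xi> \<bullet> x))
          \<longlonglongrightarrow> complex_of_real (exp (- (0 * norm \<xi>)\<^sup>2 / 2)) * fourier u \<xi> * fourier v \<xi> * cis (\<xi> \<bullet> x)"
          by (intro tendsto_intros e) simp
        then show "(\<lambda>n. damping (e n) \<xi> * fourier u \<xi> * fourier v \<xi> * cis (\<xi> \<bullet> x)) \<longlonglongrightarrow> fourier u \<xi> * fourier v \<xi> * cis (\<xi> \<bullet> x)"
          by (simp add: damping_def)
      qed
      show "AE \<xi> in lborel. norm (damping (e n) \<xi> * fourier u \<xi> * fourier v \<xi> * cis (\<xi> \<bullet> x)) \<le> norm (fourier u \<xi> * fourier v \<xi>)" for n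
        by (intro AE_I2) (simp add: norm_mult mult.assoc mult_left_le_one_le norm_damping)
    qed measurable
    define S where "S n z = (\<integral>r. complex_of_real (c * gauss r) * u (z - e n *\<^sub>R r) \<partial>lborel)" for n z
    have LS: "L n = (\<integral>t. v t * S n (x - t) \<partial>lborel)" for n
    proof -
      have iD: "integrable lborel (\<lambda>\<xi>. damping (e n) \<xi> * fourier u \<xi>)"
        by (intro integrable_mult_bounded[OF integrable_damping[OF e(1)] _ norm_fourier_le[OF u]]) simp
      have "S n z = (\<integral>\<xi>. damping (e n) \<xi> * fourier u \<xi> * cis (\<xi> \<bullet> z) \<partial>lborel)" for z
      proof -
        let ?H = "\<lambda>s. u s * complex_of_real (c * (inverse (e n) ^ DIM('a) * gauss (inverse (e n) *\<^sub>R (z - s))))"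
        have "(\<integral>s. ?H s \<partial>lborel) = \<bar>- e n\<bar> ^ DIM('a) *\<^sub>R (\<integral>r. ?H (z + (- e n) *\<^sub>R r) \<partial>lborel)"
          using e(1)[of n] by (intro integral_lborel_affine) auto
        also have "\<dots> = S n z"
          unfolding S_def using e(1)[of n]
          by (simp flip: integral_scaleR_right add: scaleR_conv_of_real power_inverse[symmetric] field_simps)
        finally show ?thesis
          unfolding damped_transform_fourier[OF u e(1)] c_def by simp
      qed
      then show ?thesis unfolding L_def fourier_fubini[OF iD v, symmetric] by simp
    qed
    have gi: "integrable lborel (\<lambda>r::'a. c * gauss r)" "integral\<^sup>L lborel (\<lambda>r::'a. c * gauss r) = c"
    proof -
      have "integrable lborel (gauss :: 'a \<Rightarrow> real)" using integrable_gauss integrable_Re by force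
      moreover from this have "ennreal (integral\<^sup>L lborel (gauss :: 'a \<Rightarrow> real)) = 1"
        using nn_integral_gauss[where 'a='a] nn_integral_eq_integral[of lborel "gauss :: 'a \<Rightarrow> real"] by simp
      ultimately show "integrable lborel (\<lambda>r::'a. c * gauss r)" "integral\<^sup>L lborel (\<lambda>r::'a. c * gauss r) = c"
        by (auto simp: ennreal_eq_1)
    qed
    have Sb: "norm (S n z) \<le> c * M" for n z
    proof -
      have "norm (S n z) \<le> (\<integral>r. norm (complex_of_real (c * gauss r) * u (z - e n *\<^sub>R r)) \<partial>lborel)"
        unfolding S_def by (rule integral_norm_bound)
      also have "\<dots> \<le> integral\<^sup>L lborel (\<lambda>r::'a. c * gauss r * M)"
      proof (rule integral_mono')
        show "integrable lborel (\<lambda>r::'a. c * gauss r * M)" using gi(1) by simp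
        have "M \<ge> 0" using bu norm_ge_zero order_trans by blast
        then show "0 \<le> c * gauss r * M" for r :: 'a using c by simp
        show "norm (complex_of_real (c * gauss r) * u (z - e n *\<^sub>R r)) \<le> c * gauss r * M" for r
          using bu c by (auto simp: norm_mult intro!: mult_left_mono)
      qed
      also have "\<dots> = c * M" using gi(2) by simp
      finally show ?thesis .
    qed
    have Sl: "(\<lambda>n. S n z) \<longlonglongrightarrow> c * u z" for z
    proof -
      have "(\<lambda>n. S n z) \<longlonglongrightarrow> integral\<^sup>L lborel (\<lambda>r::'a. complex_of_real (c * gauss r) * u z)"
        unfolding S_def
      proof (rule integral_dominated_convergence)
        show "integrable lborel (\<lambda>r::'a. c * gauss r * M)" using gi(1) by auto
        show "AE r in lborel. (\<lambda>n. complex_of_real (c * gauss r) * u (z - e n *\<^sub>R r)) \<longlonglongrightarrow> complex_of_real (c * gauss r) * u z"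
        proof (rule AE_I2)
          fix r :: 'a
          have "(\<lambda>n. z - e n *\<^sub>R r) \<longlonglongrightarrow> z - 0 *\<^sub>R r" by (intro tendsto_intros e)
          then have "(\<lambda>n. u (z - e n *\<^sub>R r)) \<longlonglongrightarrow> u z"
            using cu by (intro continuous_on_tendsto_compose[OF cu]) auto
          then show "(\<lambda>n. complex_of_real (c * gauss r) * u (z - e n *\<^sub>R r)) \<longlonglongrightarrow> complex_of_real (c * gauss r) * u z"
            by (intro tendsto_intros)
        qed
        show "AE r in lborel. norm (complex_of_real (c * gauss r) * u (z - e n *\<^sub>R r)) \<le> c * gauss r * M" for n
          using bu c by (auto simp: norm_mult intro!: mult_left_mono)
      qed measurable
      moreover have "integral\<^sup>L lborel (\<lambda>r::'a. complex_of_real (c * gauss r) * u z) = c * u z"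
        using gi by (simp only: integral_mult_left_zero integral_complex_of_real)
      ultimately show ?thesis by (simp only:)
    qed
    have "L \<longlonglongrightarrow> (\<integral>t. v t * (c * u (x - t)) \<partial>lborel)"
      unfolding LS
    proof (rule integral_dominated_convergence)
      show "integrable lborel (\<lambda>t. norm (v t) * (c * M))" using v by auto
      show "AE t in lborel. (\<lambda>n. v t * S n (x - t)) \<longlonglongrightarrow> v t * (c * u (x - t))"
        by (intro AE_I2 tendsto_intros Sl)
      show "AE t in lborel. norm (v t * S n (x - t)) \<le> norm (v t) * (c * M)" for n
        using Sb by (auto simp: norm_mult intro!: mult_left_mono)
    qed (unfold S_def, measurable)
    from LIMSEQ_unique[OF L1 this] show ?thesis by (simp add: mult_ac flip: integral_mult_right_zero)
  qed
  define g where "g \<xi> = inverse (complex_of_real c) * (fourier u \<xi> * fourier v \<xi>)" for \<xi>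
  show ?thesis unfolding wiener_bound_def
  proof (intro exI[of _ g] conjI allI)
    show "integrable lborel g" unfolding g_def using iP by auto
    have "(\<integral>x. norm (g x) \<partial>lborel) = inverse c * (\<integral>\<xi>. norm (fourier u \<xi> * fourier v \<xi>) \<partial>lborel)"
      using c by (simp add: g_def norm_mult norm_inverse)
    also have "\<dots> \<le> inverse c * (c * (U * V))" using nP c by (intro mult_left_mono) auto
    also have "inverse c * (c * (U * V)) = U * V" using c by simp
    finally show "(\<integral>x. norm (g x) \<partial>lborel) \<le> U * V" .
    fix y
    have "(\<integral>x. g x * cis (x \<bullet> y) \<partial>lborel) = inverse (complex_of_real c) * (\<integral>\<xi>. fourier u \<xi> * fourier v \<xi> * cis (\<xi> \<bullet> y) \<partial>lborel)"
      by (simp add: g_def mult.assoc flip: integral_mult_right_zero)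
    then show "(\<integral>t. v t * u (y - t) \<partial>lborel) = (\<integral>x. g x * cis (x \<bullet> y) \<partial>lborel)"
      unfolding key using c by simp
  qed
qed

text \<open>
  A square-integrable \<open>u\<close> is the limit of its products with cutoff functions, chosen
  along a sequence of radii that grows so fast that the \<open>L\<^sub>2\<close> norms of the successive
  differences are dominated by a geometric series.
\<close>
lemma wiener_bound_convolution:
  fixes u v :: "'a::euclidean_space \<Rightarrow> complex"
  assumes cu: "continuous_on UNIV u" and bu: "\<And>x. norm (u x) \<le> M"
    and u2: "(\<integral>\<^sup>+t. ennreal ((norm (u t))\<^sup>2) \<partial>lborel) \<le> ennreal (U\<^sup>2)"
    and v: "integrable lborel v" and v2: "(\<integral>\<^sup>+t. ennreal ((norm (v t))\<^sup>2) \<partial>lborel) \<le> ennreal (V\<^sup>2)"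
    and pos: "U > 0" "V > 0"
  shows "wiener_bound (\<lambda>x. \<integral>t. v t * u (x - t) \<partial>lborel) (3 * U * V)"
proof -
  have mu[measurable]: "u \<in> borel_measurable borel" by (rule borel_measurable_continuous_onI[OF cu])
  have [measurable]: "v \<in> borel_measurable borel" using v by auto
  have M0: "M \<ge> 0" using bu norm_ge_zero order_trans by blast
  note U2 = integral_le_if_nn_integral_le[OF u2]
  have iU: "integrable lborel (\<lambda>t. (norm (u t))\<^sup>2)" using U2 by simp
  (* continuous cutoff functions with compact support that increase to 1 *)
  define ct where "ct = (\<lambda>n (x::'a). max 0 (1 - norm x / real (Suc n)))"
  have ctc: "continuous_on UNIV (ct n)" for n unfolding ct_def by (intro continuous_intros) auto
  have [measurable]: "ct n \<in> borel_measurable borel" for n by (rule borel_measurable_continuous_onI[OF ctc])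
  have ct01: "0 \<le> ct n x" "ct n x \<le> 1" for n x by (auto simp: ct_def)
  have ctmono: "ct m x \<le> ct n x" if "m \<le> n" for m n x
    unfolding ct_def using that by (intro max.mono order_refl diff_mono divide_left_mono) auto
  have ctlim: "(\<lambda>n. ct n x) \<longlonglongrightarrow> 1" for x
  proof -
    have "(\<lambda>n. max 0 (1 - norm x * inverse (real (Suc n)))) \<longlonglongrightarrow> max 0 (1 - norm x * 0)"
      by (intro tendsto_intros LIMSEQ_inverse_real_of_nat)
    then show ?thesis by (simp add: ct_def divide_inverse)
  qed
  have ctsupp: "ct n x = 0" if "x \<notin> cball 0 (real (Suc n))" for n x
    using that by (auto simp: ct_def field_simps)
  define T where "T n = (\<integral>x. ((1 - ct n x) * norm (u x))\<^sup>2 \<partial>lborel)" for n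
  have bT: "((1 - ct n x) * norm (u x))\<^sup>2 \<le> (norm (u x))\<^sup>2" for n x
    using ct01[of n x] by (intro power_mono) (auto intro: mult_left_le_one_le)
  have iT: "integrable lborel (\<lambda>x. ((1 - ct n x) * norm (u x))\<^sup>2)" for n
    by (rule Bochner_Integration.integrable_bound[OF iU]) (use bT in \<open>auto intro!: AE_I2\<close>)
  have "T \<longlonglongrightarrow> integral\<^sup>L (lborel::'a measure) (\<lambda>_. 0)"
    unfolding T_def
  proof (rule integral_dominated_convergence[OF _ _ iU])
    show "AE x in lborel. (\<lambda>n. ((1 - ct n x) * norm (u x))\<^sup>2) \<longlonglongrightarrow> 0"
    proof (rule AE_I2)
      fix x :: 'a
      have "(\<lambda>n. ((1 - ct n x) * norm (u x))\<^sup>2) \<longlonglongrightarrow> ((1 - 1) * norm (u x))\<^sup>2" by (intro tendsto_intros ctlim)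
      then show "(\<lambda>n. ((1 - ct n x) * norm (u x))\<^sup>2) \<longlonglongrightarrow> 0" by simp
    qed
  qed (use bT in auto)
  then have T0: "T \<longlonglongrightarrow> 0" by simp
  have "\<forall>j. \<exists>N. \<forall>n\<ge>N. T n < (U * (1 / 2) ^ j)\<^sup>2"
    using order_tendstoD(2)[OF T0] pos unfolding eventually_sequentially by simp
  then obtain N where N: "\<And>j n. n \<ge> N j \<Longrightarrow> T n < (U * (1 / 2) ^ j)\<^sup>2" by metis
  (* the summand j makes the radii tend to infinity, the sum makes them dominate N and increase *)
  define R where "R j = j + (\<Sum>i\<le>j. N i)" for j
  have R: "N j \<le> R j" "R j \<le> R (Suc j)" for j
    unfolding R_def by (auto intro: trans_le_add2 member_le_sum)
  have Rlim: "filterlim R at_top sequentially"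
    by (rule filterlim_at_top_mono[OF filterlim_ident]) (simp add: R_def)
  define w where "w j x = (if j = 0 then of_real (ct (R 0) x) else of_real (ct (R j) x - ct (R (j - 1)) x)) * u x" for j x
  (* the bounds U, U, U/2, U/4, ... of the pieces, with sum 3 * U *)
  define W where "W j = (if j = 0 then U else U * (1 / 2) ^ (j - 1))" for j
  have Wpos: "W j > 0" for j using pos by (simp add: W_def)
  have Wsum: "W sums (3 * U)"
  proof -
    have "(\<lambda>j. W (Suc j)) sums (U * (1 / (1 - 1 / 2)))"
      using sums_mult[OF geometric_sums[of "1 / 2 :: real"], of U] by (simp add: W_def)
    then have "W sums (U * (1 / (1 - 1 / 2)) + W 0)" by (rule sums_Suc)
    then show ?thesis by (simp add: W_def)
  qed
  have wb: "wiener_bound (\<lambda>x. \<integral>t. v t * w j (x - t) \<partial>lborel) (W j * V)" for j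
  proof (rule wiener_bound_convolution_L1)
    show cw: "continuous_on UNIV (w j)"
      unfolding w_def by (cases "j = 0") (auto intro!: continuous_intros ctc cu)
    have coeff: "norm (w j x) \<le> norm (u x)" for x
    proof -
      have "\<bar>ct (R j) x - ct (R (j - 1)) x\<bar> \<le> 1" using ct01[of "R j" x] ct01[of "R (j - 1)" x] by (simp add: abs_le_iff)
      then show ?thesis using ct01[of "R 0" x]
        unfolding w_def by (auto simp: norm_mult simp flip: of_real_diff intro!: mult_left_le_one_le)
    qed
    then show "norm (w j x) \<le> M" for x using bu order_trans by blast
    show "integrable lborel (w j)"
    proof (rule Bochner_Integration.integrable_bound)
      show "integrable lborel (\<lambda>x::'a. M * indicator (cball 0 (real (Suc (R j)))) x)"
        using emeasure_bounded_finite[OF bounded_cball] by (intro integrable_mult_right integrable_real_indicator) auto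
      show "w j \<in> borel_measurable lborel" using cw borel_measurable_continuous_onI by auto
      have "w j x = 0" if "x \<notin> cball 0 (real (Suc (R j)))" for x
      proof -
        have "R (j - 1) \<le> R j" using R(2)[of "j - 1"] by (cases j) auto
        then have "ct (R (j - 1)) x = 0" using ctmono[of "R (j - 1)" "R j" x] ctsupp[OF that] ct01(1)[of "R (j - 1)" x] by simp
        then show ?thesis using ctsupp[OF that] by (cases "j = 0") (simp_all add: w_def)
      qed
      then show "AE x in lborel. norm (w j x) \<le> norm (M * indicator (cball 0 (real (Suc (R j)))) x)"
        using coeff bu M0 by (intro AE_I2) (auto simp: indicator_def intro: order_trans)
    qed
    show "(\<integral>\<^sup>+t. ennreal ((norm (w j t))\<^sup>2) \<partial>lborel) \<le> ennreal ((W j)\<^sup>2)"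
    proof (cases "j = 0")
      case True
      have "(\<integral>\<^sup>+t. ennreal ((norm (w j t))\<^sup>2) \<partial>lborel) \<le> (\<integral>\<^sup>+t. ennreal ((norm (u t))\<^sup>2) \<partial>lborel)"
        using coeff by (intro nn_integral_mono ennreal_leI power_mono) auto
      with u2 show ?thesis using True by (auto simp: W_def)
    next
      case False
      then obtain i where i: "j = Suc i" by (cases j) auto
      have "norm (w j x) \<le> (1 - ct (R i) x) * norm (u x)" for x
        using ctmono[OF R(2)[of i], of x] ct01(2)[of "R (Suc i)" x]
        unfolding w_def i by (auto simp: norm_mult simp flip: of_real_diff intro!: mult_right_mono)
      then have "(\<integral>\<^sup>+t. ennreal ((norm (w j t))\<^sup>2) \<partial>lborel) \<le> (\<integral>\<^sup>+t. ennreal (((1 - ct (R i) t) * norm (u t))\<^sup>2) \<partial>lborel)"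
        by (intro nn_integral_mono ennreal_leI power_mono) auto
      also have "\<dots> = ennreal (T (R i))" unfolding T_def by (rule nn_integral_eq_integral[OF iT]) simp
      also have "\<dots> \<le> ennreal ((W j)\<^sup>2)"
        using N[OF R(1), of i] by (intro ennreal_leI) (simp add: W_def i)
      finally show ?thesis .
    qed
  qed (use v v2 pos Wpos in auto)
  have "wiener_bound (\<lambda>x. \<integral>t. v t * u (x - t) \<partial>lborel) (\<Sum>j. W j * V)"
  proof (rule wiener_bound_series[OF wb])
    show "summable (\<lambda>j. W j * V)" using Wsum by (intro summable_mult2) (auto simp: sums_iff)
    fix y
    have part: "(\<Sum>j<Suc n. w j x) = of_real (ct (R n) x) * u x" for n x
      by (induction n) (auto simp: w_def algebra_simps)
    have iw: "integrable lborel (\<lambda>t. v t * w j (y - t))" for j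
    proof (rule integrable_mult_bounded[OF v])
      have "continuous_on UNIV (w j)" unfolding w_def by (cases "j = 0") (auto intro!: continuous_intros ctc cu)
      then have [measurable]: "w j \<in> borel_measurable borel" by (rule borel_measurable_continuous_onI)
      show "(\<lambda>t. w j (y - t)) \<in> borel_measurable lborel" by measurable
      have "\<bar>ct (R j) x - ct (R (j - 1)) x\<bar> \<le> 1" for x using ct01[of "R j" x] ct01[of "R (j - 1)" x] by (simp add: abs_le_iff)
      then show "norm (w j (y - x)) \<le> M" for x using ct01[of "R 0" "y - x"] bu
        unfolding w_def by (auto simp: norm_mult simp flip: of_real_diff intro!: order_trans[OF mult_left_le_one_le])
    qed
    have "(\<lambda>n. \<integral>t. v t * (of_real (ct (R n) (y - t)) * u (y - t)) \<partial>lborel) \<longlonglongrightarrow> (\<integral>t. v t * u (y - t) \<partial>lborel)"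
    proof (rule integral_dominated_convergence)
      show "integrable lborel (\<lambda>t. norm (v t) * M)" using v by auto
      show "AE t in lborel. (\<lambda>n. v t * (of_real (ct (R n) (y - t)) * u (y - t))) \<longlonglongrightarrow> v t * u (y - t)"
      proof (rule AE_I2)
        fix t :: 'a
        have "(\<lambda>n. ct (R n) (y - t)) \<longlonglongrightarrow> 1" by (rule filterlim_compose[OF ctlim Rlim])
        then have "(\<lambda>n. v t * (of_real (ct (R n) (y - t)) * u (y - t))) \<longlonglongrightarrow> v t * (of_real 1 * u (y - t))"
          by (intro tendsto_intros)
        then show "(\<lambda>n. v t * (of_real (ct (R n) (y - t)) * u (y - t))) \<longlonglongrightarrow> v t * u (y - t)" by simp
      qed
      show "AE t in lborel. norm (v t * (of_real (ct (R n) (y - t)) * u (y - t))) \<le> norm (v t) * M" for n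
        using bu ct01[of "R n"] by (intro AE_I2) (auto simp: norm_mult intro!: mult_left_mono order_trans[OF mult_left_le_one_le])
    qed measurable
    moreover have "(\<Sum>j<Suc n. \<integral>t. v t * w j (y - t) \<partial>lborel) = (\<integral>t. v t * (of_real (ct (R n) (y - t)) * u (y - t)) \<partial>lborel)" for n
      using iw unfolding part[symmetric] by (simp add: sum_distrib_left del: sum.lessThan_Suc)
    ultimately have "(\<lambda>n. \<Sum>j<Suc n. \<integral>t. v t * w j (y - t) \<partial>lborel) \<longlonglongrightarrow> (\<integral>t. v t * u (y - t) \<partial>lborel)" by simp
    then show "(\<lambda>j. \<integral>t. v t * w j (y - t) \<partial>lborel) sums (\<integral>t. v t * u (y - t) \<partial>lborel)"
      unfolding sums_def by (subst filterlim_sequentially_Suc[symmetric])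
  qed
  moreover have "(\<Sum>j. W j * V) = 3 * U * V" using sums_mult2[OF Wsum, of V] by (simp add: sums_iff)
  ultimately show ?thesis by simp
qed

section \<open>Partial derivatives off the coordinate hyperplanes\<close>

lemma coord_upd_eq: "coord_upd x j t = x + (t - x $ j) *\<^sub>R axis j 1"
  by (simp add: coord_upd_def vec_eq_iff axis_def)

lemma coord_upd_nth: "coord_upd x j t $ i = (if i = j then t else x $ i)"
  by (simp add: coord_upd_def)

lemma coord_upd_same[simp]: "coord_upd x j t $ j = t" by (simp add: coord_upd_nth)

lemma coord_upd_upd[simp]: "coord_upd (coord_upd x j s) j t = coord_upd x j t"
  by (simp add: coord_upd_def vec_eq_iff)

lemma coord_upd_commute: "i \<noteq> j \<Longrightarrow> coord_upd (coord_upd x i s) j t = coord_upd (coord_upd x j t) i s"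
  by (simp add: coord_upd_def vec_eq_iff)

lemma coord_upd_id[simp]: "coord_upd x j (x $ j) = x"
  by (simp add: coord_upd_def vec_eq_iff)

lemma partial_coord_upd: "partial j u (coord_upd x j t) = vector_derivative (\<lambda>s. u (coord_upd x j s)) (at t)"
  by (simp add: partial_def)

lemma tendsto_coord_upd[tendsto_intros]:
  "(f \<longlongrightarrow> x) F \<Longrightarrow> (g \<longlongrightarrow> t) F \<Longrightarrow> ((\<lambda>n. coord_upd (f n) j (g n)) \<longlongrightarrow> coord_upd x j t) F"
  unfolding coord_upd_eq by (intro tendsto_intros)

lemma measurable_coord_upd[measurable (raw)]:
  assumes [measurable]: "f \<in> borel_measurable M" "g \<in> borel_measurable M"
  shows "(\<lambda>n. coord_upd (f n) j (g n)) \<in> borel_measurable M"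
proof -
  have "(\<lambda>n. f n $ j) \<in> borel_measurable M"
    by (rule measurable_compose[OF assms(1)]) (intro borel_measurable_continuous_onI continuous_intros)
  then show ?thesis unfolding coord_upd_eq by measurable
qed

lemma measurable_vec_nth[measurable (raw)]:
  assumes [measurable]: "f \<in> borel_measurable M"
  shows "(\<lambda>n. (f n :: real^'n) $ j) \<in> borel_measurable M"
  by (rule measurable_compose[OF assms(1)]) (intro borel_measurable_continuous_onI continuous_intros)

definition off_axes :: "(real^'n) set" where "off_axes = {y. \<forall>i. y $ i \<noteq> 0}"

lemma off_axes_borel[measurable]: "off_axes \<in> sets borel"
  unfolding off_axes_def by measurable

lemma coord_upd_off_axes: "y \<in> off_axes \<Longrightarrow> t \<noteq> 0 \<Longrightarrow> coord_upd y j t \<in> off_axes"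
  by (simp add: off_axes_def coord_upd_nth)

lemma AE_off_axes: "AE y in lborel. y \<in> (off_axes :: (real^'n) set)"
proof -
  have "AE y in lborel. (y::real^'n) $ i \<noteq> 0" for i :: 'n
  proof (rule AE_I')
    have "negligible {y::real^'n. y $ i = 0}" by (rule negligible_standard_hyperplane_cart)
    moreover have "{y::real^'n. y $ i = 0} \<in> sets borel" by measurable
    ultimately show "{y::real^'n. y $ i = 0} \<in> null_sets lborel"
      by (simp add: negligible_iff_null_sets null_sets_completion_iff)
  qed auto
  then have "AE y in lborel. \<forall>i\<in>UNIV. (y::real^'n) $ i \<noteq> 0" by (intro AE_finite_allI) auto
  then show ?thesis by (simp add: off_axes_def)
qed

text \<open>
  In the direction \<open>j\<close>, and on each side of the hyperplane \<open>y $ j = 0\<close>, \<open>u\<close> is an indefinite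
  integral of \<open>w\<close>.  Only points off the coordinate hyperplanes matter, and \<open>w\<close> may be changed on
  null sets of the lines in direction \<open>j\<close>.
\<close>
definition partial_integral :: "'n \<Rightarrow> (real^'n \<Rightarrow> complex) \<Rightarrow> (real^'n \<Rightarrow> complex) \<Rightarrow> bool" where
  "partial_integral j u w \<longleftrightarrow> (\<forall>y a b. (\<forall>i. i \<noteq> j \<longrightarrow> y $ i \<noteq> 0) \<longrightarrow> a \<le> b \<longrightarrow> 0 \<notin> {a..b} \<longrightarrow>
     set_integrable lborel {a..b} (\<lambda>t. w (coord_upd y j t)) \<and>
     u (coord_upd y j b) - u (coord_upd y j a) = (LINT t:{a..b}|lborel. w (coord_upd y j t)))"

lemma partial_integralD:
  assumes "partial_integral j u w" "\<And>i. i \<noteq> j \<Longrightarrow> y $ i \<noteq> 0" "a \<le> b" "0 \<notin> {a..b}"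
  shows "set_integrable lborel {a..b} (\<lambda>t. w (coord_upd y j t))"
    "u (coord_upd y j b) - u (coord_upd y j a) = (LINT t:{a..b}|lborel. w (coord_upd y j t))"
  using assms unfolding partial_integral_def by blast+

lemma locally_AC_D:
  assumes "locally_AC_off_axes u" "\<And>i. i \<noteq> j \<Longrightarrow> y $ i \<noteq> 0" "a \<le> b" "0 \<notin> {a..b}"
  shows "abs_continuous_on {a..b} (\<lambda>t. u (coord_upd y j t))"
  using assms unfolding locally_AC_off_axes_def by blast

text \<open>
  A Borel version of the partial derivative: the limit is taken along one fixed sequence of
  increments, which preserves Borel measurability.  A merely Lebesgue measurable derivative could
  not be integrated along every coordinate line.
\<close>
definition borel_partial :: "'n \<Rightarrow> (real^'n \<Rightarrow> complex) \<Rightarrow> real^'n \<Rightarrow> complex" where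
  "borel_partial j v y = indicator off_axes y *\<^sub>R
     lim (\<lambda>n. real (Suc n) *\<^sub>R (v (coord_upd y j (y $ j + inverse (real (Suc n)))) - v y))"

lemma borel_partial_measurable:
  assumes [measurable]: "v \<in> borel_measurable borel"
  shows "borel_partial j v \<in> borel_measurable borel"
  unfolding borel_partial_def by measurable

text \<open>
  The increments of the \<open>j\<close>-th coordinate are eventually so small that the moved point is again off
  the axes, where \<open>v\<close> and \<open>u\<close> agree.
\<close>
lemma borel_partial_eq:
  assumes y: "y \<in> off_axes" and uv: "\<And>y. y \<in> off_axes \<Longrightarrow> v y = u y"
    and D: "((\<lambda>t. u (coord_upd y j t)) has_vector_derivative D) (at (y $ j))"
  shows "borel_partial j v y = D"
proof -
  let ?h = "\<lambda>n. inverse (real (Suc n))"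
  have lim: "(\<lambda>n. (u (coord_upd y j (y $ j + ?h n)) - u (coord_upd y j (y $ j))) /\<^sub>R ?h n) \<longlonglongrightarrow> D"
  proof -
    have "((\<lambda>h. (u (coord_upd y j (y $ j + h)) - u (coord_upd y j (y $ j))) /\<^sub>R h) \<longlongrightarrow> D) (at 0)"
    proof (rule LIM_zero_cancel, rule tendsto_norm_zero_cancel, rule Lim_transform_eventually)
      let ?f = "\<lambda>t. u (coord_upd y j t)"
      show "((\<lambda>h. norm (?f (y $ j + h) - ?f (y $ j) - h *\<^sub>R D) / norm h) \<longlongrightarrow> 0) (at 0)"
        using D unfolding has_vector_derivative_def has_derivative_at by blast
      have "norm (?f (y $ j + h) - ?f (y $ j) - h *\<^sub>R D) / norm h = norm ((?f (y $ j + h) - ?f (y $ j)) /\<^sub>R h - D)"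
        if "h \<noteq> 0" for h
      proof -
        have "(?f (y $ j + h) - ?f (y $ j)) /\<^sub>R h - D = (?f (y $ j + h) - ?f (y $ j) - h *\<^sub>R D) /\<^sub>R h"
          using that by (simp add: scaleR_diff_right)
        then show ?thesis by (simp add: divide_inverse mult.commute)
      qed
      then show "\<forall>\<^sub>F h in at 0. norm (?f (y $ j + h) - ?f (y $ j) - h *\<^sub>R D) / norm h
        = norm ((?f (y $ j + h) - ?f (y $ j)) /\<^sub>R h - D)"
        by (simp add: eventually_at_filter)
    qed
    moreover have "filterlim ?h (at 0) sequentially"
      unfolding filterlim_at using LIMSEQ_inverse_real_of_nat by (auto intro!: always_eventually)
    ultimately show ?thesis by (rule filterlim_compose)
  qed
  have "y $ j \<noteq> 0" using y by (simp add: off_axes_def)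
  have "(\<lambda>n. y $ j + ?h n) \<longlonglongrightarrow> y $ j + 0" by (intro tendsto_intros LIMSEQ_inverse_real_of_nat)
  then have ev: "\<forall>\<^sub>F n in sequentially. y $ j + ?h n \<noteq> 0"
    using \<open>y $ j \<noteq> 0\<close> by (intro tendsto_imp_eventually_ne) auto
  have "(\<lambda>n. real (Suc n) *\<^sub>R (v (coord_upd y j (y $ j + ?h n)) - v y)) \<longlonglongrightarrow> D"
  proof (rule Lim_transform_eventually[OF lim])
    show "\<forall>\<^sub>F n in sequentially. (u (coord_upd y j (y $ j + ?h n)) - u (coord_upd y j (y $ j))) /\<^sub>R ?h n
      = real (Suc n) *\<^sub>R (v (coord_upd y j (y $ j + ?h n)) - v y)"
      using ev
    proof eventually_elim
      case (elim n)
      then have "coord_upd y j (y $ j + ?h n) \<in> off_axes" by (rule coord_upd_off_axes[OF y])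
      then show ?case using uv y by simp
    qed
  qed
  then show ?thesis using y by (simp add: borel_partial_def limI)
qed

text \<open>
  The first two claims restate the theory of absolutely continuous functions on the lines in
  direction \<open>j\<close>.  For the third, \<open>u\<close> is an indefinite integral of the continuous function
  \<open>partial j u\<close> on each line, hence differentiable at every point off the axes.
\<close>
lemma locally_AC_partial_integral:
  fixes u v :: "real^'n \<Rightarrow> complex"
  assumes ac: "locally_AC_off_axes u" and v[measurable]: "v \<in> borel_measurable borel"
    and uv: "\<And>y. y \<in> off_axes \<Longrightarrow> v y = u y"
  shows "partial_integral j v (borel_partial j v)"
    and "\<And>y. (\<And>i. i \<noteq> j \<Longrightarrow> y $ i \<noteq> 0) \<Longrightarrow>
      AE t in lborel. t \<noteq> 0 \<longrightarrow> borel_partial j v (coord_upd y j t) = partial j u (coord_upd y j t)"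
    and "\<And>y. locally_AC_off_axes (partial j u) \<Longrightarrow> y \<in> off_axes \<Longrightarrow> borel_partial j v y = partial j u y"
proof -
  note [measurable] = borel_partial_measurable[OF v, of j]
  have off: "coord_upd y j t \<in> off_axes" if "\<And>i. i \<noteq> j \<Longrightarrow> y $ i \<noteq> 0" "t \<noteq> 0" for y :: "real^'n" and t
    using that by (auto simp: off_axes_def coord_upd_nth)
  have eqD: "borel_partial j v (coord_upd y j t) = vector_derivative (\<lambda>t. u (coord_upd y j t)) (at t)"
    if "\<And>i. i \<noteq> j \<Longrightarrow> y $ i \<noteq> 0" "t \<noteq> 0" "(\<lambda>t. u (coord_upd y j t)) differentiable (at t)" for y t
    by (rule borel_partial_eq[OF off uv]) (use that in \<open>auto simp: vector_derivative_works[symmetric]\<close>)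
  have neg: "negligible {t \<in> {a<..<b}. borel_partial j v (coord_upd y j t) \<noteq> vector_derivative (\<lambda>t. u (coord_upd y j t)) (at t)}"
    if y: "\<And>i. i \<noteq> j \<Longrightarrow> y $ i \<noteq> 0" and ab: "a \<le> b" "0 \<notin> {a..b}" for y a b
  proof (rule negligible_subset[OF abs_continuous_AE_differentiable[OF locally_AC_D[OF ac y ab]]])
    show "{t \<in> {a<..<b}. borel_partial j v (coord_upd y j t) \<noteq> vector_derivative (\<lambda>t. u (coord_upd y j t)) (at t)}
      \<subseteq> {t \<in> {a<..<b}. \<not> (\<lambda>t. u (coord_upd y j t)) differentiable (at t)}"
    proof clarify
      fix t assume t: "t \<in> {a<..<b}" and ne: "borel_partial j v (coord_upd y j t) \<noteq> vector_derivative (\<lambda>t. u (coord_upd y j t)) (at t)"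
        and d: "(\<lambda>t. u (coord_upd y j t)) differentiable (at t)"
      have "t \<noteq> 0" using t ab by auto
      from eqD[OF y this d] ne show False by blast
    qed
  qed
  show "partial_integral j v (borel_partial j v)"
    unfolding partial_integral_def
  proof (intro allI impI)
    fix y :: "real^'n" and a b :: real
    assume y': "\<forall>i. i \<noteq> j \<longrightarrow> y $ i \<noteq> 0" and ab: "a \<le> b" "0 \<notin> {a..b}"
    then have y: "\<And>i. i \<noteq> j \<Longrightarrow> y $ i \<noteq> 0" by blast
    let ?h = "\<lambda>t. u (coord_upd y j t)" and ?w = "\<lambda>t. borel_partial j v (coord_upd y j t)"
    note acab = locally_AC_D[OF ac y ab]
    have N: "negligible ({a, b} \<union> {t \<in> {a<..<b}. ?w t \<noteq> vector_derivative ?h (at t)})"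
      using neg[OF y ab] by (intro negligible_Un) auto
    have "?w absolutely_integrable_on {a..b}"
      by (rule absolutely_integrable_spike[OF abs_continuous_derivative_absolutely_integrable[OF acab] N]) auto
    then have si: "set_integrable lborel {a..b} ?w"
      unfolding set_integrable_def by (subst (asm) integrable_completion) auto
    have "(?w has_integral (?h b - ?h a)) {a..b}"
      by (rule has_integral_spike[OF N _ abs_continuous_FTC[OF acab ab(1)]]) auto
    then have "(LINT t:{a..b}|lborel. ?w t) = ?h b - ?h a"
      using set_borel_integral_eq_integral(2)[OF si] by (simp add: integral_unique)
    moreover have "a \<noteq> 0" "b \<noteq> 0" using ab by auto
    then have "v (coord_upd y j b) = ?h b" "v (coord_upd y j a) = ?h a" using uv off y by blast+
    ultimately show "set_integrable lborel {a..b} ?w \<and> v (coord_upd y j b) - v (coord_upd y j a) = (LINT t:{a..b}|lborel. ?w t)"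
      using si by simp
  qed
  show "AE t in lborel. t \<noteq> 0 \<longrightarrow> borel_partial j v (coord_upd y j t) = partial j u (coord_upd y j t)"
    if y: "\<And>i. i \<noteq> j \<Longrightarrow> y $ i \<noteq> 0" for y
  proof -
    let ?P = "\<lambda>t. borel_partial j v (coord_upd y j t) \<noteq> vector_derivative (\<lambda>t. u (coord_upd y j t)) (at t)"
    have "negligible (\<Union>n::nat. {t \<in> {inverse (real (Suc n))<..<real (Suc n)}. ?P t} \<union> {t \<in> {- real (Suc n)<..<- inverse (real (Suc n))}. ?P t})"
    proof (intro negligible_Union_nat negligible_Un neg[OF y])
      fix n :: nat
      have "inverse (real (Suc n)) \<le> 1" by (simp add: field_simps)
      also have "1 \<le> real (Suc n)" by simp
      finally show "inverse (real (Suc n)) \<le> real (Suc n)" "- real (Suc n) \<le> - inverse (real (Suc n))" by auto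
    qed auto
    then have "negligible {t. t \<noteq> 0 \<and> ?P t}"
    proof (rule negligible_subset, intro subsetI)
      fix t assume t: "t \<in> {t. t \<noteq> 0 \<and> ?P t}"
      obtain n where n: "inverse (real (Suc n)) < \<bar>t\<bar>" using t reals_Archimedean[of "\<bar>t\<bar>"] by auto
      obtain m where m: "\<bar>t\<bar> < real m" using reals_Archimedean2 by blast
      let ?k = "max n m"
      have "inverse (real (Suc ?k)) \<le> inverse (real (Suc n))" by (intro le_imp_inverse_le) auto
      then have "inverse (real (Suc ?k)) < \<bar>t\<bar>" using n by linarith
      moreover have "real m \<le> real (Suc ?k)" by simp
      then have "\<bar>t\<bar> < real (Suc ?k)" using m by linarith
      ultimately have "t \<in> {inverse (real (Suc ?k))<..<real (Suc ?k)} \<or> t \<in> {- real (Suc ?k)<..<- inverse (real (Suc ?k))}"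
        by (cases "t > 0") auto
      with t show "t \<in> (\<Union>n::nat. {t \<in> {inverse (real (Suc n))<..<real (Suc n)}. ?P t} \<union> {t \<in> {- real (Suc n)<..<- inverse (real (Suc n))}. ?P t})"
        by blast
    qed
    then have "AE t in lebesgue. \<not> (t \<noteq> 0 \<and> ?P t)"
      unfolding negligible_iff_null_sets by (rule AE_I') auto
    then have "AE t in lborel. \<not> (t \<noteq> 0 \<and> ?P t)" by (simp add: AE_completion_iff)
    then show ?thesis by (rule eventually_mono) (auto simp: partial_coord_upd)
  qed
  show "borel_partial j v y = partial j u y" if ac2: "locally_AC_off_axes (partial j u)" and y: "y \<in> off_axes" for y
  proof -
    have y': "\<And>i. i \<noteq> j \<Longrightarrow> y $ i \<noteq> 0" and yj: "y $ j \<noteq> 0" using y by (auto simp: off_axes_def)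
    define a where "a = y $ j - \<bar>y $ j\<bar> / 2"
    define b where "b = y $ j + \<bar>y $ j\<bar> / 2"
    have ab: "a < b" "a < y $ j" "y $ j < b" "0 \<notin> {a..b}" using yj by (auto simp: a_def b_def field_simps abs_if)
    let ?h = "\<lambda>t. u (coord_upd y j t)" and ?g = "\<lambda>t. partial j u (coord_upd y j t)"
    have acs: "abs_continuous_on {a..s} ?h" if "s \<in> {a..b}" for s
      using that ab by (intro locally_AC_D[OF ac y']) auto
    have hs: "?h s = ?h a + integral {a..s} ?g" if "s \<in> {a..b}" for s
      using integral_unique[OF abs_continuous_FTC[OF acs[OF that]]] that by (simp add: partial_coord_upd)
    have "continuous_on {a..b} ?g"
      using ab by (intro abs_continuous_imp_continuous locally_AC_D[OF ac2 y']) auto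
    then have "((\<lambda>s. integral {a..s} ?g) has_vector_derivative ?g (y $ j)) (at (y $ j) within {a..b})"
      using ab by (intro integral_has_vector_derivative) auto
    then have "((\<lambda>s. ?h a + integral {a..s} ?g) has_vector_derivative ?g (y $ j)) (at (y $ j) within {a..b})"
      by (auto intro!: derivative_eq_intros)
    then have "(?h has_vector_derivative ?g (y $ j)) (at (y $ j) within {a..b})"
    proof (rule has_vector_derivative_transform[rotated 2])
      show "y $ j \<in> {a..b}" using ab by simp
      fix s assume "s \<in> {a..b}"
      then show "?h s = ?h a + integral {a..s} ?g" by (rule hs)
    qed
    then have "(?h has_vector_derivative ?g (y $ j)) (at (y $ j))"
      using ab at_within_Icc_at[of a "y $ j" b] by simp
    from borel_partial_eq[OF y uv this] show ?thesis by simp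
  qed
qed

section \<open>Integration along coordinate lines\<close>

text \<open>
  Fubini's theorem for one coordinate, stated without leaving \<open>real^'n\<close>: the superfluous variable
  \<open>z $ j\<close> is integrated against the density of the unit interval.  Substituting \<open>t = z $ j + r\<close>
  and translating reduces it to Tonelli's theorem for the product of \<open>real^'n\<close> and the line.
\<close>
lemma nn_integral_coord:
  fixes F :: "real^'n \<Rightarrow> ennreal"
  assumes [measurable]: "F \<in> borel_measurable borel"
  shows "(\<integral>\<^sup>+z. F z \<partial>lborel)
    = (\<integral>\<^sup>+z. (\<integral>\<^sup>+t. F (coord_upd z j t) \<partial>lborel) * indicator {0..1} (z $ j) \<partial>lborel)"
proof -
  have "(\<integral>\<^sup>+z. (\<integral>\<^sup>+t. F (coord_upd z j t) \<partial>lborel) * indicator {0..1} (z $ j) \<partial>lborel)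
    = (\<integral>\<^sup>+z. \<integral>\<^sup>+r. F (z + r *\<^sub>R axis j 1) * indicator {0..1} (z $ j) \<partial>lborel \<partial>lborel)"
  proof (rule nn_integral_cong)
    fix z :: "real^'n"
    have "(\<integral>\<^sup>+t. F (coord_upd z j t) \<partial>lborel) = (\<integral>\<^sup>+r. F (coord_upd z j (z $ j + 1 *\<^sub>R r)) \<partial>lborel)"
      by (subst nn_integral_lborel_affine[of "\<lambda>t. F (coord_upd z j t)" 1 "z $ j"]) auto
    also have "\<dots> = (\<integral>\<^sup>+r. F (z + r *\<^sub>R axis j 1) \<partial>lborel)" by (simp add: coord_upd_eq)
    finally show "(\<integral>\<^sup>+t. F (coord_upd z j t) \<partial>lborel) * indicator {0..1} (z $ j)
      = (\<integral>\<^sup>+r. F (z + r *\<^sub>R axis j 1) * indicator {0..1} (z $ j) \<partial>lborel)"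
      by (simp add: nn_integral_multc)
  qed
  also have "\<dots> = (\<integral>\<^sup>+r. \<integral>\<^sup>+z. F (z + r *\<^sub>R axis j 1) * indicator {0..1} (z $ j) \<partial>lborel \<partial>lborel)"
    by (rule lborel_pair.Fubini') measurable
  also have "\<dots> = (\<integral>\<^sup>+r. \<integral>\<^sup>+z. F z * indicator {0..1} (z $ j - r) \<partial>lborel \<partial>lborel)"
  proof (rule nn_integral_cong)
    fix r :: real
    have "(\<lambda>z. F (z + r *\<^sub>R axis j 1) * indicator {0..1} (z $ j)) \<in> borel_measurable borel" by measurable
    from nn_integral_lborel_affine[OF this, of 1 "- r *\<^sub>R axis j 1"]
    show "(\<integral>\<^sup>+z. F (z + r *\<^sub>R axis j 1) * indicator {0..1} (z $ j) \<partial>lborel) = (\<integral>\<^sup>+z. F z * indicator {0..1} (z $ j - r) \<partial>lborel)"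
      by (simp add: axis_def)
  qed
  also have "\<dots> = (\<integral>\<^sup>+z. \<integral>\<^sup>+r. F z * indicator {0..1} (z $ j - r) \<partial>lborel \<partial>lborel)"
    by (rule lborel_pair.Fubini') measurable
  also have "\<dots> = (\<integral>\<^sup>+z. F z * (\<integral>\<^sup>+r. indicator {z $ j - 1..z $ j} r \<partial>lborel) \<partial>lborel)"
  proof (rule nn_integral_cong)
    fix z :: "real^'n"
    have "(\<lambda>r. indicator {0..1} (z $ j - r) :: ennreal) = indicator {z $ j - 1..z $ j}"
      by (intro ext) (auto simp: indicator_def)
    then show "(\<integral>\<^sup>+r. F z * indicator {0..1} (z $ j - r) \<partial>lborel) = F z * (\<integral>\<^sup>+r. indicator {z $ j - 1..z $ j} r \<partial>lborel)"
      by (subst nn_integral_cmult) simp_all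
  qed
  also have "\<dots> = (\<integral>\<^sup>+z. F z \<partial>lborel)" by simp
  finally show ?thesis by simp
qed

text \<open>
  A Lebesgue measurable set is a Borel set up to a null set, and \<open>nn_integral_coord\<close> applies to
  the Borel set.
\<close>
lemma null_if_null_on_lines:
  fixes E :: "(real^'n) set"
  assumes E: "E \<in> sets lebesgue"
    and lines: "\<And>y. y \<in> off_axes \<Longrightarrow> AE t in lborel. coord_upd y j t \<notin> E"
  shows "E \<in> null_sets lebesgue"
proof -
  obtain S N N' where S: "E = S \<union> N" "N \<subseteq> N'" "N' \<in> null_sets lborel" "S \<in> sets lborel"
    using sets_completionE[OF E] .
  have [measurable]: "S \<in> sets borel" using S(4) by simp
  have "emeasure lborel S = (\<integral>\<^sup>+z. indicator S z \<partial>lborel)" by simp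
  also have "\<dots> = (\<integral>\<^sup>+z. (\<integral>\<^sup>+t. indicator S (coord_upd z j t) \<partial>lborel) * indicator {0..1} (z $ j) \<partial>lborel)"
    by (rule nn_integral_coord) measurable
  also have "\<dots> = (\<integral>\<^sup>+z. 0 \<partial>(lborel :: (real^'n) measure))"
  proof (rule nn_integral_cong_AE)
    show "AE z in lborel. (\<integral>\<^sup>+t. indicator S (coord_upd z j t) \<partial>lborel) * indicator {0..1} (z $ j) = 0"
      using AE_off_axes
    proof eventually_elim
      case (elim z)
      have "AE t in lborel. indicator S (coord_upd z j t) = (0::ennreal)"
        using lines[OF elim] by eventually_elim (auto simp: S(1) indicator_def)
      then have "(\<integral>\<^sup>+t. indicator S (coord_upd z j t) \<partial>lborel) = (\<integral>\<^sup>+t. 0 \<partial>(lborel::real measure))"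
        by (rule nn_integral_cong_AE)
      then show ?case by simp
    qed
  qed
  finally have "S \<in> null_sets lborel" using S(4) by (simp add: null_sets_def)
  then have "S \<union> N' \<in> null_sets lborel" using S(3) by (rule null_sets.Un)
  then have "S \<union> N' \<in> null_sets lebesgue" by (rule null_sets_completionI)
  then show ?thesis
    using S(1,2) E by (metis Un_mono order_refl null_sets_subset)
qed

text \<open>
  The power function lies above its tangent at \<open>m\<close>; multiplied out so as to have only
  nonnegative terms, as integration with values in \<open>ennreal\<close> requires.
\<close>
lemma powr_tangent:
  fixes x m q :: real
  assumes "x \<ge> 0" "m > 0" "q \<ge> 1"
  shows "m powr q + q * m powr (q - 1) * x \<le> x powr q + q * m powr q"
proof (cases "x = 0")
  case True
  have "m powr q * 1 \<le> m powr q * q" using assms by (intro mult_left_mono) auto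
  with True assms show ?thesis by (simp add: mult.commute)
next
  case False
  then have x: "x > 0" using assms by simp
  have "(x powr q) powr (1 / q) * (m powr q) powr (1 - 1 / q) \<le> 1 / q * x powr q + (1 - 1 / q) * m powr q"
    using x assms by (intro Youngs_inequality_0) auto
  then have "x * m powr (q - 1) \<le> 1 / q * x powr q + (1 - 1 / q) * m powr q"
    using x assms by (simp add: powr_powr right_diff_distrib)
  then have "q * (x * m powr (q - 1)) \<le> q * (1 / q * x powr q + (1 - 1 / q) * m powr q)"
    using assms by (intro mult_left_mono) auto
  also have "\<dots> = x powr q + q * m powr q - m powr q" using assms by (simp add: field_simps)
  finally show ?thesis by (simp add: mult_ac)
qed

text \<open>
  Jensen's inequality on an interval of length \<open>h\<close>, by integrating the tangent inequality at the
  mean value.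
\<close>
lemma powr_nn_integral_interval:
  fixes f :: "real \<Rightarrow> real"
  assumes [measurable]: "f \<in> borel_measurable borel" and f0: "\<And>t. f t \<ge> 0" and h: "h > 0" and q: "q \<ge> 1"
    and \<alpha>: "\<alpha> \<ge> 0" "ennreal \<alpha> \<le> (\<integral>\<^sup>+t. ennreal (f t) * indicator {c..c + h} t \<partial>lborel)"
  shows "ennreal (\<alpha> powr q) \<le> ennreal (h powr (q - 1)) * (\<integral>\<^sup>+t. ennreal (f t powr q) * indicator {c..c + h} t \<partial>lborel)"
proof (cases "\<alpha> = 0")
  case False
  (* the mean value, at which the tangent is taken *)
  define m where "m = \<alpha> / h"
  have m: "m > 0" "\<alpha> = m * h" using False \<alpha>(1) h by (auto simp: m_def)
  let ?J = "indicator {c..c + h} :: real \<Rightarrow> ennreal"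
  have J: "(\<integral>\<^sup>+t. ennreal b * ?J t \<partial>lborel) = ennreal (b * h)" if "b \<ge> 0" for b
    using h that by (simp add: nn_integral_cmult_indicator ennreal_mult)
  have "ennreal (m powr q * h) + ennreal (q * m powr q * h) = ennreal (m powr q * h) + ennreal (q * m powr (q - 1)) * ennreal \<alpha>"
    using m q h by (simp add: ennreal_mult'[symmetric] powr_diff)
  also have "\<dots> \<le> (\<integral>\<^sup>+t. ennreal (m powr q) * ?J t \<partial>lborel) + ennreal (q * m powr (q - 1)) * (\<integral>\<^sup>+t. ennreal (f t) * ?J t \<partial>lborel)"
    using J[of "m powr q"] \<alpha>(2) by (intro add_mono mult_left_mono) auto
  also have "\<dots> = (\<integral>\<^sup>+t. ennreal (m powr q) * ?J t + ennreal (q * m powr (q - 1)) * (ennreal (f t) * ?J t) \<partial>lborel)"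
    by (simp add: nn_integral_add nn_integral_cmult)
  also have "\<dots> \<le> (\<integral>\<^sup>+t. ennreal (f t powr q) * ?J t + ennreal (q * m powr q) * ?J t \<partial>lborel)"
  proof (rule nn_integral_mono)
    fix t
    have "ennreal (m powr q + q * m powr (q - 1) * f t) \<le> ennreal (f t powr q + q * m powr q)"
      by (intro ennreal_leI powr_tangent f0 m q)
    then have "ennreal (m powr q) + ennreal (q * m powr (q - 1)) * ennreal (f t) \<le> ennreal (f t powr q) + ennreal (q * m powr q)"
      using q f0 by (simp add: ennreal_mult)
    then show "ennreal (m powr q) * ?J t + ennreal (q * m powr (q - 1)) * (ennreal (f t) * ?J t)
      \<le> ennreal (f t powr q) * ?J t + ennreal (q * m powr q) * ?J t"
      by (cases "t \<in> {c..c + h}") auto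
  qed
  also have "\<dots> = (\<integral>\<^sup>+t. ennreal (f t powr q) * ?J t \<partial>lborel) + ennreal (q * m powr q * h)"
    using J[of "q * m powr q"] q by (simp add: nn_integral_add)
  finally have "ennreal (m powr q * h) \<le> (\<integral>\<^sup>+t. ennreal (f t powr q) * ?J t \<partial>lborel)"
    by (subst (asm) add.commute) (simp add: ennreal_add_left_cancel_le add.commute)
  then have "ennreal (h powr (q - 1)) * ennreal (m powr q * h) \<le> ennreal (h powr (q - 1)) * (\<integral>\<^sup>+t. ennreal (f t powr q) * ?J t \<partial>lborel)"
    by (intro mult_left_mono) auto
  moreover have "ennreal (h powr (q - 1)) * ennreal (m powr q * h) = ennreal (\<alpha> powr q)"
    using m h by (simp add: ennreal_mult'[symmetric] powr_mult powr_diff)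
  ultimately show ?thesis by simp
qed simp

section \<open>Differences across the coordinate hyperplanes\<close>

text \<open>
  The difference of \<open>u\<close> over \<open>[y $ j - h, y $ j]\<close> with the part of the interval in
  \<open>{-e<..<e}\<close> cut out: the first bracket is the increment over the part to the right of \<open>e\<close>, the
  second one over the part to the left of \<open>-e\<close>.  For \<open>e = 0\<close> this is the plain difference,
  whatever the position of \<open>0\<close>, since \<open>{max a 0, min a 0} = {a, 0}\<close>.
\<close>
definition cut_diff :: "'n \<Rightarrow> real \<Rightarrow> real \<Rightarrow> (real^'n \<Rightarrow> complex) \<Rightarrow> real^'n \<Rightarrow> complex" where
  "cut_diff j h e u y =
     (u (coord_upd y j (max (y $ j) e)) - u (coord_upd y j (max (y $ j - h) e))) +
     (u (coord_upd y j (min (y $ j) (- e))) - u (coord_upd y j (min (y $ j - h) (- e))))"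

lemma cut_diff_measurable[measurable (raw)]:
  assumes [measurable]: "u \<in> borel_measurable borel"
  shows "cut_diff j h e u \<in> borel_measurable borel"
  unfolding cut_diff_def by measurable

text \<open>
  Cut differences in another direction evaluate functions only at points whose \<open>i\<close>-th coordinate
  is nonzero, so they preserve the relation; this is what plain differences fail to do.
\<close>
lemma partial_integral_cut_diff:
  fixes u w :: "real^'n \<Rightarrow> complex"
  assumes P: "partial_integral j u w" and ij: "i \<noteq> j" and e: "e > 0"
  shows "partial_integral j (cut_diff i h e u) (cut_diff i h e w)"
  unfolding partial_integral_def
proof (intro allI impI)
  fix y :: "real^'n" and a b :: real
  assume y: "\<forall>k. k \<noteq> j \<longrightarrow> y $ k \<noteq> 0" and ab: "a \<le> b" "0 \<notin> {a..b}"
  have yi: "coord_upd y j t $ i = y $ i" for t using ij by (simp add: coord_upd_nth)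
  have sw: "coord_upd (coord_upd y j t) i s = coord_upd (coord_upd y i s) j t" for t s
    using ij by (simp add: coord_upd_commute)
  have *: "set_integrable lborel {a..b} (\<lambda>t. w (coord_upd (coord_upd y i s) j t))"
    "u (coord_upd (coord_upd y i s) j b) - u (coord_upd (coord_upd y i s) j a)
      = (LINT t:{a..b}|lborel. w (coord_upd (coord_upd y i s) j t))" if "s \<noteq> 0" for s
    using that y by (auto intro!: partial_integralD[OF P _ ab] simp: coord_upd_nth split: if_split_asm)
  (* the cut keeps the points of evaluation off the hyperplane *)
  have nz: "max r e \<noteq> 0" "min r (- e) \<noteq> 0" for r using e by (auto simp: max_def min_def)
  show "set_integrable lborel {a..b} (\<lambda>t. cut_diff i h e w (coord_upd y j t)) \<and>
    cut_diff i h e u (coord_upd y j b) - cut_diff i h e u (coord_upd y j a) =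
      (LINT t:{a..b}|lborel. cut_diff i h e w (coord_upd y j t))"
    unfolding cut_diff_def yi sw
    using *[OF nz(1)] *[OF nz(2)]
    by (simp add: set_integral_add set_integral_diff algebra_simps)
qed

text \<open>
  The two parts of the cut interval have at most endpoints in common, so the difference is bounded
  by one integral over the whole interval, to which Jensen's inequality applies.
\<close>
lemma cut_diff_powr_le:
  fixes u w :: "real^'n \<Rightarrow> complex"
  assumes P: "partial_integral j u w" and [measurable]: "w \<in> borel_measurable borel"
    and y: "y \<in> off_axes" and "e > 0" "h > 0" "q \<ge> 1"
  shows "ennreal (norm (cut_diff j h e u y) powr q)
    \<le> ennreal (h powr (q - 1)) * (\<integral>\<^sup>+t. ennreal (norm (w (coord_upd y j t)) powr q) * indicator {y $ j - h..y $ j} t \<partial>lborel)"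
proof -
  have y': "\<And>i. i \<noteq> j \<Longrightarrow> y $ i \<noteq> 0" using y by (auto simp: off_axes_def)
  let ?W = "\<lambda>t. w (coord_upd y j t)"
  have part: "ennreal (norm (u (coord_upd y j b) - u (coord_upd y j a))) \<le> (\<integral>\<^sup>+t. ennreal (norm (?W t)) * indicator {a..b} t \<partial>lborel)"
    if ab: "a \<le> b" "0 \<notin> {a..b}" for a b
  proof -
    have "ennreal (norm (u (coord_upd y j b) - u (coord_upd y j a))) = ennreal (norm (integral\<^sup>L lborel (\<lambda>t. indicator {a..b} t *\<^sub>R ?W t)))"
      using partial_integralD(2)[OF P y' ab] by (simp add: set_lebesgue_integral_def)
    also have "\<dots> \<le> (\<integral>\<^sup>+t. ennreal (norm (indicator {a..b} t *\<^sub>R ?W t)) \<partial>lborel)"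
      by (rule norm_integral_le_nn_integral)
    also have "\<dots> = (\<integral>\<^sup>+t. ennreal (norm (?W t)) * indicator {a..b} t \<partial>lborel)"
      by (intro nn_integral_cong) (simp add: indicator_def)
    finally show ?thesis .
  qed
  let ?A = "{max (y $ j - h) e..max (y $ j) e}" and ?B = "{min (y $ j - h) (- e)..min (y $ j) (- e)}"
  have "ennreal (norm (cut_diff j h e u y)) \<le>
     ennreal (norm (u (coord_upd y j (max (y $ j) e)) - u (coord_upd y j (max (y $ j - h) e)))) +
     ennreal (norm (u (coord_upd y j (min (y $ j) (- e))) - u (coord_upd y j (min (y $ j - h) (- e)))))"
    unfolding cut_diff_def
    by (simp del: ennreal_plus add: ennreal_plus[symmetric] norm_triangle_ineq ennreal_leI)
  also have "\<dots> \<le> (\<integral>\<^sup>+t. ennreal (norm (?W t)) * indicator ?A t \<partial>lborel) + (\<integral>\<^sup>+t. ennreal (norm (?W t)) * indicator ?B t \<partial>lborel)"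
    using \<open>e > 0\<close> \<open>h > 0\<close> by (intro add_mono part) auto
  also have "\<dots> = (\<integral>\<^sup>+t. ennreal (norm (?W t)) * indicator ?A t + ennreal (norm (?W t)) * indicator ?B t \<partial>lborel)"
    by (rule nn_integral_add[symmetric]) measurable
  also have "\<dots> \<le> (\<integral>\<^sup>+t. ennreal (norm (?W t)) * indicator {y $ j - h..y $ j} t \<partial>lborel)"
  proof (rule nn_integral_mono_AE)
    have "AE t in lborel. t \<noteq> e" "AE t in lborel. t \<noteq> - e" by (simp_all add: AE_lborel_singleton)
    then show "AE t in lborel. ennreal (norm (?W t)) * indicator ?A t + ennreal (norm (?W t)) * indicator ?B t
      \<le> ennreal (norm (?W t)) * indicator {y $ j - h..y $ j} t"
    proof eventually_elim
      case (elim t)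
      have "t \<in> ?A \<Longrightarrow> t \<in> {y $ j - h..y $ j} \<and> t > 0" "t \<in> ?B \<Longrightarrow> t \<in> {y $ j - h..y $ j} \<and> t < 0"
        using elim \<open>e > 0\<close> by (auto simp: max_def min_def split: if_splits)
      then have "t \<notin> ?A \<or> t \<notin> ?B" "t \<in> ?A \<union> ?B \<Longrightarrow> t \<in> {y $ j - h..y $ j}" by fastforce+
      then show ?case
        by (cases "t \<in> ?A"; cases "t \<in> ?B") (simp_all only: indicator_simps Un_iff simp_thms mult_1_right mult_zero_right add_0_left add_0_right order_refl zero_le)
    qed
  qed
  finally have "ennreal (norm (cut_diff j h e u y)) \<le> (\<integral>\<^sup>+t. ennreal (norm (?W t)) * indicator {(y $ j - h)..(y $ j - h) + h} t \<partial>lborel)"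
    by simp
  from powr_nn_integral_interval[OF _ _ \<open>h > 0\<close> \<open>q \<ge> 1\<close> _ this] show ?thesis by simp
qed

lemma cut_diff_Lq:
  fixes u w :: "real^'n \<Rightarrow> complex"
  assumes P: "partial_integral j u w" and [measurable]: "w \<in> borel_measurable borel"
    and "e > 0" "h > 0" "q \<ge> 1"
  shows "(\<integral>\<^sup>+y. ennreal (norm (cut_diff j h e u y) powr q) \<partial>lborel)
    \<le> ennreal (h powr q) * (\<integral>\<^sup>+y. ennreal (norm (w y) powr q) \<partial>lborel)"
proof -
  let ?F = "\<lambda>y. ennreal (norm (w y) powr q)"
  have "(\<integral>\<^sup>+y. ennreal (norm (cut_diff j h e u y) powr q) \<partial>lborel)
    \<le> (\<integral>\<^sup>+y. ennreal (h powr (q - 1)) * (\<integral>\<^sup>+t. ?F (coord_upd y j t) * indicator {y $ j - h..y $ j} t \<partial>lborel) \<partial>lborel)"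
  proof (rule nn_integral_mono_AE)
    show "AE y in lborel. ennreal (norm (cut_diff j h e u y) powr q)
      \<le> ennreal (h powr (q - 1)) * (\<integral>\<^sup>+t. ?F (coord_upd y j t) * indicator {y $ j - h..y $ j} t \<partial>lborel)"
    proof (rule AE_mp[OF AE_off_axes], intro AE_I2 impI)
      fix y :: "real^'n" assume "y \<in> off_axes"
      from cut_diff_powr_le[OF P assms(2) this assms(3-5)]
      show "ennreal (norm (cut_diff j h e u y) powr q)
        \<le> ennreal (h powr (q - 1)) * (\<integral>\<^sup>+t. ?F (coord_upd y j t) * indicator {y $ j - h..y $ j} t \<partial>lborel)" .
    qed
  qed
  also have "\<dots> = (\<integral>\<^sup>+y. ennreal (h powr (q - 1)) * (\<integral>\<^sup>+s. ?F (y + (- s) *\<^sub>R axis j 1) * indicator {0..h} s \<partial>lborel) \<partial>lborel)"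
  proof (rule nn_integral_cong, rule arg_cong[where f = "(*) (ennreal (h powr (q - 1)))"])
    fix y :: "real^'n"
    have "(\<lambda>t. ?F (coord_upd y j t) * indicator {y $ j - h..y $ j} t) \<in> borel_measurable borel" by measurable
    from nn_integral_lborel_affine[OF this, of "-1" "y $ j"]
    have "(\<integral>\<^sup>+t. ?F (coord_upd y j t) * indicator {y $ j - h..y $ j} t \<partial>lborel)
      = (\<integral>\<^sup>+s. ?F (coord_upd y j (y $ j - s)) * indicator {y $ j - h..y $ j} (y $ j - s) \<partial>lborel)" by simp
    also have "\<dots> = (\<integral>\<^sup>+s. ?F (y + (- s) *\<^sub>R axis j 1) * indicator {0..h} s \<partial>lborel)"
      by (intro nn_integral_cong) (auto simp: coord_upd_eq indicator_def)
    finally show "(\<integral>\<^sup>+t. ?F (coord_upd y j t) * indicator {y $ j - h..y $ j} t \<partial>lborel) = \<dots>" .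
  qed
  also have "\<dots> = ennreal (h powr (q - 1)) * (\<integral>\<^sup>+y. \<integral>\<^sup>+s. ?F (y + (- s) *\<^sub>R axis j 1) * indicator {0..h} s \<partial>lborel \<partial>lborel)"
    by (rule nn_integral_cmult) measurable
  also have "(\<integral>\<^sup>+y. \<integral>\<^sup>+s. ?F (y + (- s) *\<^sub>R axis j 1) * indicator {0..h} s \<partial>lborel \<partial>lborel)
    = (\<integral>\<^sup>+s. \<integral>\<^sup>+y. ?F (y + (- s) *\<^sub>R axis j 1) * indicator {0..h} s \<partial>lborel \<partial>lborel)"
    by (rule lborel_pair.Fubini') measurable
  also have "\<dots> = (\<integral>\<^sup>+s. (\<integral>\<^sup>+y. ?F y \<partial>lborel) * indicator {0..h} s \<partial>lborel)"
  proof (rule nn_integral_cong)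
    fix s :: real
    have "(\<integral>\<^sup>+y. ?F y \<partial>lborel) = (\<integral>\<^sup>+y. ?F (y + (- s) *\<^sub>R axis j 1) \<partial>lborel)"
      by (subst nn_integral_lborel_affine[of ?F 1 "(- s) *\<^sub>R axis j 1"]) (simp_all add: add.commute)
    then show "(\<integral>\<^sup>+y. ?F (y + (- s) *\<^sub>R axis j 1) * indicator {0..h} s \<partial>lborel) = (\<integral>\<^sup>+y. ?F y \<partial>lborel) * indicator {0..h} s"
      by (simp add: nn_integral_multc)
  qed
  also have "\<dots> = (\<integral>\<^sup>+y. ?F y \<partial>lborel) * ennreal h"
    using \<open>h > 0\<close> by (simp add: nn_integral_cmult)
  finally show ?thesis
    using \<open>h > 0\<close> by (simp add: powr_diff ennreal_mult'[symmetric] mult_ac) (simp add: mult.assoc[symmetric] ennreal_mult'[symmetric])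
qed

text \<open>
  The list is read from the right: its last direction is differentiated first, as in \<open>foldr\<close>.
\<close>
inductive derivative_chain :: "'n list \<Rightarrow> (real^'n \<Rightarrow> complex) \<Rightarrow> (real^'n \<Rightarrow> complex) \<Rightarrow> bool" where
  Nil: "derivative_chain [] g g"
| snoc: "partial_integral j u w \<Longrightarrow> w \<in> borel_measurable borel \<Longrightarrow> derivative_chain ks w g \<Longrightarrow>
    derivative_chain (ks @ [j]) u g"

lemma derivative_chain_Cons:
  assumes "derivative_chain ks u v" "partial_integral j v w" "w \<in> borel_measurable borel"
  shows "derivative_chain (j # ks) u w"
  using assms
proof (induction rule: derivative_chain.induct)
  case (Nil g)
  from derivative_chain.snoc[OF Nil derivative_chain.Nil] show ?case by simp
next
  case (snoc k u v ks g)
  then show ?case using derivative_chain.snoc[of k u v "j # ks" w] by simp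
qed

definition cut_diffs :: "('n \<Rightarrow> real) \<Rightarrow> real \<Rightarrow> 'n list \<Rightarrow> (real^'n \<Rightarrow> complex) \<Rightarrow> real^'n \<Rightarrow> complex" where
  "cut_diffs h e ks = fold (\<lambda>j. cut_diff j (h j) e) ks"

lemma cut_diffs_simps[simp]:
  "cut_diffs h e [] u = u"
  "cut_diffs h e (k # ks) u = cut_diffs h e ks (cut_diff k (h k) e u)"
  "cut_diffs h e (ks @ [j]) u = cut_diff j (h j) e (cut_diffs h e ks u)"
  by (simp_all add: cut_diffs_def)

lemma cut_diffs_measurable:
  "u \<in> borel_measurable borel \<Longrightarrow> cut_diffs h e ks u \<in> borel_measurable borel"
  by (induction ks arbitrary: u) (auto intro: cut_diff_measurable)

lemma partial_integral_cut_diffs: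
  assumes "partial_integral j u w" "j \<notin> set ks" "e > 0"
  shows "partial_integral j (cut_diffs h e ks u) (cut_diffs h e ks w)"
  using assms
proof (induction ks arbitrary: u w)
  case (Cons a ks)
  then have "partial_integral j (cut_diff a (h a) e u) (cut_diff a (h a) e w)"
    by (intro partial_integral_cut_diff) auto
  then show ?case using Cons by simp
qed simp

text \<open>
  The differences are replaced by derivatives one at a time.  The direction differentiated first
  carries the outermost difference, and the remaining differences are applied to the derivative.
\<close>
lemma cut_diffs_Lq:
  fixes u g :: "real^'n \<Rightarrow> complex"
  assumes "derivative_chain ks u g" "distinct ks" "e > 0" "\<And>j. h j > 0" "q \<ge> 1"
  shows "(\<integral>\<^sup>+y. ennreal (norm (cut_diffs h e ks u y) powr q) \<partial>lborel)
    \<le> ennreal ((\<Prod>j\<in>set ks. h j) powr q) * (\<integral>\<^sup>+y. ennreal (norm (g y) powr q) \<partial>lborel)"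
  using assms
proof (induction rule: derivative_chain.induct)
  case (Nil g)
  then show ?case by simp
next
  case (snoc j u w ks g)
  then have j: "j \<notin> set ks" by simp
  have m: "cut_diffs h e ks w \<in> borel_measurable borel" using snoc by (intro cut_diffs_measurable)
  have P: "partial_integral j (cut_diffs h e ks u) (cut_diffs h e ks w)"
    using snoc j by (intro partial_integral_cut_diffs)
  have "(\<integral>\<^sup>+y. ennreal (norm (cut_diffs h e (ks @ [j]) u y) powr q) \<partial>lborel)
    \<le> ennreal (h j powr q) * (\<integral>\<^sup>+y. ennreal (norm (cut_diffs h e ks w y) powr q) \<partial>lborel)"
    using cut_diff_Lq[OF P m snoc.prems(2) snoc.prems(3) snoc.prems(4)] by simp
  also have "\<dots> \<le> ennreal (h j powr q) * (ennreal ((\<Prod>j\<in>set ks. h j) powr q) * (\<integral>\<^sup>+y. ennreal (norm (g y) powr q) \<partial>lborel))"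
    using snoc by (intro mult_left_mono snoc.IH) auto
  also have "\<dots> = ennreal ((\<Prod>j\<in>set (ks @ [j]). h j) powr q) * (\<integral>\<^sup>+y. ennreal (norm (g y) powr q) \<partial>lborel)"
  proof -
    have "(\<Prod>j\<in>set (ks @ [j]). h j) powr q = h j powr q * (\<Prod>j\<in>set ks. h j) powr q"
      using j snoc.prems(3) by (simp add: powr_mult prod_nonneg less_imp_le)
    then show ?thesis by (simp add: ennreal_mult mult.assoc)
  qed
  finally show ?case .
qed

text \<open>
  For a set \<open>J\<close> of directions already integrated over, \<open>z\<close> carries the integration variables and
  \<open>y\<close> the fixed coordinates.
\<close>
definition mix :: "'n set \<Rightarrow> real^'n \<Rightarrow> real^'n \<Rightarrow> real^'n" where
  "mix J y z = (\<chi> i. if i \<in> J then z $ i else y $ i)"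

lemma mix_measurable[measurable]: "mix J y \<in> borel_measurable borel"
proof (rule borel_measurable_continuous_onI)
  have "mix J y = (\<lambda>z. \<chi> i. if i \<in> J then z $ i else y $ i)" by (simp add: mix_def fun_eq_iff)
  moreover have "continuous_on UNIV (\<lambda>z. if i \<in> J then z $ i else y $ i)" for i
    by (cases "i \<in> J") (auto intro!: continuous_intros)
  ultimately show "continuous_on UNIV (mix J y)" by (auto intro!: continuous_on_vec_lambda)
qed

text \<open>
  The density of the dummy variables: the coordinates outside \<open>J\<close> are integrated over the unit
  interval.
\<close>
definition unit_slab :: "'n set \<Rightarrow> (real^'n) set" where
  "unit_slab J = {z. \<forall>i. i \<notin> J \<longrightarrow> z $ i \<in> {0..1}}"

lemma unit_slab_borel[measurable]: "unit_slab J \<in> sets borel"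
  unfolding unit_slab_def by measurable

lemma emeasure_unit_slab: "emeasure lborel (unit_slab {} :: (real^'n) set) = 1"
proof -
  have "unit_slab {} = cbox (0::real^'n) 1" by (auto simp: unit_slab_def mem_box_cart)
  moreover have "emeasure lborel (cbox (0::real^'n) 1) = ennreal (measure lborel (cbox 0 (1::real^'n)))"
    by (rule emeasure_eq_ennreal_measure) (simp add: emeasure_lborel_cbox_eq)
  moreover have "measure lborel (cbox 0 (1::real^'n)) = 1" by (simp add: content_cbox_cart interval_eq_empty_cart)
  ultimately show ?thesis by simp
qed

text \<open>
  The pointwise form of the preceding estimate: the integrals are kept over the directions in the
  list only.  For a list of all directions the right-hand side does not depend on \<open>y\<close>, and the
  inequality becomes a bound of the supremum.
\<close>
lemma cut_diffs_pointwise: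
  fixes u g :: "real^'n \<Rightarrow> complex"
  assumes "derivative_chain ks u g" "distinct ks" "e > 0" "\<And>j. h j > 0" "q \<ge> 1" "y \<in> off_axes" "g \<in> borel_measurable borel"
  shows "ennreal (norm (cut_diffs h e ks u y) powr q)
    \<le> ennreal ((\<Prod>j\<in>set ks. h j) powr (q - 1)) *
      (\<integral>\<^sup>+z. ennreal (norm (g (mix (set ks) y z)) powr q) * indicator (unit_slab (set ks)) z \<partial>lborel)"
  using assms
proof (induction arbitrary: y rule: derivative_chain.induct)
  case (Nil g)
  have "mix {} y z = y" for z by (simp add: mix_def vec_eq_iff)
  then show ?case by (simp add: nn_integral_cmult emeasure_unit_slab)
next
  case (snoc j u w ks g)
  note [measurable] = snoc.hyps(2) snoc.prems(6)
  let ?K = "set ks"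
  have j: "j \<notin> ?K" and d: "distinct ks" using snoc by auto
  have [measurable]: "cut_diffs h e ks w \<in> borel_measurable borel" using snoc by (intro cut_diffs_measurable)
  have P: "partial_integral j (cut_diffs h e ks u) (cut_diffs h e ks w)"
    using snoc j by (intro partial_integral_cut_diffs)
  let ?G = "\<lambda>y z. ennreal (norm (g (mix ?K y z)) powr q) * indicator (unit_slab ?K) z"
  let ?H = "\<lambda>z. ennreal (norm (g (mix (insert j ?K) y z)) powr q) * indicator (unit_slab (insert j ?K)) z"
  have mm: "mix ?K (coord_upd y j t) z = mix (insert j ?K) y (coord_upd z j t)" for t z
    using j by (auto simp: mix_def vec_eq_iff coord_upd_nth)
  (* the coordinate j passes from the dummy variables to the integration variables *)
  have us: "indicator (unit_slab ?K) z = (indicator (unit_slab (insert j ?K)) (coord_upd z j t) * indicator {0..1} (z $ j) :: ennreal)" for z t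
  proof -
    have "z \<in> unit_slab ?K \<longleftrightarrow> coord_upd z j t \<in> unit_slab (insert j ?K) \<and> z $ j \<in> {0..1}"
      using j by (auto simp: unit_slab_def coord_upd_nth)
    then show ?thesis by (simp add: indicator_def)
  qed
  have "ennreal (norm (cut_diffs h e (ks @ [j]) u y) powr q)
    \<le> ennreal (h j powr (q - 1)) * (\<integral>\<^sup>+t. ennreal (norm (cut_diffs h e ks w (coord_upd y j t)) powr q) * indicator {y $ j - h j..y $ j} t \<partial>lborel)"
    using cut_diff_powr_le[OF P _ snoc.prems(5,2,3,4)] by simp
  also have "\<dots> \<le> ennreal (h j powr (q - 1)) * (\<integral>\<^sup>+t. ennreal ((\<Prod>j\<in>?K. h j) powr (q - 1)) * (\<integral>\<^sup>+z. ?G (coord_upd y j t) z \<partial>lborel) \<partial>lborel)"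
  proof (intro mult_left_mono nn_integral_mono_AE)
    show "AE t in lborel. ennreal (norm (cut_diffs h e ks w (coord_upd y j t)) powr q) * indicator {y $ j - h j..y $ j} t
      \<le> ennreal ((\<Prod>j\<in>?K. h j) powr (q - 1)) * (\<integral>\<^sup>+z. ?G (coord_upd y j t) z \<partial>lborel)"
    proof (rule AE_mp[OF AE_lborel_singleton[of 0]], intro AE_I2 impI)
      fix t :: real assume "t \<noteq> 0"
      then have "coord_upd y j t \<in> off_axes" using snoc.prems by (intro coord_upd_off_axes)
      from snoc.IH[OF d snoc.prems(2,3,4) this snoc.prems(6)]
      show "ennreal (norm (cut_diffs h e ks w (coord_upd y j t)) powr q) * indicator {y $ j - h j..y $ j} t
        \<le> ennreal ((\<Prod>j\<in>?K. h j) powr (q - 1)) * (\<integral>\<^sup>+z. ?G (coord_upd y j t) z \<partial>lborel)"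
        by (cases "t \<in> {y $ j - h j..y $ j}") simp_all
    qed
  qed simp
  also have "(\<integral>\<^sup>+t. ennreal ((\<Prod>j\<in>?K. h j) powr (q - 1)) * (\<integral>\<^sup>+z. ?G (coord_upd y j t) z \<partial>lborel) \<partial>lborel)
    = ennreal ((\<Prod>j\<in>?K. h j) powr (q - 1)) * (\<integral>\<^sup>+t. \<integral>\<^sup>+z. ?G (coord_upd y j t) z \<partial>lborel \<partial>lborel)"
    unfolding mm by (rule nn_integral_cmult) measurable
  also have "(\<integral>\<^sup>+t. \<integral>\<^sup>+z. ?G (coord_upd y j t) z \<partial>lborel \<partial>lborel)
    = (\<integral>\<^sup>+z. \<integral>\<^sup>+t. ?G (coord_upd y j t) z \<partial>lborel \<partial>lborel)"
    unfolding mm by (rule lborel_pair.Fubini') measurable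
  also have "\<dots> = (\<integral>\<^sup>+z. (\<integral>\<^sup>+t. ?H (coord_upd z j t) \<partial>lborel) * indicator {0..1} (z $ j) \<partial>lborel)"
  proof (rule nn_integral_cong)
    fix z :: "real^'n"
    have "(\<integral>\<^sup>+t. ?G (coord_upd y j t) z \<partial>lborel) = (\<integral>\<^sup>+t. ?H (coord_upd z j t) * indicator {0..1} (z $ j) \<partial>lborel)"
      unfolding mm by (rule nn_integral_cong) (subst us, simp add: mult.assoc)
    also have "\<dots> = (\<integral>\<^sup>+t. ?H (coord_upd z j t) \<partial>lborel) * indicator {0..1} (z $ j)"
      by (rule nn_integral_multc) measurable
    finally show "(\<integral>\<^sup>+t. ?G (coord_upd y j t) z \<partial>lborel) = (\<integral>\<^sup>+t. ?H (coord_upd z j t) \<partial>lborel) * indicator {0..1} (z $ j)" .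
  qed
  also have "\<dots> = (\<integral>\<^sup>+z. ?H z \<partial>lborel)"
    by (rule nn_integral_coord[symmetric]) measurable
  also have "ennreal (h j powr (q - 1)) * (ennreal ((\<Prod>j\<in>?K. h j) powr (q - 1)) * (\<integral>\<^sup>+z. ?H z \<partial>lborel))
    = ennreal ((\<Prod>j\<in>set (ks @ [j]). h j) powr (q - 1)) * (\<integral>\<^sup>+z. ?H z \<partial>lborel)"
  proof -
    have "(\<Prod>j\<in>set (ks @ [j]). h j) powr (q - 1) = h j powr (q - 1) * (\<Prod>j\<in>?K. h j) powr (q - 1)"
      using j snoc.prems(3) by (simp add: powr_mult prod_nonneg less_imp_le)
    then show ?thesis by (simp add: ennreal_mult mult.assoc)
  qed
  finally show ?case by simp
qed

definition coord_diff :: "'n \<Rightarrow> real \<Rightarrow> (real^'n \<Rightarrow> complex) \<Rightarrow> real^'n \<Rightarrow> complex" where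
  "coord_diff j h u y = u y - u (coord_upd y j (y $ j - h))"

definition coord_diffs :: "('n \<Rightarrow> real) \<Rightarrow> 'n list \<Rightarrow> (real^'n \<Rightarrow> complex) \<Rightarrow> real^'n \<Rightarrow> complex" where
  "coord_diffs h ks = fold (\<lambda>j. coord_diff j (h j)) ks"

lemma coord_diffs_simps[simp]:
  "coord_diffs h [] u = u"
  "coord_diffs h (k # ks) u = coord_diffs h ks (coord_diff k (h k) u)"
  "coord_diffs h (ks @ [j]) u = coord_diff j (h j) (coord_diffs h ks u)"
  by (simp_all add: coord_diffs_def)

text \<open>
  For the induction the point moves along with the width of the cut: a cut difference evaluates
  the inner differences at points that depend on \<open>e\<close>.
\<close>
lemma cut_diffs_tendsto:
  assumes u: "continuous_on UNIV u" and e: "e \<longlonglongrightarrow> 0" and Y: "Y \<longlonglongrightarrow> y"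
  shows "(\<lambda>n. cut_diffs h (e n) ks u (Y n)) \<longlonglongrightarrow> coord_diffs h ks u y"
  using Y
proof (induction ks arbitrary: Y y rule: rev_induct)
  case Nil
  then show ?case by (simp add: continuous_on_tendsto_compose[OF u])
next
  case (snoc j ks)
  let ?c = "\<lambda>n. cut_diffs h (e n) ks u" and ?d = "coord_diffs h ks u"
  have nth: "(\<lambda>n. Y n $ j) \<longlonglongrightarrow> y $ j" using snoc.prems by (rule tendsto_vec_nth)
  have "(\<lambda>n. cut_diff j (h j) (e n) (?c n) (Y n)) \<longlonglongrightarrow>
     (?d (coord_upd y j (max (y $ j) 0)) - ?d (coord_upd y j (max (y $ j - h j) 0))) +
     (?d (coord_upd y j (min (y $ j) (- 0))) - ?d (coord_upd y j (min (y $ j - h j) (- 0))))"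
    unfolding cut_diff_def
    by (intro tendsto_add tendsto_diff snoc.IH tendsto_coord_upd tendsto_max tendsto_min tendsto_minus tendsto_const nth e snoc.prems)
  moreover have "(?d (coord_upd y j (max (y $ j) 0)) - ?d (coord_upd y j (max (y $ j - h j) 0))) +
     (?d (coord_upd y j (min (y $ j) (- 0))) - ?d (coord_upd y j (min (y $ j - h j) (- 0))))
     = coord_diff j (h j) ?d y"
    unfolding coord_diff_def by (auto simp: max_def min_def)
  ultimately show ?case by simp
qed

lemma coord_diffs_measurable:
  assumes "u \<in> borel_measurable borel"
  shows "coord_diffs h ks u \<in> borel_measurable borel"
proof -
  have "coord_diff j s v \<in> borel_measurable borel" if [measurable]: "v \<in> borel_measurable borel" for j s v
    unfolding coord_diff_def by measurable
  then show ?thesis using assms by (induction ks arbitrary: u) auto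
qed

text \<open>
  By Fatou's lemma the estimate for cut differences, which is uniform in \<open>e\<close>, passes to the limit.
\<close>
lemma coord_diffs_Lq:
  fixes u g :: "real^'n \<Rightarrow> complex"
  assumes c: "derivative_chain ks u g" "distinct ks" "\<And>j. h j > 0" "q \<ge> 1" and u: "continuous_on UNIV u"
  shows "(\<integral>\<^sup>+y. ennreal (norm (coord_diffs h ks u y) powr q) \<partial>lborel)
    \<le> ennreal ((\<Prod>j\<in>set ks. h j) powr q) * (\<integral>\<^sup>+y. ennreal (norm (g y) powr q) \<partial>lborel)" (is "_ \<le> ?B")
proof -
  have mu: "u \<in> borel_measurable borel" using u by (rule borel_measurable_continuous_onI)
  define e where "e n = inverse (real (Suc n))" for n
  have e: "e \<longlonglongrightarrow> 0" "e n > 0" for n unfolding e_def using LIMSEQ_inverse_real_of_nat by auto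
  let ?f = "\<lambda>n y. ennreal (norm (cut_diffs h (e n) ks u y) powr q)"
  have lim: "(\<lambda>n. ?f n y) \<longlonglongrightarrow> ennreal (norm (coord_diffs h ks u y) powr q)" for y
    using assms(4) by (intro tendsto_ennrealI tendsto_powr' tendsto_norm cut_diffs_tendsto[OF u e(1)] tendsto_const) auto
  have "(\<integral>\<^sup>+y. ennreal (norm (coord_diffs h ks u y) powr q) \<partial>lborel) = (\<integral>\<^sup>+y. liminf (\<lambda>n. ?f n y) \<partial>lborel)"
    by (intro nn_integral_cong lim_imp_Liminf[symmetric] lim) simp
  also have "\<dots> \<le> liminf (\<lambda>n. \<integral>\<^sup>+y. ?f n y \<partial>lborel)"
    using cut_diffs_measurable[OF mu] by (intro nn_integral_liminf) simp
  also have "\<dots> \<le> liminf (\<lambda>n::nat. ?B)"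
    by (intro Liminf_mono always_eventually allI cut_diffs_Lq c e)
  also have "\<dots> = ?B" by (simp add: Liminf_const)
  finally show ?thesis .
qed

lemma coord_diffs_sup:
  fixes u g :: "real^'n \<Rightarrow> complex"
  assumes c: "derivative_chain ks u g" "distinct ks" "\<And>j. h j > 0" "q \<ge> 1" "y \<in> off_axes" "g \<in> borel_measurable borel"
    and u: "continuous_on UNIV u" and ks: "set ks = UNIV"
  shows "ennreal (norm (coord_diffs h ks u y) powr q)
    \<le> ennreal ((\<Prod>j\<in>UNIV. h j) powr (q - 1)) * (\<integral>\<^sup>+y. ennreal (norm (g y) powr q) \<partial>lborel)" (is "_ \<le> ?B")
proof (rule tendsto_upperbound)
  define e where "e n = inverse (real (Suc n))" for n
  have e: "e \<longlonglongrightarrow> 0" "e n > 0" for n unfolding e_def using LIMSEQ_inverse_real_of_nat by auto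
  show "(\<lambda>n. ennreal (norm (cut_diffs h (e n) ks u y) powr q)) \<longlonglongrightarrow> ennreal (norm (coord_diffs h ks u y) powr q)"
    using assms(4) by (intro tendsto_ennrealI tendsto_powr' tendsto_norm cut_diffs_tendsto[OF u e(1)] tendsto_const) auto
  have "mix UNIV y z = z" for z by (simp add: mix_def vec_eq_iff)
  moreover have "(unit_slab UNIV :: (real^'n) set) = UNIV" by (simp add: unit_slab_def)
  ultimately show "\<forall>\<^sub>F n in sequentially. ennreal (norm (cut_diffs h (e n) ks u y) powr q) \<le> ?B"
    using cut_diffs_pointwise[where h = h, OF c(1,2) e(2) c(3,4,5,6)] unfolding ks by (intro always_eventually allI) simp
qed simp

section \<open>Mixed differences and mixed derivatives\<close>

text \<open>
  Along the list of the directions in \<open>\<eta>\<close> each derivative is replaced by a Borel version.  As long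
  as some direction is missing, the version agrees with the mixed derivative everywhere off the
  axes; for the derivative of full order the two agree only almost everywhere.
\<close>
lemma derivative_chain_exists:
  fixes f :: "real^'n \<Rightarrow> complex" and js :: "'n list"
  assumes js: "distinct js" "set js = UNIV" and f: "f \<in> borel_measurable borel"
    and ac: "\<And>\<eta>. \<eta> \<noteq> UNIV \<Longrightarrow> locally_AC_off_axes (mixed_partial js \<eta> f)"
    and meas: "\<And>\<eta>. \<eta> \<noteq> {} \<Longrightarrow> mixed_partial js \<eta> f \<in> borel_measurable lebesgue"
  shows "\<exists>g\<in>borel_measurable borel. derivative_chain (filter (\<lambda>j. j \<in> \<eta>) js) f g \<and>
    (AE y in lebesgue. g y = mixed_partial js \<eta> f y)"
proof -
  have main: "\<exists>g\<in>borel_measurable borel. derivative_chain ks f g \<and>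
      (AE y in lebesgue. g y = mixed_partial js (set ks) f y) \<and>
      (set ks \<noteq> UNIV \<longrightarrow> (\<forall>y\<in>off_axes. g y = mixed_partial js (set ks) f y))"
    if "ks = filter (\<lambda>j. j \<in> set ks) js" for ks
    using that
  proof (induction ks)
    case Nil
    have "mixed_partial js (set []) f = f" by (simp add: mixed_partial_def)
    then show ?case using f by (intro bexI[of _ f]) (auto intro: derivative_chain.Nil)
  next
    case (Cons j ks)
    have dist: "distinct (j # ks)" using Cons.prems js(1) by (metis distinct_filter)
    have ks: "ks = filter (\<lambda>i. i \<in> set ks) js"
    proof -
      have "filter (\<lambda>i. i \<in> set ks) js = filter (\<lambda>i. i \<in> set ks) (filter (\<lambda>i. i \<in> set (j # ks)) js)"
        unfolding filter_filter by (rule filter_cong) auto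
      also have "\<dots> = filter (\<lambda>i. i \<in> set ks) (j # ks)" by (rule arg_cong[OF Cons.prems[symmetric]])
      also have "\<dots> = ks" using dist by (simp add: filter_id_conv)
      finally show ?thesis by simp
    qed
    obtain g where g: "g \<in> borel_measurable borel" "derivative_chain ks f g"
      "\<And>y. y \<in> off_axes \<Longrightarrow> g y = mixed_partial js (set ks) f y"
      using Cons.IH[OF ks] dist by auto
    let ?u = "mixed_partial js (set ks) f" and ?w = "borel_partial j g"
    have "set ks \<noteq> UNIV" using dist by auto
    note acu = ac[OF this]
    have L: "partial_integral j g ?w"
      "\<And>y. (\<And>i. i \<noteq> j \<Longrightarrow> y $ i \<noteq> 0) \<Longrightarrow> AE t in lborel. t \<noteq> 0 \<longrightarrow> ?w (coord_upd y j t) = partial j ?u (coord_upd y j t)"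
      "\<And>y. locally_AC_off_axes (partial j ?u) \<Longrightarrow> y \<in> off_axes \<Longrightarrow> ?w y = partial j ?u y"
      by (rule locally_AC_partial_integral[OF acu g(1)], rule g(3), assumption+)+
    have next_eq: "mixed_partial js (set (j # ks)) f = partial j ?u"
      unfolding mixed_partial_def using ks Cons.prems by (metis comp_apply foldr_Cons)
    have wm: "?w \<in> borel_measurable borel" by (rule borel_partial_measurable[OF g(1)])
    have ch: "derivative_chain (j # ks) f ?w" by (rule derivative_chain_Cons[OF g(2) L(1) wm])
    let ?E = "{y \<in> off_axes. ?w y \<noteq> partial j ?u y}"
    have "partial j ?u \<in> borel_measurable lebesgue" using meas[of "set (j # ks)"] unfolding next_eq by simp
    moreover have "?w \<in> borel_measurable lebesgue" using wm by (simp add: measurable_completion)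
    moreover have "(off_axes :: (real^'n) set) \<in> sets lebesgue" using off_axes_borel by (simp add: sets_completionI_sets)
    ultimately have Em: "?E \<in> sets lebesgue"
    proof -
      assume a: "partial j ?u \<in> borel_measurable lebesgue" "?w \<in> borel_measurable lebesgue" "(off_axes :: (real^'n) set) \<in> sets lebesgue"
      have "(\<lambda>y. ?w y - partial j ?u y) -` (- {0}) \<inter> space lebesgue \<in> sets lebesgue"
        by (rule measurable_sets[OF borel_measurable_diff[OF a(2,1)]]) simp
      also have "(\<lambda>y. ?w y - partial j ?u y) -` (- {0}) \<inter> space lebesgue = {y \<in> space lebesgue. ?w y \<noteq> partial j ?u y}"
        by auto
      finally have "off_axes \<inter> {y \<in> space lebesgue. ?w y \<noteq> partial j ?u y} \<in> sets lebesgue" by (rule sets.Int[OF a(3)])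
      also have "off_axes \<inter> {y \<in> space lebesgue. ?w y \<noteq> partial j ?u y} = ?E" by auto
      finally show ?thesis .
    qed
    have "?E \<in> null_sets lebesgue"
    proof (rule null_if_null_on_lines[OF Em, of j])
      fix y :: "real^'n" assume "y \<in> off_axes"
      then have "AE t in lborel. t \<noteq> 0 \<longrightarrow> ?w (coord_upd y j t) = partial j ?u (coord_upd y j t)"
        by (intro L(2)) (auto simp: off_axes_def)
      then show "AE t in lborel. coord_upd y j t \<notin> ?E"
        by (rule eventually_mono) (auto simp: off_axes_def coord_upd_nth dest: spec[of _ j])
    qed
    then have "AE y in lebesgue. y \<notin> ?E" by (rule AE_not_in)
    moreover have "AE y in lebesgue. y \<in> (off_axes :: (real^'n) set)" using AE_off_axes by (simp add: AE_completion_iff)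
    ultimately have "AE y in lebesgue. ?w y = partial j ?u y" by eventually_elim auto
    moreover have "?w y = partial j ?u y" if "set (j # ks) \<noteq> UNIV" "y \<in> off_axes" for y
      using L(3)[OF _ that(2)] ac[OF that(1)] unfolding next_eq by blast
    ultimately show ?case using wm ch unfolding next_eq by blast
  qed
  have \<eta>: "set (filter (\<lambda>j. j \<in> \<eta>) js) = \<eta>" using js(2) by auto
  from main[of "filter (\<lambda>j. j \<in> \<eta>) js"] show ?thesis unfolding \<eta> by blast
qed

text \<open>
  The vertices of the box with sides \<open>h\<close> at the origin, indexed by the sets of coordinates.
\<close>
definition shift :: "('n \<Rightarrow> real) \<Rightarrow> 'n set \<Rightarrow> real^'n" where
  "shift h S = (\<chi> i. if i \<in> S then h i else 0)"

text \<open>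
  In this form the mixed difference visibly does not depend on the order of the directions.
\<close>
lemma coord_diffs_sum:
  assumes "distinct ks"
  shows "coord_diffs h ks u y = (\<Sum>S\<in>Pow (set ks). (- 1) ^ card S * u (y - shift h S))"
  using assms
proof (induction ks arbitrary: y rule: rev_induct)
  case Nil
  have "y - shift h {} = y" by (simp add: shift_def vec_eq_iff)
  then show ?case by simp
next
  case (snoc j ks)
  then have j: "j \<notin> set ks" and IH: "\<And>y. coord_diffs h ks u y = (\<Sum>S\<in>Pow (set ks). (- 1) ^ card S * u (y - shift h S))"
    by auto
  have inj: "inj_on (insert j) (Pow (set ks))" using j by (auto simp: inj_on_def)
  have dj: "Pow (set ks) \<inter> insert j ` Pow (set ks) = {}" using j by auto
  have "(\<Sum>S\<in>Pow (set (ks @ [j])). (- 1) ^ card S * u (y - shift h S))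
    = (\<Sum>S\<in>Pow (set ks). (- 1) ^ card S * u (y - shift h S)) + (\<Sum>S\<in>insert j ` Pow (set ks). (- 1) ^ card S * u (y - shift h S))"
    using dj by (simp add: Pow_insert sum.union_disjoint)
  also have "(\<Sum>S\<in>insert j ` Pow (set ks). (- 1) ^ card S * u (y - shift h S))
    = (\<Sum>S\<in>Pow (set ks). (- 1) ^ card (insert j S) * u (y - shift h (insert j S)))"
    by (subst sum.reindex[OF inj]) simp
  also have "\<dots> = (\<Sum>S\<in>Pow (set ks). - ((- 1) ^ card S * u (coord_upd y j (y $ j - h j) - shift h S)))"
  proof (rule sum.cong[OF refl])
    fix S assume S: "S \<in> Pow (set ks)"
    then have "j \<notin> S" "finite S" using j finite_subset by auto
    moreover have "y - shift h (insert j S) = coord_upd y j (y $ j - h j) - shift h S"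
      using \<open>j \<notin> S\<close> by (auto simp: vec_eq_iff shift_def coord_upd_nth)
    ultimately show "(- 1) ^ card (insert j S) * u (y - shift h (insert j S)) = - ((- 1) ^ card S * u (coord_upd y j (y $ j - h j) - shift h S))"
      by simp
  qed
  finally show ?case by (simp add: IH coord_diff_def sum_negf)
qed

lemma powr_diff_le:
  fixes a b :: complex
  assumes "q \<ge> 1"
  shows "norm (a - b) powr q \<le> 2 powr q * (norm a powr q + norm b powr q)"
proof -
  have "norm (a - b) powr q \<le> (2 * max (norm a) (norm b)) powr q"
    using norm_triangle_ineq4[of a b] assms by (intro powr_mono2) auto
  also have "\<dots> = 2 powr q * max (norm a) (norm b) powr q" by (simp add: powr_mult)
  also have "max (norm a) (norm b) powr q \<le> norm a powr q + norm b powr q" by (simp add: max_def)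
  finally show ?thesis by simp
qed

lemma coord_diff_Lq_crude:
  fixes u :: "real^'n \<Rightarrow> complex"
  assumes [measurable]: "u \<in> borel_measurable borel" and q: "q \<ge> 1"
  shows "(\<integral>\<^sup>+y. ennreal (norm (coord_diff j s u y) powr q) \<partial>lborel)
    \<le> ennreal (2 * 2 powr q) * (\<integral>\<^sup>+y. ennreal (norm (u y) powr q) \<partial>lborel)"
proof -
  let ?F = "\<lambda>y. ennreal (norm (u y) powr q)"
  have "(\<integral>\<^sup>+y. ennreal (norm (coord_diff j s u y) powr q) \<partial>lborel)
    \<le> (\<integral>\<^sup>+y. ennreal (2 powr q) * (?F y + ?F ((- s) *\<^sub>R axis j 1 + 1 *\<^sub>R y)) \<partial>lborel)"
  proof (rule nn_integral_mono)
    fix y :: "real^'n"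
    have "coord_upd y j (y $ j - s) = (- s) *\<^sub>R axis j 1 + 1 *\<^sub>R y" by (simp add: coord_upd_eq)
    then have "norm (coord_diff j s u y) powr q \<le> 2 powr q * (norm (u y) powr q + norm (u ((- s) *\<^sub>R axis j 1 + 1 *\<^sub>R y)) powr q)"
      unfolding coord_diff_def using powr_diff_le[OF q] by metis
    from ennreal_leI[OF this] show "ennreal (norm (coord_diff j s u y) powr q)
      \<le> ennreal (2 powr q) * (?F y + ?F ((- s) *\<^sub>R axis j 1 + 1 *\<^sub>R y))"
      by (simp add: ennreal_mult del: scaleR_one scaleR_minus_left)
  qed
  also have "\<dots> = ennreal (2 powr q) * ((\<integral>\<^sup>+y. ?F y \<partial>lborel) + (\<integral>\<^sup>+y. ?F ((- s) *\<^sub>R axis j 1 + 1 *\<^sub>R y) \<partial>lborel))"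
    by (simp add: nn_integral_cmult nn_integral_add del: scaleR_one scaleR_minus_left)
  also have "(\<integral>\<^sup>+y. ?F ((- s) *\<^sub>R axis j 1 + 1 *\<^sub>R y) \<partial>lborel) = (\<integral>\<^sup>+y. ?F y \<partial>lborel)"
  proof -
    have "?F \<in> borel_measurable borel" by measurable
    from nn_integral_lborel_affine[OF this, of 1 "(- s) *\<^sub>R axis j 1"] show ?thesis by simp
  qed
  also have "ennreal (2 powr q) * ((\<integral>\<^sup>+y. ?F y \<partial>lborel) + (\<integral>\<^sup>+y. ?F y \<partial>lborel)) = ennreal (2 * 2 powr q) * (\<integral>\<^sup>+y. ?F y \<partial>lborel)"
    by (simp add: ennreal_mult mult_2[symmetric] mult_ac)
  finally show ?thesis .
qed

lemma coord_diffs_Lq_crude: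
  fixes u :: "real^'n \<Rightarrow> complex"
  assumes "u \<in> borel_measurable borel" and q: "q \<ge> 1"
  shows "(\<integral>\<^sup>+y. ennreal (norm (coord_diffs h ks u y) powr q) \<partial>lborel)
    \<le> ennreal ((2 * 2 powr q) ^ length ks) * (\<integral>\<^sup>+y. ennreal (norm (u y) powr q) \<partial>lborel)"
proof (induction ks rule: rev_induct)
  case Nil
  then show ?case by simp
next
  case (snoc j ks)
  have "(\<integral>\<^sup>+y. ennreal (norm (coord_diffs h (ks @ [j]) u y) powr q) \<partial>lborel)
    \<le> ennreal (2 * 2 powr q) * (\<integral>\<^sup>+y. ennreal (norm (coord_diffs h ks u y) powr q) \<partial>lborel)"
    using coord_diff_Lq_crude[OF coord_diffs_measurable[OF assms(1)] q] by simp
  also have "\<dots> \<le> ennreal (2 * 2 powr q) * (ennreal ((2 * 2 powr q) ^ length ks) * (\<integral>\<^sup>+y. ennreal (norm (u y) powr q) \<partial>lborel))"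
    by (intro mult_left_mono snoc) simp
  also have "\<dots> = ennreal ((2 * 2 powr q) ^ length (ks @ [j])) * (\<integral>\<^sup>+y. ennreal (norm (u y) powr q) \<partial>lborel)"
    by (simp add: ennreal_mult mult.assoc del: ennreal_power)
  finally show ?case .
qed

text \<open>
  The differences in the directions of the chain are estimated by the derivative.  The other
  differences are applied last and cost only a constant.
\<close>
lemma full_diff_Lq:
  fixes u g :: "real^'n \<Rightarrow> complex"
  assumes c: "derivative_chain ks u g" and ks: "distinct ks" and js: "distinct js" "set js = UNIV"
    and h: "\<And>j. h j > 0" and q: "q \<ge> 1" and u: "continuous_on UNIV u"
  shows "(\<integral>\<^sup>+y. ennreal (norm (coord_diffs h js u y) powr q) \<partial>lborel)
    \<le> ennreal ((2 * 2 powr q) ^ CARD('n) * (\<Prod>j\<in>set ks. h j) powr q) * (\<integral>\<^sup>+y. ennreal (norm (g y) powr q) \<partial>lborel)"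
proof -
  have mu: "u \<in> borel_measurable borel" using u by (rule borel_measurable_continuous_onI)
  (* both lists contain every direction once, in a different order *)
  define rs where "rs = filter (\<lambda>j. j \<notin> set ks) js"
  have d: "distinct (ks @ rs)" "set (ks @ rs) = UNIV" using ks js by (auto simp: rs_def)
  have split: "coord_diffs h js u = coord_diffs h rs (coord_diffs h ks u)"
  proof -
    have "coord_diffs h js u = coord_diffs h (ks @ rs) u"
      using coord_diffs_sum[OF js(1), of h u] coord_diffs_sum[OF d(1), of h u] js(2) d(2) by (intro ext) simp
    then show ?thesis by (simp add: coord_diffs_def)
  qed
  have len: "length rs \<le> CARD('n)"
    using d(1) distinct_card[of rs] card_mono[of UNIV "set rs"] by simp
  have "(\<integral>\<^sup>+y. ennreal (norm (coord_diffs h js u y) powr q) \<partial>lborel)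
    \<le> ennreal ((2 * 2 powr q) ^ length rs) * (\<integral>\<^sup>+y. ennreal (norm (coord_diffs h ks u y) powr q) \<partial>lborel)"
    unfolding split by (rule coord_diffs_Lq_crude[OF coord_diffs_measurable[OF mu] q])
  also have "\<dots> \<le> ennreal ((2 * 2 powr q) ^ CARD('n)) * (ennreal ((\<Prod>j\<in>set ks. h j) powr q) * (\<integral>\<^sup>+y. ennreal (norm (g y) powr q) \<partial>lborel))"
  proof (intro mult_mono coord_diffs_Lq[OF c ks h q u] ennreal_leI power_increasing len)
    have "2 powr q \<ge> 1" using q by (intro ge_one_powr_ge_zero) auto
    then show "1 \<le> 2 * 2 powr q" by simp
  qed simp_all
  finally show ?thesis by (simp add: ennreal_mult mult.assoc del: ennreal_power)
qed

section \<open>Square integrals by interpolation\<close>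

text \<open>
  Log-convexity of the integral of \<open>F\<close> to the power \<open>s\<close> as a function of \<open>s\<close>, by integrating Young's
  inequality for the normalised functions.
\<close>
lemma interpolation:
  fixes F :: "'a \<Rightarrow> real"
  assumes [measurable]: "F \<in> borel_measurable M" and F0: "\<And>x. F x \<ge> 0"
    and a: "a > 0" "(\<integral>\<^sup>+x. ennreal (F x powr q) \<partial>M) \<le> ennreal a"
    and b: "b > 0" "(\<integral>\<^sup>+x. ennreal (F x powr p) \<partial>M) \<le> ennreal b"
    and t: "0 \<le> t" "t \<le> 1"
  shows "(\<integral>\<^sup>+x. ennreal (F x powr (q * t + p * (1 - t))) \<partial>M) \<le> ennreal (a powr t * b powr (1 - t))"
proof -
  define c where "c = a powr t * b powr (1 - t)"
  have c: "c > 0" using a b by (simp add: c_def)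
  have ptw: "F x powr (q * t + p * (1 - t)) \<le> c * t / a * F x powr q + c * (1 - t) / b * F x powr p" for x
  proof (cases "F x = 0")
    case False
    then have x: "F x > 0" using F0[of x] by simp
    have "(F x powr q / a) powr t * (F x powr p / b) powr (1 - t) \<le> t * (F x powr q / a) + (1 - t) * (F x powr p / b)"
      using x a b t by (intro Youngs_inequality_0) auto
    also have "(F x powr q / a) powr t * (F x powr p / b) powr (1 - t) = F x powr (q * t + p * (1 - t)) / c"
      using x a b by (simp add: powr_divide powr_powr powr_add c_def)
    finally have "F x powr (q * t + p * (1 - t)) \<le> c * (t * (F x powr q / a) + (1 - t) * (F x powr p / b))"
      using c by (simp add: field_simps)
    then show ?thesis by (simp add: algebra_simps)
  qed (use c a b t in auto)
  have co: "c * t / a \<ge> 0" "c * (1 - t) / b \<ge> 0" using c a b t by auto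
  have "(\<integral>\<^sup>+x. ennreal (F x powr (q * t + p * (1 - t))) \<partial>M)
    \<le> (\<integral>\<^sup>+x. ennreal (c * t / a) * ennreal (F x powr q) + ennreal (c * (1 - t) / b) * ennreal (F x powr p) \<partial>M)"
  proof (rule nn_integral_mono)
    fix x
    have "ennreal (F x powr (q * t + p * (1 - t))) \<le> ennreal (c * t / a * F x powr q + c * (1 - t) / b * F x powr p)"
      by (rule ennreal_leI[OF ptw])
    also have "\<dots> = ennreal (c * t / a) * ennreal (F x powr q) + ennreal (c * (1 - t) / b) * ennreal (F x powr p)"
      using co by (simp only: ennreal_plus ennreal_mult powr_ge_zero mult_nonneg_nonneg)
    finally show "ennreal (F x powr (q * t + p * (1 - t))) \<le> \<dots>" .
  qed
  also have "\<dots> = ennreal (c * t / a) * (\<integral>\<^sup>+x. ennreal (F x powr q) \<partial>M) + ennreal (c * (1 - t) / b) * (\<integral>\<^sup>+x. ennreal (F x powr p) \<partial>M)"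
    by (simp add: nn_integral_add nn_integral_cmult)
  also have "\<dots> \<le> ennreal (c * t / a) * ennreal a + ennreal (c * (1 - t) / b) * ennreal b"
    by (intro add_mono mult_left_mono a b) auto
  also have "\<dots> = ennreal (c * t / a * a + c * (1 - t) / b * b)"
    using co a b by (simp only: ennreal_plus ennreal_mult mult_nonneg_nonneg less_imp_le)
  also have "c * t / a * a + c * (1 - t) / b * b = c * t + c * (1 - t)" using a(1) b(1) by simp
  also have "\<dots> = c" by (simp add: algebra_simps)
  finally show ?thesis unfolding c_def .
qed

text \<open>
  With \<open>\<delta> = 0\<close> this is the product of the steps, the borderline at which the norms of all Haar
  blocks have the same bound.  A positive \<open>\<delta>\<close> gains a power for small and for large steps.
\<close>
definition decay :: "real \<Rightarrow> ('n::finite \<Rightarrow> real) \<Rightarrow> real" where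
  "decay \<delta> h = (\<Prod>i\<in>UNIV. h i * min (h i) (1 / h i) powr \<delta>)"

lemma decay_antimono:
  assumes "\<delta> \<le> \<delta>'" "\<And>i. h i > 0"
  shows "decay \<delta>' h \<le> decay \<delta> h"
  unfolding decay_def
proof (rule prod_mono, intro conjI)
  fix i
  have m: "0 < min (h i) (1 / h i)" "min (h i) (1 / h i) \<le> 1"
    using assms(2)[of i] by (auto simp: min_le_iff_disj divide_le_eq_1)
  show "0 \<le> h i * min (h i) (1 / h i) powr \<delta>'" using assms(2)[of i] by simp
  have "min (h i) (1 / h i) powr \<delta>' \<le> min (h i) (1 / h i) powr \<delta>"
    using m assms(1) by (intro powr_mono') auto
  then show "h i * min (h i) (1 / h i) powr \<delta>' \<le> h i * min (h i) (1 / h i) powr \<delta>"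
    using assms(2)[of i] by (intro mult_left_mono) auto
qed

text \<open>
  A large step \<open>h > 1\<close> contributes \<open>h\<^sup>\<delta>\<close> on the left and \<open>h\<^sup>1\<^sup>-\<^sup>\<delta>\<close> on the right, whence \<open>\<delta> \<le> 1/2\<close>.
\<close>
lemma decay_small_steps:
  fixes h :: "'n::finite \<Rightarrow> real"
  assumes h: "\<And>i. h i > 0" and \<delta>: "0 < \<delta>" "\<delta> \<le> 1 / 2"
  shows "(\<Prod>i\<in>UNIV. h i) powr \<delta> * (\<Prod>i\<in>{i. h i \<le> 1}. h i) \<le> decay \<delta> h"
proof -
  have "(\<Prod>i\<in>{i. h i \<le> 1}. h i) = (\<Prod>i\<in>UNIV. if h i \<le> 1 then h i else 1)"
    by (simp add: prod.If_cases)
  moreover have "(\<Prod>i\<in>UNIV. h i) powr \<delta> = (\<Prod>i\<in>UNIV. h i powr \<delta>)"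
    using h by (intro prod_powr_distrib less_imp_le)
  ultimately have "(\<Prod>i\<in>UNIV. h i) powr \<delta> * (\<Prod>i\<in>{i. h i \<le> 1}. h i) = (\<Prod>i\<in>UNIV. h i powr \<delta> * (if h i \<le> 1 then h i else 1))"
    by (simp add: prod.distrib)
  also have "\<dots> \<le> decay \<delta> h" unfolding decay_def
  proof (rule prod_mono, intro conjI)
    fix i
    show "0 \<le> h i powr \<delta> * (if h i \<le> 1 then h i else 1)" using h[of i] by simp
    show "h i powr \<delta> * (if h i \<le> 1 then h i else 1) \<le> h i * min (h i) (1 / h i) powr \<delta>"
    proof (cases "h i \<le> 1")
      case True
      then have "h i \<le> 1 / h i" using h[of i] by (simp add: field_simps mult_le_one)
      then show ?thesis using True by (simp add: mult.commute min_def)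
    next
      case False
      then have g: "1 / h i \<le> h i" "1 < h i" using mult_mono[of 1 "h i" 1 "h i"] by (auto simp: field_simps)
      have "h i powr \<delta> \<le> h i powr (1 - \<delta>)" using g \<delta> by (intro powr_mono) auto
      also have "\<dots> = h i * (1 / h i) powr \<delta>" using h[of i] by (simp add: powr_diff powr_divide)
      finally show ?thesis using False g by (simp add: min_def)
    qed
  qed
  finally show ?thesis .
qed

lemma decay_large_steps:
  fixes h :: "'n::finite \<Rightarrow> real"
  assumes h: "\<And>i. h i > 1"
  shows "decay \<delta> h = (\<Prod>i\<in>UNIV. h i) powr (1 - \<delta>)"
proof -
  have "h i * min (h i) (1 / h i) powr \<delta> = h i powr (1 - \<delta>)" for i
  proof -
    have "1 / h i < 1" using h[of i] by simp
    then have "min (h i) (1 / h i) = 1 / h i" using h[of i] by (intro min_absorb2) linarith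
    then show ?thesis using h[of i] by (simp add: powr_diff powr_divide)
  qed
  then show ?thesis unfolding decay_def
    using h by (subst prod_powr_distrib) (auto intro: less_imp_le less_trans[OF zero_less_one])
qed

lemma L2_bound_by_sup:
  fixes u :: "'a \<Rightarrow> complex"
  assumes [measurable]: "u \<in> borel_measurable M" and S: "AE x in M. norm (u x) \<le> S" "S > 0" and s: "s \<ge> 0"
    and I: "(\<integral>\<^sup>+x. ennreal (norm (u x) powr (2 - s)) \<partial>M) \<le> ennreal I" "I \<ge> 0"
  shows "(\<integral>\<^sup>+x. ennreal ((norm (u x))\<^sup>2) \<partial>M) \<le> ennreal (S powr s * I)"
proof -
  have "(\<integral>\<^sup>+x. ennreal ((norm (u x))\<^sup>2) \<partial>M) \<le> (\<integral>\<^sup>+x. ennreal (S powr s) * ennreal (norm (u x) powr (2 - s)) \<partial>M)"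
  proof (rule nn_integral_mono_AE)
    show "AE x in M. ennreal ((norm (u x))\<^sup>2) \<le> ennreal (S powr s) * ennreal (norm (u x) powr (2 - s))"
      using S(1)
    proof eventually_elim
      case (elim x)
      have "(norm (u x))\<^sup>2 \<le> S powr s * norm (u x) powr (2 - s)"
      proof (cases "u x = 0")
        case False
        then have "(norm (u x))\<^sup>2 = norm (u x) powr s * norm (u x) powr (2 - s)"
          by (simp add: powr_add[symmetric])
        also have "\<dots> \<le> S powr s * norm (u x) powr (2 - s)"
          using elim s by (intro mult_right_mono powr_mono2) auto
        finally show ?thesis .
      qed simp
      then show ?case by (simp add: ennreal_mult[symmetric] ennreal_leI)
    qed
  qed
  also have "\<dots> = ennreal (S powr s) * (\<integral>\<^sup>+x. ennreal (norm (u x) powr (2 - s)) \<partial>M)"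
    by (rule nn_integral_cmult) measurable
  also have "\<dots> \<le> ennreal (S powr s) * ennreal I" by (intro mult_left_mono I) simp
  finally show ?thesis using I(2) by (simp add: ennreal_mult)
qed

text \<open>
  Here \<open>\<eta>\<close> is the set of the small steps.  With \<open>s = 1 - p (1 - 1/q)\<close>, which is positive exactly
  if \<open>1/p + 1/q > 1\<close>, one has \<open>2 - s = q (1/q) + p (1 - 1/q)\<close>, so that interpolation
  gives the first power of the product of the small steps, and the remaining factor \<open>\<bar>u\<bar>\<^sup>s\<close>
  adds a small positive power of the product of all steps.
\<close>
lemma L2_bound_small:
  fixes u :: "('n::finite \<Rightarrow> real) \<Rightarrow> 'a \<Rightarrow> complex"
  assumes p: "p \<ge> 1" and q: "q > 1" "1 / p + 1 / q > 1" and r: "r > 1" and K: "K \<ge> 1"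
    and m: "\<And>h. u h \<in> borel_measurable M"
    and A: "\<And>h. (\<And>i. h i > 0) \<Longrightarrow> (\<integral>\<^sup>+y. ennreal (norm (u h y) powr p) \<partial>M) \<le> ennreal K"
    and B: "\<And>h. (\<And>i. h i > 0) \<Longrightarrow> (\<integral>\<^sup>+y. ennreal (norm (u h y) powr q) \<partial>M) \<le> ennreal (K * (\<Prod>i\<in>\<eta>. h i) powr q)"
    and C: "\<And>h. (\<And>i. h i > 0) \<Longrightarrow> AE y in M. norm (u h y) \<le> K"
    and D: "\<And>h. (\<And>i. h i > 0) \<Longrightarrow> AE y in M. norm (u h y) \<le> K * (\<Prod>i\<in>UNIV. h i) powr (1 - 1 / r)"
  shows "\<exists>\<delta>>0. \<exists>C>0. \<forall>h. (\<forall>i. h i > 0) \<longrightarrow> {i. h i \<le> 1} = \<eta> \<longrightarrow>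
    (\<integral>\<^sup>+y. ennreal ((norm (u h y))\<^sup>2) \<partial>M) \<le> ennreal (C * decay \<delta> h)"
proof -
  define a where "a = 1 - 1 / r"
  have a: "a > 0" using r by (simp add: a_def)
  define s where "s = 1 - p * (1 - 1 / q)"
  have s: "s > 0"
  proof -
    have "1 - 1 / q < 1 / p" using q by simp
    then have "p * (1 - 1 / q) < p * (1 / p)" using p by (intro mult_strict_left_mono) auto
    then show ?thesis using p by (simp add: s_def)
  qed
  define \<delta> where "\<delta> = min (a * s) (1 / 2)"
  have \<delta>: "0 < \<delta>" "\<delta> \<le> 1 / 2" "\<delta> \<le> a * s" using a s by (auto simp: \<delta>_def)
  (* the share of the supremum bound by the product of the steps that is used,
     the rest being the bound by a constant *)
  define \<theta> where "\<theta> = \<delta> / (a * s)"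
  have \<theta>: "0 < \<theta>" "\<theta> \<le> 1" "a * \<theta> * s = \<delta>" using \<delta> a s by (auto simp: \<theta>_def)
  have "(\<integral>\<^sup>+y. ennreal ((norm (u h y))\<^sup>2) \<partial>M) \<le> ennreal (K powr (s + 1) * decay \<delta> h)"
    if h': "\<forall>i. h i > 0" and sm: "{i. h i \<le> 1} = \<eta>" for h
  proof -
    have h: "\<And>i. h i > 0" using h' by blast
    define P where "P = (\<Prod>i\<in>UNIV. h i)"
    define E where "E = (\<Prod>i\<in>\<eta>. h i)"
    have P: "P > 0" and E: "E > 0" unfolding P_def E_def using h by (auto intro: prod_pos)
    have sup: "AE y in M. norm (u h y) \<le> K * P powr (a * \<theta>)"
      using C[of h, OF h] D[of h, OF h]
    proof eventually_elim
      case (elim y)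
      then have "norm (u h y) \<le> K * min 1 (P powr a)" using K by (auto simp: P_def a_def min_def)
      also have "min 1 (P powr a) \<le> (P powr a) powr \<theta>"
      proof (cases "P powr a \<le> 1")
        case True
        have "(P powr a) powr 1 \<le> (P powr a) powr \<theta>" using True P \<theta> by (intro powr_mono') auto
        then show ?thesis using True P by simp
      next
        case False
        have "1 \<le> (P powr a) powr \<theta>" by (rule ge_one_powr_ge_zero) (use False \<theta> in linarith)+
        then show ?thesis by simp
      qed
      finally show ?case using K by (simp add: powr_powr mult_left_mono)
    qed
    have Ipos: "(K * E powr q) > 0" using K E by simp
    have mF: "(\<lambda>y. norm (u h y)) \<in> borel_measurable M" using m by measurable
    have "(\<integral>\<^sup>+y. ennreal (norm (u h y) powr (q * (1 / q) + p * (1 - 1 / q))) \<partial>M)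
      \<le> ennreal ((K * E powr q) powr (1 / q) * K powr (1 - 1 / q))"
      using q K by (intro interpolation[OF mF _ Ipos B[of h, OF h, folded E_def] _ A[of h, OF h]]) auto
    also have "q * (1 / q) + p * (1 - 1 / q) = 2 - s" using q by (simp add: s_def)
    also have "(K * E powr q) powr (1 / q) * K powr (1 - 1 / q) = K * E"
      using K E q by (simp add: powr_mult powr_powr powr_diff)
    finally have I: "(\<integral>\<^sup>+y. ennreal (norm (u h y) powr (2 - s)) \<partial>M) \<le> ennreal (K * E)" .
    have "(\<integral>\<^sup>+y. ennreal ((norm (u h y))\<^sup>2) \<partial>M) \<le> ennreal ((K * P powr (a * \<theta>)) powr s * (K * E))"
      using K P E s by (intro L2_bound_by_sup[OF m sup _ _ I]) auto
    also have "(K * P powr (a * \<theta>)) powr s * (K * E) = K powr (s + 1) * (P powr \<delta> * E)"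
    proof -
      have "(K * P powr (a * \<theta>)) powr s = K powr s * P powr (a * \<theta> * s)"
        using K P by (simp add: powr_mult powr_powr)
      then show ?thesis using K unfolding \<theta>(3) by (simp add: powr_add mult_ac)
    qed
    also have "ennreal \<dots> \<le> ennreal (K powr (s + 1) * decay \<delta> h)"
      using decay_small_steps[of h \<delta>, OF h \<delta>(1,2)] unfolding sm P_def E_def by (intro ennreal_leI mult_left_mono) auto
    finally show ?thesis .
  qed
  moreover have "K powr (s + 1) > 0" using K by simp
  ultimately show ?thesis using \<delta>(1) by blast
qed

text \<open>
  If no step is small, boundedness and the exponent \<open>p\<close> suffice for \<open>p \<le> 2\<close>.  If \<open>p > 2\<close>, then
  \<open>q < 2 < p\<close>, and interpolation between \<open>q\<close> and \<open>p\<close> gives the power \<open>q t\<close> of the product of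
  the steps; \<open>q t < 1\<close> is again equivalent to \<open>1/p + 1/q > 1\<close>.
\<close>
lemma L2_bound_large:
  fixes u :: "('n::finite \<Rightarrow> real) \<Rightarrow> 'a \<Rightarrow> complex"
  assumes p: "p \<ge> 1" and q: "q > 1" "1 / p + 1 / q > 1" and K: "K \<ge> 1"
    and m: "\<And>h. u h \<in> borel_measurable M"
    and A: "\<And>h. (\<And>i. h i > 0) \<Longrightarrow> (\<integral>\<^sup>+y. ennreal (norm (u h y) powr p) \<partial>M) \<le> ennreal K"
    and B: "\<And>h. (\<And>i. h i > 0) \<Longrightarrow> (\<integral>\<^sup>+y. ennreal (norm (u h y) powr q) \<partial>M) \<le> ennreal (K * (\<Prod>i\<in>UNIV. h i) powr q)"
    and C: "\<And>h. (\<And>i. h i > 0) \<Longrightarrow> AE y in M. norm (u h y) \<le> K"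
  shows "\<exists>\<delta>>0. \<exists>C>0. \<forall>h. (\<forall>i. h i > 0) \<longrightarrow> {i. h i \<le> 1} = {} \<longrightarrow>
    (\<integral>\<^sup>+y. ennreal ((norm (u h y))\<^sup>2) \<partial>M) \<le> ennreal (C * decay \<delta> h)"
proof (cases "p \<le> 2")
  case True
  have "(\<integral>\<^sup>+y. ennreal ((norm (u h y))\<^sup>2) \<partial>M) \<le> ennreal (K powr (2 - p) * K * decay (1 / 2) h)"
    if h': "\<forall>i. h i > 0" and lg: "{i. h i \<le> 1} = {}" for h
  proof -
    have h: "\<And>i. h i > 0" "\<And>i. h i > 1" using h' lg by (auto simp: not_le)
    have I: "(\<integral>\<^sup>+y. ennreal (norm (u h y) powr (2 - (2 - p))) \<partial>M) \<le> ennreal K" using A[of h, OF h(1)] by simp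
    have "(\<integral>\<^sup>+y. ennreal ((norm (u h y))\<^sup>2) \<partial>M) \<le> ennreal (K powr (2 - p) * K)"
      using K True by (intro L2_bound_by_sup[OF m C[of h, OF h(1)] _ _ I]) auto
    also have "\<dots> \<le> ennreal (K powr (2 - p) * K * decay (1 / 2) h)"
    proof -
      have "1 \<le> (\<Prod>i\<in>UNIV. h i)" using h(2) by (intro prod_ge_1) (auto intro: less_imp_le)
      then have "1 \<le> decay (1 / 2) h" unfolding decay_large_steps[of h, OF h(2)] by (intro ge_one_powr_ge_zero) auto
      then show ?thesis using K by (intro ennreal_leI) simp
    qed
    finally show ?thesis .
  qed
  moreover have "K powr (2 - p) * K > 0" using K by simp
  ultimately show ?thesis by (intro exI[of _ "1 / 2"]) auto
next
  case False
  have "1 / p < 1 / 2" using False by (simp add: field_simps)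
  then have "1 / 2 < 1 / q" using q by linarith
  then have q2: "q < 2" using q(1) by (simp add: field_simps)
  define t where "t = (p - 2) / (p - q)"
  have t: "0 \<le> t" "t \<le> 1" using False q2 by (auto simp: t_def field_simps)
  have qt: "q * t < 1"
  proof -
    have "p * q * 1 < p * q * (1 / p + 1 / q)" using q False by (intro mult_strict_left_mono) auto
    also have "\<dots> = q + p" using q False by (simp add: field_simps)
    finally have "q * (p - 2) < p - q" by (simp add: algebra_simps)
    then show ?thesis using False q2 by (simp add: t_def field_simps)
  qed
  have two: "q * t + p * (1 - t) = 2"
  proof -
    have "t * (p - q) = p - 2" using False q2 by (simp add: t_def)
    then show ?thesis by (simp add: algebra_simps)
  qed
  have "(\<integral>\<^sup>+y. ennreal ((norm (u h y))\<^sup>2) \<partial>M) \<le> ennreal (K * decay (1 - q * t) h)"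
    if h': "\<forall>i. h i > 0" and lg: "{i. h i \<le> 1} = {}" for h
  proof -
    have h: "\<And>i. h i > 0" "\<And>i. h i > 1" using h' lg by (auto simp: not_le)
    define P where "P = (\<Prod>i\<in>UNIV. h i)"
    have P: "P > 0" unfolding P_def using h by (auto intro: prod_pos)
    have Ipos: "(K * P powr q) > 0" using K P by simp
    have mF: "(\<lambda>y. norm (u h y)) \<in> borel_measurable M" using m by measurable
    have "(\<integral>\<^sup>+y. ennreal (norm (u h y) powr (q * t + p * (1 - t))) \<partial>M)
      \<le> ennreal ((K * P powr q) powr t * K powr (1 - t))"
      using t K by (intro interpolation[OF mF _ Ipos B[of h, OF h(1), folded P_def] _ A[of h, OF h(1)]]) auto
    also have "(K * P powr q) powr t * K powr (1 - t) = K * P powr (q * t)"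
      using K P by (simp add: powr_mult powr_powr powr_diff)
    also have "P powr (q * t) = decay (1 - q * t) h"
      unfolding decay_large_steps[of h, OF h(2)] P_def by simp
    finally have "(\<integral>\<^sup>+y. ennreal (norm (u h y) powr 2) \<partial>M) \<le> ennreal (K * decay (1 - q * t) h)" unfolding two .
    then show ?thesis by simp
  qed
  then show ?thesis using qt K by (intro exI[of _ "1 - q * t"] conjI exI[of _ K]) auto
qed

text \<open>
  There are finitely many sets of small steps; the worst \<open>\<delta>\<close> and the sum of the constants serve
  for all of them.
\<close>
lemma L2_bound:
  fixes u :: "('n::finite \<Rightarrow> real) \<Rightarrow> 'a \<Rightarrow> complex" and p :: "'n set \<Rightarrow> real"
  assumes p: "p {} \<ge> 1" "\<And>\<eta>. \<eta> \<noteq> {} \<Longrightarrow> p \<eta> > 1" "\<And>\<eta>. \<eta> \<noteq> {} \<Longrightarrow> 1 / p {} + 1 / p \<eta> > 1"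
    and K: "K \<ge> 1" and m: "\<And>h. u h \<in> borel_measurable M"
    and A: "\<And>h. (\<And>i. h i > 0) \<Longrightarrow> (\<integral>\<^sup>+y. ennreal (norm (u h y) powr p {}) \<partial>M) \<le> ennreal K"
    and B: "\<And>h \<eta>. (\<And>i. h i > 0) \<Longrightarrow> \<eta> \<noteq> {} \<Longrightarrow>
      (\<integral>\<^sup>+y. ennreal (norm (u h y) powr p \<eta>) \<partial>M) \<le> ennreal (K * (\<Prod>i\<in>\<eta>. h i) powr p \<eta>)"
    and C: "\<And>h. (\<And>i. h i > 0) \<Longrightarrow> AE y in M. norm (u h y) \<le> K"
    and D: "\<And>h. (\<And>i. h i > 0) \<Longrightarrow> AE y in M. norm (u h y) \<le> K * (\<Prod>i\<in>UNIV. h i) powr (1 - 1 / p UNIV)"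
  shows "\<exists>\<delta>>0. \<exists>C>0. \<forall>h. (\<forall>i. h i > 0) \<longrightarrow>
    (\<integral>\<^sup>+y. ennreal ((norm (u h y))\<^sup>2) \<partial>M) \<le> ennreal (C * decay \<delta> h)"
proof -
  define Q where "Q \<eta> \<delta> C \<longleftrightarrow> (\<forall>h. (\<forall>i. h i > 0) \<longrightarrow> {i. h i \<le> 1} = \<eta> \<longrightarrow>
    (\<integral>\<^sup>+y. ennreal ((norm (u h y))\<^sup>2) \<partial>M) \<le> ennreal (C * decay \<delta> h))" for \<eta> \<delta> C
  have "\<exists>\<delta>>0. \<exists>C>0. Q \<eta> \<delta> C" for \<eta>
  proof (cases "\<eta> = {}")
    case True
    show ?thesis unfolding True Q_def
      by (rule L2_bound_large[OF p(1) p(2,3)[OF UNIV_not_empty] K m A B C]) auto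
  next
    case False
    show ?thesis unfolding Q_def
      by (rule L2_bound_small[OF p(1) p(2,3)[OF False] p(2)[OF UNIV_not_empty] K m A B[OF _ False] C D]) auto
  qed
  then obtain \<delta> C where \<delta>: "\<And>\<eta>. \<delta> \<eta> > 0" and C: "\<And>\<eta>. C \<eta> > 0" and Q: "\<And>\<eta>. Q \<eta> (\<delta> \<eta>) (C \<eta>)"
    by metis
  have bd: "(\<integral>\<^sup>+y. ennreal ((norm (u h y))\<^sup>2) \<partial>M) \<le> ennreal (C \<eta> * decay (\<delta> \<eta>) h)"
    if "\<forall>i. h i > 0" "{i. h i \<le> 1} = \<eta>" for \<eta> h
    using Q[of \<eta>] that unfolding Q_def by blast
  define d where "d = Min (range \<delta>)"
  define c where "c = (\<Sum>\<eta>\<in>UNIV. C \<eta>)"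
  have d: "d > 0" "\<And>\<eta>. d \<le> \<delta> \<eta>" unfolding d_def using \<delta> by (auto simp: Min_gr_iff)
  have c: "C \<eta> \<le> c" for \<eta> unfolding c_def using C by (intro member_le_sum) (auto intro: less_imp_le)
  have c0: "c > 0" using c[of "{}"] C[of "{}"] by linarith
  have "(\<integral>\<^sup>+y. ennreal ((norm (u h y))\<^sup>2) \<partial>M) \<le> ennreal (c * decay d h)" if h: "\<forall>i. h i > 0" for h
  proof -
    let ?\<eta> = "{i. h i \<le> 1}"
    have "decay d h \<ge> 0" unfolding decay_def using h by (intro prod_nonneg mult_nonneg_nonneg) (auto intro: less_imp_le)
    then have "C ?\<eta> * decay (\<delta> ?\<eta>) h \<le> c * decay d h"
      using C[of ?\<eta>] c[of ?\<eta>] c0 h decay_antimono[OF d(2)[of ?\<eta>], of h]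
      by (intro order_trans[OF mult_left_mono mult_right_mono]) (auto intro: less_imp_le)
    then show ?thesis using bd[OF h refl] by (meson ennreal_leI order_trans)
  qed
  with d(1) c0 show ?thesis by blast
qed

section \<open>The Haar expansion\<close>

lemma integral_lborel_shift:
  fixes F :: "'a::euclidean_space \<Rightarrow> complex"
  assumes "F \<in> borel_measurable borel"
  shows "(\<integral>t. F (t + a) \<partial>lborel) = (\<integral>t. F t \<partial>lborel)"
  using integral_lborel_affine[OF assms, of 1 a] by (simp add: add.commute)

lemma integral_lborel_stretch:
  fixes F :: "real^'n \<Rightarrow> complex" and r :: "'n \<Rightarrow> real"
  assumes [measurable]: "F \<in> borel_measurable borel" and r: "\<And>i. r i > 0"
  shows "(\<integral>x. F x \<partial>lborel) = (\<Prod>i\<in>UNIV. r i) *\<^sub>R (\<integral>x. F (\<chi> i. r i * x $ i) \<partial>lborel)"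
proof -
  define c where "c b = (\<Sum>i\<in>UNIV. r i * b $ i)" for b :: "real^'n"
  have ca: "c (axis i 1) = r i" for i by (simp add: c_def axis_def if_distrib cong: if_cong)
  have B: "(Basis :: (real^'n) set) = range (\<lambda>i. axis i 1)" by (auto simp: Basis_vec_def)
  have inj: "inj (\<lambda>i. axis i 1 :: real^'n)" by (auto simp: inj_on_def axis_eq_axis)
  have nz: "c j \<noteq> 0" if j: "j \<in> Basis" for j
  proof -
    obtain i where "j = axis i 1" using j unfolding B by blast
    then show ?thesis using r[of i] by (simp add: ca)
  qed
  have T: "0 + (\<Sum>j\<in>Basis. (c j * (x \<bullet> j)) *\<^sub>R j) = (\<chi> i. r i * x $ i)" for x :: "real^'n"
  proof -
    have "(\<Sum>j\<in>Basis. (c j * (x \<bullet> j)) *\<^sub>R j) = (\<Sum>i\<in>UNIV. (r i * x $ i) *\<^sub>R axis i 1)"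
      unfolding B by (subst sum.reindex[OF inj]) (simp add: ca inner_axis)
    then show ?thesis by (simp add: vec_eq_iff axis_def if_distrib cong: if_cong)
  qed
  have P: "(\<Prod>j\<in>Basis. \<bar>c j\<bar>) = (\<Prod>i\<in>UNIV. r i)"
    unfolding B using r by (subst prod.reindex[OF inj]) (simp add: ca abs_of_pos)
  have mT: "(\<lambda>x::real^'n. \<chi> i. r i * x $ i) \<in> borel_measurable borel"
    by (intro borel_measurable_continuous_onI continuous_on_vec_lambda continuous_intros)
  have "(lborel :: (real^'n) measure) = density (distr lborel borel (\<lambda>x. \<chi> i. r i * x $ i)) (\<lambda>_. ennreal (\<Prod>i\<in>UNIV. r i))"
    using lborel_affine_euclidean[of c 0] nz unfolding T P by blast
  then have "(\<integral>x. F x \<partial>lborel) = (\<integral>x. F x \<partial>density (distr lborel borel (\<lambda>x. \<chi> i. r i * x $ i)) (\<lambda>_. ennreal (\<Prod>i\<in>UNIV. r i)))"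
    by (rule arg_cong)
  also have "\<dots> = (\<Prod>i\<in>UNIV. r i) *\<^sub>R (\<integral>x. F (\<chi> i. r i * x $ i) \<partial>lborel)"
  proof -
    have "0 \<le> (\<Prod>i\<in>UNIV. r i)" by (intro prod_nonneg less_imp_le r)
    then show ?thesis using mT by (subst integral_density) (simp_all add: integral_distr)
  qed
  finally show ?thesis .
qed

text \<open>
  Half-open, so that the box of twice the size in one direction is a disjoint union of two
  translates.
\<close>
definition half_box :: "('n \<Rightarrow> real) \<Rightarrow> (real^'n) set" where
  "half_box r = {t. \<forall>i. 0 \<le> t $ i \<and> t $ i < r i}"

lemma half_box_borel[measurable]: "half_box r \<in> sets borel"
  unfolding half_box_def by measurable

lemma emeasure_half_box:
  assumes "\<And>i. r i > 0"
  shows "emeasure lborel (half_box r :: (real^'n) set) = ennreal (\<Prod>i\<in>UNIV. r i)"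
proof (rule antisym)
  let ?b = "(\<chi> i. r i) :: real^'n"
  have B: "(Basis :: (real^'n) set) = range (\<lambda>i. axis i 1)" by (auto simp: Basis_vec_def)
  have inj: "inj (\<lambda>i. axis i 1 :: real^'n)" by (auto simp: inj_on_def axis_eq_axis)
  have le: "(0::real^'n) \<bullet> j \<le> ?b \<bullet> j" if "j \<in> Basis" for j
    using that assms unfolding B by (auto simp: inner_axis intro: less_imp_le)
  have P: "(\<Prod>j\<in>Basis. (?b - 0) \<bullet> j) = (\<Prod>i\<in>UNIV. r i)"
    unfolding B by (subst prod.reindex[OF inj]) (simp add: inner_axis)
  have "half_box r \<subseteq> cbox 0 ?b" by (auto simp: half_box_def mem_box_cart less_imp_le)
  then have "emeasure lborel (half_box r :: (real^'n) set) \<le> emeasure lborel (cbox 0 ?b)" by (intro emeasure_mono) auto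
  also have "\<dots> = ennreal (\<Prod>i\<in>UNIV. r i)" using emeasure_lborel_cbox[OF le] P by simp
  finally show "emeasure lborel (half_box r :: (real^'n) set) \<le> ennreal (\<Prod>i\<in>UNIV. r i)" .
  have "box 0 ?b \<subseteq> half_box r" by (auto simp: half_box_def mem_box_cart intro: less_imp_le)
  then have "emeasure lborel (box 0 ?b) \<le> emeasure lborel (half_box r :: (real^'n) set)" by (intro emeasure_mono) auto
  moreover have "emeasure lborel (box 0 ?b) = ennreal (\<Prod>i\<in>UNIV. r i)" using emeasure_lborel_box[OF le] P by simp
  ultimately show "ennreal (\<Prod>i\<in>UNIV. r i) \<le> emeasure lborel (half_box r :: (real^'n) set)" by simp
qed

definition avg :: "real \<Rightarrow> real \<Rightarrow> real" where
  "avg r s = indicator {0..<r} s / r"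

lemma avg_measurable[measurable]: "avg r \<in> borel_measurable borel"
  unfolding avg_def by measurable

lemma prod_avg: "(\<Prod>i\<in>UNIV. avg (r i) (t $ i)) = indicator (half_box r) t / (\<Prod>i\<in>UNIV. r i)"
proof -
  have "(\<Prod>i\<in>UNIV. indicator {0..<r i} (t $ i)) = (indicator (half_box r) t :: real)"
  proof (cases "t \<in> half_box r")
    case True
    then show ?thesis by (simp add: half_box_def indicator_def)
  next
    case False
    then obtain i where "\<not> (0 \<le> t $ i \<and> t $ i < r i)" by (auto simp: half_box_def)
    then have "indicator {0..<r i} (t $ i) = (0::real)" by simp
    then have "(\<Prod>i\<in>UNIV. indicator {0..<r i} (t $ i)) = (0::real)" by (intro prod_zero) auto
    then show ?thesis using False by simp
  qed
  then show ?thesis unfolding avg_def by (simp add: prod_dividef)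
qed

lemma integrable_prod_avg:
  assumes "\<And>i. r i > 0"
  shows "integrable lborel (\<lambda>t::real^'n. \<Prod>i\<in>UNIV. avg (r i) (t $ i))"
  unfolding prod_avg using emeasure_half_box[of r] assms
  by (intro integrable_divide integrable_real_indicator) auto

text \<open>
  The difference of the averages over \<open>[0, r)\<close> and \<open>[0, 2r)\<close> is the Haar function, a difference of
  two translates.
\<close>
lemma avg_diff: "r > 0 \<Longrightarrow> avg r s - avg (2 * r) s = avg r s / 2 - avg r (s - r) / 2"
  unfolding avg_def by (auto simp: indicator_def field_simps)

definition haar_block :: "(real^'n \<Rightarrow> complex) \<Rightarrow> ('n \<Rightarrow> real) \<Rightarrow> real^'n \<Rightarrow> complex" where
  "haar_block f h x = (\<integral>t. complex_of_real (\<Prod>i\<in>UNIV. avg (h i) (t $ i) - avg (2 * h i) (t $ i)) * f (x - t) \<partial>lborel)"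

lemma prod_diff_expand:
  fixes f g :: "'i::finite \<Rightarrow> real"
  shows "(\<Prod>i\<in>UNIV. f i - g i) = (\<Sum>S\<in>Pow UNIV. (- 1) ^ card S * (\<Prod>i\<in>UNIV. if i \<in> S then g i else f i))"
proof -
  have "(\<Prod>i\<in>UNIV. f i - g i) = (\<Prod>i\<in>UNIV. - g i + f i)" by simp
  also have "\<dots> = (\<Sum>S\<in>Pow UNIV. (\<Prod>i\<in>S. - g i) * (\<Prod>i\<in>UNIV - S. f i))" by (rule prod_add) simp
  also have "\<dots> = (\<Sum>S\<in>Pow UNIV. (- 1) ^ card S * (\<Prod>i\<in>UNIV. if i \<in> S then g i else f i))"
  proof (rule sum.cong[OF refl])
    fix S :: "'i set"
    have "(\<Prod>i\<in>UNIV. if i \<in> S then g i else f i) = (\<Prod>i\<in>S. g i) * (\<Prod>i\<in>UNIV - S. f i)"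
      by (subst prod.If_cases) (simp_all add: Compl_eq_Diff_UNIV)
    then show "(\<Prod>i\<in>S. - g i) * (\<Prod>i\<in>UNIV - S. f i) = (- 1) ^ card S * (\<Prod>i\<in>UNIV. if i \<in> S then g i else f i)"
      by (simp add: prod_uminus mult.assoc)
  qed
  finally show ?thesis .
qed

text \<open>
  Expanding the product of the Haar functions over the sets of coordinates and translating each
  term moves the differences from the kernel to \<open>f\<close>.
\<close>
lemma haar_block_eq:
  fixes f :: "real^'n \<Rightarrow> complex"
  assumes f[measurable]: "f \<in> borel_measurable borel" and M: "\<And>x. norm (f x) \<le> M" and h: "\<And>i. h i > 0"
    and js: "distinct js" "set js = UNIV"
  shows "haar_block f h x = (\<integral>t. complex_of_real (\<Prod>i\<in>UNIV. avg (h i) (t $ i) / 2) * coord_diffs h js f (x - t) \<partial>lborel)"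
proof -
  define G where "G t = complex_of_real (\<Prod>i\<in>UNIV. avg (h i) (t $ i) / 2)" for t :: "real^'n"
  have [measurable]: "G \<in> borel_measurable borel" unfolding G_def by measurable
  have iG: "integrable lborel G"
    unfolding G_def using integrable_prod_avg[of h, OF h] by (intro integrable_of_real) (simp add: prod_dividef)
  have Gs: "G (t - shift h S) = complex_of_real (\<Prod>i\<in>UNIV. if i \<in> S then avg (h i) (t $ i - h i) / 2 else avg (h i) (t $ i) / 2)" for t S
    unfolding G_def by (intro arg_cong[of _ _ complex_of_real] prod.cong) (auto simp: shift_def)
  have iGf: "integrable lborel (\<lambda>t. G t * f (y - t))" for y
    using M by (intro integrable_mult_bounded[OF iG]) auto
  have iGs: "integrable lborel (\<lambda>t. G (t - shift h S) * f (x - t))" for S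
  proof (rule integrable_mult_bounded[of _ _ "\<lambda>t. f (x - t)" M])
    show "integrable lborel (\<lambda>t. G (t - shift h S))"
      using integrable_lborel_affine[OF iG, of 1 "- shift h S"] by (simp add: add.commute)
  qed (use M in auto)
  have "haar_block f h x = (\<integral>t. (\<Sum>S\<in>Pow UNIV. (- 1) ^ card S * (G (t - shift h S) * f (x - t))) \<partial>lborel)"
    unfolding haar_block_def avg_diff[OF h] prod_diff_expand Gs
    by (simp add: sum_distrib_right mult.assoc)
  also have "\<dots> = (\<Sum>S\<in>Pow UNIV. (- 1) ^ card S * (\<integral>t. G (t - shift h S) * f (x - t) \<partial>lborel))"
    using iGs by (subst Bochner_Integration.integral_sum) auto
  also have "\<dots> = (\<Sum>S\<in>Pow UNIV. (- 1) ^ card S * (\<integral>t. G t * f (x - shift h S - t) \<partial>lborel))"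
  proof (rule sum.cong[OF refl])
    fix S :: "'n set"
    have "(\<lambda>t. G (t - shift h S) * f (x - t)) \<in> borel_measurable borel" by measurable
    from integral_lborel_shift[OF this, of "shift h S"]
    show "(- 1) ^ card S * (\<integral>t. G (t - shift h S) * f (x - t) \<partial>lborel) = (- 1) ^ card S * (\<integral>t. G t * f (x - shift h S - t) \<partial>lborel)"
      by (simp add: diff_diff_add add.commute)
  qed
  also have "\<dots> = (\<integral>t. (\<Sum>S\<in>Pow UNIV. (- 1) ^ card S * (G t * f (x - shift h S - t))) \<partial>lborel)"
    using iGf by (subst Bochner_Integration.integral_sum) auto
  also have "\<dots> = (\<integral>t. G t * coord_diffs h js f (x - t) \<partial>lborel)"
    unfolding coord_diffs_sum[OF js(1)] js(2) by (simp add: sum_distrib_left algebra_simps)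
  finally show ?thesis unfolding G_def .
qed

text \<open>
  The scale \<open>2\<^sup>-\<^sup>k\<^sup>-\<^sup>1\<close>: the block takes the average over sides \<open>2\<^sup>-\<^sup>k\<^sup>-\<^sup>1\<close> minus that over sides \<open>2\<^sup>-\<^sup>k\<close>.
\<close>
definition dyadic :: "('n \<Rightarrow> int) \<Rightarrow> 'n \<Rightarrow> real" where
  "dyadic k i = 2 powr (- of_int (k i) - 1)"

lemma dyadic_pos: "dyadic k i > 0" by (simp add: dyadic_def)

definition index_box :: "nat \<Rightarrow> ('n \<Rightarrow> int) set" where
  "index_box N = PiE UNIV (\<lambda>_. {- int N..<int N})"

lemma index_box_finite: "finite (index_box N :: ('n::finite \<Rightarrow> int) set)"
  unfolding index_box_def by (intro finite_PiE) auto

lemma index_box_mono: "N \<le> M \<Longrightarrow> index_box N \<subseteq> index_box M"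
  unfolding index_box_def by (intro PiE_mono) auto

lemma sum_int_telescope:
  fixes F :: "int \<Rightarrow> real"
  shows "(\<Sum>m\<in>{- int N..<int N}. F (m + 1) - F m) = F (int N) - F (- int N)"
proof -
  have "(\<Sum>m\<in>{a..<a + int n}. F (m + 1) - F m) = F (a + int n) - F a" for a n
  proof (induction n)
    case (Suc n)
    have "{a..<a + int (Suc n)} = insert (a + int n) {a..<a + int n}" by auto
    then show ?case using Suc by (simp add: add_ac)
  qed simp
  from this[of "- int N" "2 * N"] show ?thesis by simp
qed

text \<open>
  The sum over a cube of indices is a product of sums that telescope in each coordinate.
  Expanding the product again gives averages over boxes with the sides \<open>2\<^sup>N\<close> in the directions in
  \<open>S\<close> and \<open>2\<^sup>-\<^sup>N\<close> in the others, rescaled here to the unit box.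
\<close>
lemma sum_haar_blocks:
  fixes f :: "real^'n \<Rightarrow> complex"
  assumes f[measurable]: "f \<in> borel_measurable borel" and M: "\<And>x. norm (f x) \<le> M"
  shows "(\<Sum>k\<in>index_box N. haar_block f (dyadic k) x) =
    (\<Sum>S\<in>Pow UNIV. (- 1) ^ card S *
      (\<integral>z. complex_of_real (indicator (half_box (\<lambda>_. 1)) z) *
        f (x - (\<chi> i. (if i \<in> S then 2 ^ N else inverse (2 ^ N)) * z $ i)) \<partial>lborel))"
proof -
  define A where "A m s = avg (2 powr (- of_int m)) s" for m :: int and s
  have Am[measurable]: "A m \<in> borel_measurable borel" for m unfolding A_def by measurable
  have dy: "avg (dyadic k i) s = A (k i + 1) s" "avg (2 * dyadic k i) s = A (k i) s" for k :: "'n \<Rightarrow> int" and i s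
    unfolding A_def dyadic_def by (simp_all add: powr_diff powr_minus field_simps)
  have exp: "(\<Prod>i\<in>UNIV. A (p i) (t $ i) - A (q i) (t $ i)) =
      (\<Sum>S\<in>Pow UNIV. (- 1) ^ card S * (\<Prod>i\<in>UNIV. avg (2 powr (- of_int (if i \<in> S then q i else p i))) (t $ i)))"
    for p q :: "'n \<Rightarrow> int" and t :: "real^'n"
    unfolding prod_diff_expand A_def by (intro sum.cong refl arg_cong2[where f = "(*)"] prod.cong) auto
  have iA: "integrable lborel (\<lambda>t. complex_of_real (\<Prod>i\<in>UNIV. avg (2 powr (- of_int (p i))) (t $ i)) * f (x - t))"
    for p :: "'n \<Rightarrow> int"
    using M integrable_prod_avg[of "\<lambda>i. 2 powr (- of_int (p i))"]
    by (intro integrable_mult_bounded[of _ _ "\<lambda>t. f (x - t)" M] integrable_of_real) auto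
  have iB: "integrable lborel (\<lambda>t. complex_of_real (\<Prod>i\<in>UNIV. A (p i) (t $ i) - A (q i) (t $ i)) * f (x - t))"
    for p q :: "'n \<Rightarrow> int"
    unfolding exp of_real_sum sum_distrib_right of_real_mult mult.assoc
    by (intro Bochner_Integration.integrable_sum integrable_mult_right iA)
  have "(\<Sum>k\<in>index_box N. haar_block f (dyadic k) x)
    = (\<Sum>k\<in>index_box N. \<integral>t. complex_of_real (\<Prod>i\<in>UNIV. A (k i + 1) (t $ i) - A (k i) (t $ i)) * f (x - t) \<partial>lborel)"
    unfolding haar_block_def dy ..
  also have "\<dots> = (\<integral>t. (\<Sum>k\<in>index_box N. complex_of_real (\<Prod>i\<in>UNIV. A (k i + 1) (t $ i) - A (k i) (t $ i)) * f (x - t)) \<partial>lborel)"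
    by (rule Bochner_Integration.integral_sum[symmetric]) (rule iB)
  also have "\<dots> = (\<integral>t. complex_of_real (\<Prod>i\<in>UNIV. A (int N) (t $ i) - A (- int N) (t $ i)) * f (x - t) \<partial>lborel)"
  proof (rule Bochner_Integration.integral_cong[OF refl])
    fix t :: "real^'n"
    have "(\<Prod>i\<in>UNIV. A (int N) (t $ i) - A (- int N) (t $ i)) = (\<Prod>i\<in>UNIV. \<Sum>m\<in>{- int N..<int N}. A (m + 1) (t $ i) - A m (t $ i))"
      by (intro prod.cong refl sum_int_telescope[where F = "\<lambda>m. A m (t $ _)", symmetric])
    also have "\<dots> = (\<Sum>k\<in>index_box N. \<Prod>i\<in>UNIV. A (k i + 1) (t $ i) - A (k i) (t $ i))"
      unfolding index_box_def by (rule prod_sum_PiE) auto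
    finally show "(\<Sum>k\<in>index_box N. complex_of_real (\<Prod>i\<in>UNIV. A (k i + 1) (t $ i) - A (k i) (t $ i)) * f (x - t))
      = complex_of_real (\<Prod>i\<in>UNIV. A (int N) (t $ i) - A (- int N) (t $ i)) * f (x - t)"
      by (simp only: of_real_sum sum_distrib_right)
  qed
  also have "\<dots> = (\<Sum>S\<in>Pow UNIV. (- 1) ^ card S *
      (\<integral>t. complex_of_real (\<Prod>i\<in>UNIV. avg (2 powr (- of_int (if i \<in> S then - int N else int N))) (t $ i)) * f (x - t) \<partial>lborel))"
    unfolding exp of_real_sum sum_distrib_right of_real_mult mult.assoc
    using iA by (subst Bochner_Integration.integral_sum) auto
  also have "\<dots> = (\<Sum>S\<in>Pow UNIV. (- 1) ^ card S *
      (\<integral>z. complex_of_real (indicator (half_box (\<lambda>_. 1)) z) *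
        f (x - (\<chi> i. (if i \<in> S then 2 ^ N else inverse (2 ^ N)) * z $ i)) \<partial>lborel))"
  proof (rule sum.cong[OF refl], rule arg_cong[where f = "(*) _"])
    fix S :: "'n set"
    define r where "r i = (if i \<in> S then 2 ^ N else inverse (2 ^ N) :: real)" for i
    have r: "r i > 0" for i by (simp add: r_def)
    have rp: "2 powr (- of_int (if i \<in> S then - int N else int N)) = r i" for i
      by (simp add: r_def powr_realpow powr_minus)
    have "(\<lambda>t::real^'n. complex_of_real (\<Prod>i\<in>UNIV. avg (r i) (t $ i)) * f (x - t)) \<in> borel_measurable borel" by measurable
    from integral_lborel_stretch[OF this r]
    have "(\<integral>t. complex_of_real (\<Prod>i\<in>UNIV. avg (r i) (t $ i)) * f (x - t) \<partial>lborel)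
      = (\<Prod>i\<in>UNIV. r i) *\<^sub>R (\<integral>z. complex_of_real (\<Prod>i\<in>UNIV. avg (r i) (r i * z $ i)) * f (x - (\<chi> i. r i * z $ i)) \<partial>lborel)"
      by simp
    also have "\<dots> = (\<integral>z. complex_of_real (\<Prod>i\<in>UNIV. r i * avg (r i) (r i * z $ i)) * f (x - (\<chi> i. r i * z $ i)) \<partial>lborel)"
      by (simp add: scaleR_conv_of_real prod.distrib mult.assoc flip: integral_mult_right_zero)
    also have "(\<lambda>z. \<Prod>i\<in>UNIV. r i * avg (r i) (r i * z $ i)) = indicator (half_box (\<lambda>_. 1))"
    proof
      fix z :: "real^'n"
      have "r i * avg (r i) (r i * z $ i) = avg 1 (z $ i)" for i
        using r[of i] unfolding avg_def by (auto simp: indicator_def zero_le_mult_iff)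
      then show "(\<Prod>i\<in>UNIV. r i * avg (r i) (r i * z $ i)) = indicator (half_box (\<lambda>_. 1)) z"
        using prod_avg[of "\<lambda>_. 1" z] by simp
    qed
    finally show "(\<integral>t. complex_of_real (\<Prod>i\<in>UNIV. avg (2 powr (- of_int (if i \<in> S then - int N else int N))) (t $ i)) * f (x - t) \<partial>lborel)
      = (\<integral>z. complex_of_real (indicator (half_box (\<lambda>_. 1)) z) *
        f (x - (\<chi> i. (if i \<in> S then 2 ^ N else inverse (2 ^ N)) * z $ i)) \<partial>lborel)"
      unfolding rp r_def .
  qed
  finally show ?thesis .
qed

text \<open>
  The average with \<open>S = {}\<close> tends to \<open>f x\<close> by continuity.  In all others the argument of \<open>f\<close> tends
  to infinity for almost every point of the unit box.
\<close>
lemma haar_expansion: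
  fixes f :: "real^'n \<Rightarrow> complex"
  assumes cf: "continuous_on UNIV f" and f0: "(f \<longlongrightarrow> 0) at_infinity" and M: "\<And>x. norm (f x) \<le> M"
  shows "(\<lambda>N. \<Sum>k\<in>index_box N. haar_block f (dyadic k) x) \<longlonglongrightarrow> f x"
proof -
  have f[measurable]: "f \<in> borel_measurable borel" using cf by (rule borel_measurable_continuous_onI)
  let ?r = "\<lambda>S N i. if i \<in> S then 2 ^ N else inverse (2 ^ N) :: real"
  let ?Q = "half_box (\<lambda>_. 1) :: (real^'n) set"
  let ?I = "\<lambda>S N. \<integral>z. complex_of_real (indicator ?Q z) * f (x - (\<chi> i. ?r S N i * z $ i)) \<partial>lborel"
  have mQ: "emeasure lborel ?Q = 1" using emeasure_half_box[of "\<lambda>_. 1"] by simp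
  have iQ: "integrable lborel (indicator ?Q :: real^'n \<Rightarrow> real)" using mQ by (intro integrable_real_indicator) auto
  have inv0: "(\<lambda>N. inverse (2 ^ N) :: real) \<longlonglongrightarrow> 0" by (rule LIMSEQ_inverse_realpow_zero) simp
  have lim: "?I S \<longlonglongrightarrow> (if S = {} then f x else 0)" if "S \<in> Pow UNIV" for S
  proof -
    have "?I S \<longlonglongrightarrow> (\<integral>z. complex_of_real (indicator ?Q z) * (if S = {} then f x else 0) \<partial>lborel)"
    proof (rule integral_dominated_convergence)
      show "integrable lborel (\<lambda>z. M * indicator ?Q z)" using iQ by auto
      show "AE z in lborel. norm (complex_of_real (indicator ?Q z) * f (x - (\<chi> i. ?r S N i * z $ i))) \<le> M * indicator ?Q z" for N
        using M by (intro AE_I2) (auto simp: norm_mult indicator_def)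
      show "AE z in lborel. (\<lambda>N. complex_of_real (indicator ?Q z) * f (x - (\<chi> i. ?r S N i * z $ i)))
        \<longlonglongrightarrow> complex_of_real (indicator ?Q z) * (if S = {} then f x else 0)"
      proof (rule AE_mp[OF AE_off_axes], intro AE_I2 impI tendsto_mult tendsto_const)
        fix z :: "real^'n" assume z: "z \<in> off_axes"
        show "(\<lambda>N. f (x - (\<chi> i. ?r S N i * z $ i))) \<longlonglongrightarrow> (if S = {} then f x else 0)"
        proof (cases "S = {}")
          case True
          have "(\<lambda>N. x - inverse (2 ^ N) *\<^sub>R z) \<longlonglongrightarrow> x - 0 *\<^sub>R z" by (intro tendsto_intros inv0)
          then have "(\<lambda>N. f (x - inverse (2 ^ N) *\<^sub>R z)) \<longlonglongrightarrow> f x"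
            by (intro continuous_on_tendsto_compose[OF cf]) auto
          moreover have "(\<chi> i. ?r S N i * z $ i) = inverse (2 ^ N) *\<^sub>R z" for N
            using True by (simp add: vec_eq_iff)
          ultimately show ?thesis using True by simp
        next
          case False
          then obtain i where i: "i \<in> S" by auto
          have zi: "\<bar>z $ i\<bar> > 0" using z by (simp add: off_axes_def)
          have "filterlim (\<lambda>N. \<bar>z $ i\<bar> * 2 ^ N - \<bar>x $ i\<bar>) at_top sequentially"
          proof -
            have "filterlim (\<lambda>N. (2::real) ^ N) at_top sequentially"
              by (rule filterlim_at_top_mono[OF filterlim_real_sequentially])
                 (auto intro!: always_eventually less_imp_le of_nat_less_two_power)
            then have "filterlim (\<lambda>N. \<bar>z $ i\<bar> * 2 ^ N) at_top sequentially"
              by (rule filterlim_tendsto_pos_mult_at_top[OF tendsto_const zi])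
            from filterlim_tendsto_add_at_top[OF tendsto_const this, of "- \<bar>x $ i\<bar>"] show ?thesis by simp
          qed
          then have "filterlim (\<lambda>N. norm (x - (\<chi> i. ?r S N i * z $ i))) at_top sequentially"
          proof (rule filterlim_at_top_mono, intro always_eventually allI)
            fix N
            have "\<bar>z $ i\<bar> * 2 ^ N - \<bar>x $ i\<bar> = \<bar>2 ^ N * z $ i\<bar> - \<bar>x $ i\<bar>" by (simp add: abs_mult)
            also have "\<dots> \<le> \<bar>(x - (\<chi> i. ?r S N i * z $ i)) $ i\<bar>" using i by simp
            also have "\<dots> \<le> norm (x - (\<chi> i. ?r S N i * z $ i))" by (rule component_le_norm_cart)
            finally show "\<bar>z $ i\<bar> * 2 ^ N - \<bar>x $ i\<bar> \<le> norm (x - (\<chi> i. ?r S N i * z $ i))" .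
          qed
          then have "filterlim (\<lambda>N. x - (\<chi> i. ?r S N i * z $ i)) at_infinity sequentially"
            by (simp add: filterlim_at_infinity_conv_norm_at_top)
          then show ?thesis using False filterlim_compose[OF f0] by simp
        qed
      qed
      have mr: "(\<lambda>z::real^'n. \<chi> i. ?r S N i * z $ i) \<in> borel_measurable borel" for N
        by (intro borel_measurable_continuous_onI continuous_on_vec_lambda continuous_intros)
      show "(\<lambda>z. complex_of_real (indicator ?Q z) * f (x - (\<chi> i. ?r S N i * z $ i))) \<in> borel_measurable lborel" for N
        using mr[of N] by measurable
    qed measurable
    moreover have "(\<integral>z. complex_of_real (indicator ?Q z) * c \<partial>lborel) = c" for c
      using mQ by (simp add: measure_def)
    ultimately show ?thesis by (simp only:)
  qed
  have "(\<lambda>N. \<Sum>S\<in>Pow UNIV. (- 1) ^ card S * ?I S N) \<longlonglongrightarrow> (\<Sum>S\<in>Pow (UNIV :: 'n set). (- 1) ^ card S * (if S = {} then f x else 0))"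
    by (intro tendsto_sum tendsto_mult tendsto_const lim)
  moreover have "(\<Sum>S\<in>Pow (UNIV :: 'n set). (- 1) ^ card S * (if S = {} then f x else 0)) = f x"
    by (subst sum.remove[of _ "{}"]) auto
  ultimately show ?thesis unfolding sum_haar_blocks[OF f M] by simp
qed

section \<open>Absolute convergence in the Wiener algebra\<close>

lemma sum_geometric_int:
  fixes r :: real
  assumes r: "0 < r" "r < 1" and J: "finite J"
  shows "(\<Sum>m\<in>J. r ^ nat \<bar>m + 1\<bar>) \<le> 2 / (1 - r)"
proof -
  have half: "(\<Sum>m\<in>L. r ^ nat \<bar>m + 1\<bar>) \<le> 1 / (1 - r)" if L: "finite L" "inj_on (\<lambda>m. nat \<bar>m + 1\<bar>) L" for L :: "int set"
  proof -
    have "(\<Sum>m\<in>L. r ^ nat \<bar>m + 1\<bar>) = (\<Sum>n\<in>(\<lambda>m. nat \<bar>m + 1\<bar>) ` L. r ^ n)"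
      by (subst sum.reindex[OF L(2)]) simp
    also have "\<dots> \<le> (\<Sum>n. r ^ n)" using r L(1) by (intro sum_le_suminf summable_geometric) auto
    also have "\<dots> = 1 / (1 - r)" using r by (intro suminf_geometric) auto
    finally show ?thesis .
  qed
  have "(\<Sum>m\<in>J. r ^ nat \<bar>m + 1\<bar>) = (\<Sum>m\<in>{m\<in>J. m \<ge> -1}. r ^ nat \<bar>m + 1\<bar>) + (\<Sum>m\<in>{m\<in>J. m < -1}. r ^ nat \<bar>m + 1\<bar>)"
    using J by (subst sum.union_disjoint[symmetric]) (auto intro!: sum.cong)
  also have "\<dots> \<le> 1 / (1 - r) + 1 / (1 - r)"
    using J by (intro add_mono half) (auto simp: inj_on_def)
  finally show ?thesis by simp
qed

lemma dyadic_min: "min (dyadic k i) (1 / dyadic k i) powr \<delta> = (2 powr (- \<delta>)) ^ nat \<bar>k i + 1\<bar>"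
proof -
  define x where "x = (of_int (k i) + 1 :: real)"
  have "dyadic k i = 2 powr (- x)" by (simp add: dyadic_def x_def)
  moreover from this have "1 / dyadic k i = 2 powr x" by (simp add: powr_minus_divide)
  ultimately have "min (dyadic k i) (1 / dyadic k i) = 2 powr (- \<bar>x\<bar>)" by (auto simp: min_def abs_if)
  then have "min (dyadic k i) (1 / dyadic k i) = 2 powr (- \<bar>of_int (k i) + 1\<bar>)" by (simp only: x_def)
  then have "min (dyadic k i) (1 / dyadic k i) powr \<delta> = 2 powr (- \<bar>of_int (k i) + 1\<bar> * \<delta>)"
    by (simp add: powr_powr)
  also have "- \<bar>of_int (k i) + 1\<bar> * \<delta> = (- \<delta>) * real (nat \<bar>k i + 1\<bar>)" by simp
  also have "2 powr \<dots> = (2 powr (- \<delta>)) powr real (nat \<bar>k i + 1\<bar>)"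
    by (simp only: powr_powr)
  also have "\<dots> = (2 powr (- \<delta>)) ^ nat \<bar>k i + 1\<bar>" by (rule powr_realpow) simp
  finally show ?thesis .
qed

lemma sum_index_box:
  fixes c :: "int \<Rightarrow> real"
  shows "(\<Sum>k\<in>(index_box N :: ('n::finite \<Rightarrow> int) set). \<Prod>i\<in>UNIV. c (k i)) = (\<Sum>m\<in>{- int N..<int N}. c m) ^ CARD('n)"
  unfolding index_box_def using prod_sum_PiE[of "UNIV :: 'n set" "\<lambda>_. {- int N..<int N}" "\<lambda>_. c"] by simp

lemma C0_bounded:
  fixes f :: "'a::euclidean_space \<Rightarrow> complex"
  assumes "continuous_on UNIV f" "(f \<longlongrightarrow> 0) at_infinity"
  obtains M where "M \<ge> 0" "\<And>x. norm (f x) \<le> M"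
proof -
  obtain b where b: "\<And>x. norm x \<ge> b \<Longrightarrow> dist (f x) 0 < 1"
    using assms(2) unfolding Lim_at_infinity by (metis zero_less_one)
  have "compact (f ` cball 0 b)"
    by (intro compact_continuous_image continuous_on_subset[OF assms(1)]) auto
  then have "bounded (f ` cball 0 b)" by (rule compact_imp_bounded)
  then obtain B where "\<forall>y\<in>f ` cball 0 b. norm y \<le> B" unfolding bounded_iff by blast
  then have B: "\<And>x. x \<in> cball 0 b \<Longrightarrow> norm (f x) \<le> B" by blast
  have "norm (f x) \<le> max 1 B" for x
    using b[of x] B[of x] by (cases "norm x \<ge> b") (auto simp: max_def)
  then show thesis using that[of "max 1 B"] by auto
qed

lemma continuous_coord_diffs:
  assumes "continuous_on UNIV f" "distinct ks"
  shows "continuous_on UNIV (coord_diffs h ks f)"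
proof -
  have "coord_diffs h ks f = (\<lambda>y. \<Sum>S\<in>Pow (set ks). (- 1) ^ card S * f (y - shift h S))"
    using coord_diffs_sum[OF assms(2)] by (intro ext)
  moreover have "continuous_on UNIV (\<lambda>y. f (y - shift h S))" for S
    by (rule continuous_on_compose2[OF assms(1)]) (auto intro!: continuous_intros)
  ultimately show ?thesis by (simp only:) (intro continuous_intros)
qed

lemma norm_coord_diffs_le:
  fixes f :: "real^'n \<Rightarrow> complex"
  assumes "\<And>x. norm (f x) \<le> M" and js: "distinct js" "set js = UNIV"
  shows "norm (coord_diffs h js f y) \<le> 2 ^ CARD('n) * M"
proof -
  have "norm (coord_diffs h js f y) \<le> (\<Sum>S\<in>Pow (UNIV :: 'n set). M)"
    unfolding coord_diffs_sum[OF js(1)] js(2)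
    by (rule order_trans[OF norm_sum sum_mono]) (simp add: norm_mult norm_power assms)
  then show ?thesis by (simp add: card_Pow)
qed

text \<open>
  The kernel is the indicator function of a box divided by \<open>2\<^sup>n\<close> times the volume \<open>P\<close> of the box, so
  its \<open>L\<^sub>2\<close> norm is of the order of the square root of \<open>1 / P\<close>.  This cancels the product of the
  steps in \<open>decay\<close>.
\<close>
lemma wiener_bound_haar_block:
  fixes f :: "real^'n \<Rightarrow> complex"
  assumes cf: "continuous_on UNIV f" and M: "\<And>x. norm (f x) \<le> M" and h: "\<And>i. h i > 0"
    and js: "distinct js" "set js = UNIV" and C: "C > 0"
    and L2: "(\<integral>\<^sup>+y. ennreal ((norm (coord_diffs h js f y))\<^sup>2) \<partial>lborel) \<le> ennreal (C * decay \<delta> h)"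
  shows "wiener_bound (haar_block f h) (3 * sqrt C * (\<Prod>i\<in>UNIV. min (h i) (1 / h i) powr (\<delta> / 2)))"
proof -
  have f: "f \<in> borel_measurable borel" using cf by (rule borel_measurable_continuous_onI)
  define v where "v t = complex_of_real (\<Prod>i\<in>UNIV. avg (h i) (t $ i) / 2)" for t :: "real^'n"
  define P where "P = (\<Prod>i\<in>UNIV. h i)"
  define m where "m = (\<Prod>i\<in>UNIV. min (h i) (1 / h i) powr (\<delta> / 2))"
  define D where "D = 2 ^ CARD('n) * P"
  have P: "P > 0" unfolding P_def using h by (intro prod_pos) auto
  have D: "D > 0" using P by (simp add: D_def)
  have mpos: "min (h i) (1 / h i) > 0" for i using h[of i] by simp
  have m: "m > 0" unfolding m_def using mpos by (intro prod_pos) (metis powr_gt_zero less_irrefl)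
  have v_eq: "v t = complex_of_real (indicator (half_box h) t / D)" for t
    unfolding v_def prod_dividef prod_avg P_def D_def by (simp add: mult.commute)
  have emb: "emeasure lborel (half_box h :: (real^'n) set) = ennreal P"
    unfolding P_def by (rule emeasure_half_box[OF h])
  have iv: "integrable lborel v"
    unfolding v_eq using emb by (intro integrable_of_real integrable_divide integrable_real_indicator) auto
  have dec: "decay \<delta> h = P * m\<^sup>2"
  proof -
    have "(min (h i) (1 / h i) powr (\<delta> / 2))\<^sup>2 = min (h i) (1 / h i) powr \<delta>" for i
      using mpos[of i] by (simp add: power2_eq_square powr_add[symmetric])
    then show ?thesis unfolding decay_def P_def m_def by (simp add: prod.distrib prod_power_distrib)
  qed
  have "(\<integral>\<^sup>+t. ennreal ((norm (v t))\<^sup>2) \<partial>lborel) = (\<integral>\<^sup>+t. ennreal (inverse (D\<^sup>2)) * indicator (half_box h) t \<partial>lborel)"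
    using D by (intro nn_integral_cong) (auto simp: v_eq norm_inverse power_inverse indicator_def divide_inverse)
  also have "\<dots> = ennreal (inverse (D\<^sup>2)) * ennreal P"
    by (subst nn_integral_cmult_indicator) (simp_all add: emb)
  also have "\<dots> = ennreal ((sqrt P / D)\<^sup>2)"
    using P D by (simp add: ennreal_mult[symmetric] divide_inverse mult.commute power_mult_distrib power_inverse)
  finally have v2: "(\<integral>\<^sup>+t. ennreal ((norm (v t))\<^sup>2) \<partial>lborel) \<le> ennreal ((sqrt P / D)\<^sup>2)" by simp
  have u2: "(\<integral>\<^sup>+y. ennreal ((norm (coord_diffs h js f y))\<^sup>2) \<partial>lborel) \<le> ennreal ((sqrt (C * P) * m)\<^sup>2)"
    using L2 C P unfolding dec by (simp add: power_mult_distrib mult.assoc)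
  have wb: "wiener_bound (\<lambda>x. \<integral>t. v t * coord_diffs h js f (x - t) \<partial>lborel) (3 * (sqrt (C * P) * m) * (sqrt P / D))"
    using C P D m
    by (intro wiener_bound_convolution[OF continuous_coord_diffs[OF cf js(1)] norm_coord_diffs_le[OF M js] u2 iv v2]) auto
  have hb: "haar_block f h = (\<lambda>x. \<integral>t. v t * coord_diffs h js f (x - t) \<partial>lborel)"
    unfolding v_def by (intro ext haar_block_eq[OF f M h js])
  have le: "3 * (sqrt (C * P) * m) * (sqrt P / D) \<le> 3 * sqrt C * m"
  proof -
    have "sqrt (C * P) * sqrt P = sqrt C * P" using P by (simp add: real_sqrt_mult mult.assoc)
    then have "3 * (sqrt (C * P) * m) * (sqrt P / D) = 3 * sqrt C * m * (P / D)" by (simp add: mult_ac)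
    also have "P / D \<le> 1" using P by (simp add: D_def)
    then have "3 * sqrt C * m * (P / D) \<le> 3 * sqrt C * m * 1" using C m by (intro mult_left_mono) auto
    finally show ?thesis by simp
  qed
  show ?thesis unfolding hb m_def[symmetric] by (rule wiener_bound_mono[OF wb le])
qed

text \<open>
  The sums over the differences of consecutive cubes of indices turn the multiple series into an
  ordinary one, whose bounds sum up to at most a power of a two-sided geometric series.
\<close>
theorem wiener_bound_if_diffs_decay:
  fixes f :: "real^'n \<Rightarrow> complex"
  assumes cf: "continuous_on UNIV f" and f0: "(f \<longlongrightarrow> 0) at_infinity"
    and js: "distinct js" "set js = UNIV" and C: "C > 0" and \<delta>: "\<delta> > 0"
    and L2: "\<And>h. \<forall>i. h i > 0 \<Longrightarrow> (\<integral>\<^sup>+y. ennreal ((norm (coord_diffs h js f y))\<^sup>2) \<partial>lborel) \<le> ennreal (C * decay \<delta> h)"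
  shows "\<exists>c. wiener_bound f c"
proof -
  obtain M where M: "\<And>x. norm (f x) \<le> M" using C0_bounded[OF cf f0] by blast
  define r where "r = 2 powr (- (\<delta> / 2))"
  have r: "0 < r" "r < 1" using \<delta> by (auto simp: r_def powr_less_one)
  define c where "c m = r ^ nat \<bar>m + 1\<bar>" for m :: int
  define A where "A = 3 * sqrt C"
  have A: "A \<ge> 0" using C by (simp add: A_def)
  have block: "wiener_bound (haar_block f (dyadic k)) (A * (\<Prod>i\<in>UNIV. c (k i)))" for k :: "'n \<Rightarrow> int"
    using wiener_bound_haar_block[where h = "dyadic k", OF cf M dyadic_pos js C L2] dyadic_pos[of k]
    unfolding dyadic_min A_def c_def r_def by simp
  let ?box = "\<lambda>N. index_box N :: ('n \<Rightarrow> int) set"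
  define a where "a N = (\<Sum>k\<in>?box (Suc N) - ?box N. A * (\<Prod>i\<in>UNIV. c (k i)))" for N
  define F where "F N x = (\<Sum>k\<in>?box (Suc N) - ?box N. haar_block f (dyadic k) x)" for N x
  have wF: "wiener_bound (F N) (a N)" for N
    unfolding F_def a_def using index_box_finite block by (intro wiener_bound_sum) auto
  have split: "(\<Sum>k\<in>?box (Suc N) - ?box N. G k) = (\<Sum>k\<in>?box (Suc N). G k) - (\<Sum>k\<in>?box N. G k)"
    for G :: "('n \<Rightarrow> int) \<Rightarrow> 'b::ab_group_add" and N
    by (rule sum_diff[OF index_box_finite index_box_mono]) simp
  have empty: "?box 0 = {}" by (auto simp: index_box_def)
  have "summable a"
  proof (rule summableI_nonneg_bounded)
    show "0 \<le> a N" for N unfolding a_def c_def using A r by (intro sum_nonneg mult_nonneg_nonneg prod_nonneg) auto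
    fix N
    have "(\<Sum>n<N. a n) = (\<Sum>k\<in>?box N. A * (\<Prod>i\<in>UNIV. c (k i)))"
      unfolding a_def split by (subst sum_lessThan_telescope) (simp add: empty)
    also have "\<dots> = A * (\<Sum>m\<in>{- int N..<int N}. c m) ^ CARD('n)"
      by (simp only: sum_distrib_left[symmetric] sum_index_box)
    also have "\<dots> \<le> A * (2 / (1 - r)) ^ CARD('n)"
      unfolding c_def using A r by (intro mult_left_mono power_mono sum_geometric_int sum_nonneg) auto
    finally show "(\<Sum>n<N. a n) \<le> A * (2 / (1 - r)) ^ CARD('n)" .
  qed
  moreover have "(\<lambda>N. F N x) sums f x" for x
  proof -
    have "(\<Sum>n<N. F n x) = (\<Sum>k\<in>?box N. haar_block f (dyadic k) x)" for N
      unfolding F_def split by (subst sum_lessThan_telescope) (simp add: empty)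
    then show ?thesis unfolding sums_def using haar_expansion[OF cf f0 M] by simp
  qed
  ultimately have "wiener_bound f (\<Sum>N. a N)" by (rule wiener_bound_series[OF wF])
  then show ?thesis by blast
qed

lemma wiener_bound_imp_wiener_A:
  fixes f :: "real^'n \<Rightarrow> complex"
  assumes "wiener_bound f c"
  shows "f \<in> wiener_A"
proof -
  obtain g where g: "integrable lborel g" "\<And>y. f y = (\<integral>x. g x * cis (x \<bullet> y) \<partial>lborel)"
    using assms unfolding wiener_bound_def by blast
  have [measurable]: "g \<in> borel_measurable lborel" using g(1) by auto
  have "integrable lebesgue g" using g(1) by (subst integrable_completion) auto
  moreover have "f y = (LINT x|lebesgue. g x * exp (\<i> * complex_of_real (x \<bullet> y)))" for y
    unfolding g(2)[of y] cis_conv_exp[symmetric] by (subst integral_completion) auto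
  ultimately show ?thesis unfolding wiener_A_def by blast
qed

text \<open>
  The three bounds of the mixed differences come from the derivative chains.  The constant \<open>K\<close>
  dominates all constants that occur in them.
\<close>
theorem theorem2p1:
  fixes f :: "real ^ 'n \<Rightarrow> complex"
    and p :: "'n set \<Rightarrow> real"
    and js :: "'n list"
  assumes "distinct js" and "set js = UNIV"
    and "f \<in> C0_space"
    and "\<And>\<eta>. \<eta> \<noteq> UNIV \<Longrightarrow> locally_AC_off_axes (mixed_partial js \<eta> f)"
    and "1 \<le> p {}" and "f \<in> L_space (p {})"
    and "\<And>\<eta>. \<eta> \<noteq> {} \<Longrightarrow> 1 < p \<eta>"
    and "\<And>\<eta>. \<eta> \<noteq> {} \<Longrightarrow> mixed_partial js \<eta> f \<in> L_space (p \<eta>)"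
    and "\<And>\<eta>. \<eta> \<noteq> {} \<Longrightarrow> 1 / p {} + 1 / p \<eta> > 1"
  shows "f \<in> wiener_A"
proof -
  note js = assms(1,2)
  have cf: "continuous_on UNIV f" and f0: "(f \<longlongrightarrow> 0) at_infinity"
    using assms(3) by (auto simp: C0_space_def)
  have fb: "f \<in> borel_measurable borel" using cf by (rule borel_measurable_continuous_onI)
  obtain M where M: "M \<ge> 0" "\<And>x. norm (f x) \<le> M" using C0_bounded[OF cf f0] by blast
  have p1: "p \<eta> \<ge> 1" for \<eta> using assms(5) assms(7)[of \<eta>] by (cases "\<eta> = {}") auto
  have Lp: "mixed_partial js \<eta> f \<in> L_space (p \<eta>)" for \<eta>
    using assms(6) assms(8)[of \<eta>] by (cases "\<eta> = {}") (auto simp: mixed_partial_def)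
  have "\<exists>g I. g \<in> borel_measurable borel \<and> derivative_chain (filter (\<lambda>j. j \<in> \<eta>) js) f g \<and> I \<ge> 0 \<and>
      (\<integral>\<^sup>+y. ennreal (norm (g y) powr p \<eta>) \<partial>lborel) \<le> ennreal I" for \<eta>
  proof -
    obtain g where g: "g \<in> borel_measurable borel" "derivative_chain (filter (\<lambda>j. j \<in> \<eta>) js) f g"
      "AE y in lebesgue. g y = mixed_partial js \<eta> f y"
      using derivative_chain_exists[OF js fb assms(4), of \<eta>] assms(8) by (auto simp: L_space_def)
    have [measurable]: "g \<in> borel_measurable lborel" using g(1) by simp
    let ?I = "integral\<^sup>L lebesgue (\<lambda>y. norm (mixed_partial js \<eta> f y) powr p \<eta>)"
    have "(\<integral>\<^sup>+y. ennreal (norm (g y) powr p \<eta>) \<partial>lborel) = (\<integral>\<^sup>+y. ennreal (norm (g y) powr p \<eta>) \<partial>lebesgue)"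
      by (rule nn_integral_completion[symmetric]) measurable
    also have "\<dots> = (\<integral>\<^sup>+y. ennreal (norm (mixed_partial js \<eta> f y) powr p \<eta>) \<partial>lebesgue)"
      using g(3) by (intro nn_integral_cong_AE) auto
    also have "\<dots> = ennreal ?I"
      using Lp[of \<eta>] by (intro nn_integral_eq_integral) (auto simp: L_space_def)
    finally have "(\<integral>\<^sup>+y. ennreal (norm (g y) powr p \<eta>) \<partial>lborel) \<le> ennreal ?I" by simp
    moreover have "?I \<ge> 0" by simp
    ultimately show ?thesis using g(1,2) by blast
  qed
  then obtain g I where g: "\<And>\<eta>. g \<eta> \<in> borel_measurable borel"
    "\<And>\<eta>. derivative_chain (filter (\<lambda>j. j \<in> \<eta>) js) f (g \<eta>)" and I: "\<And>\<eta>. I \<eta> \<ge> 0"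
    "\<And>\<eta>. (\<integral>\<^sup>+y. ennreal (norm (g \<eta> y) powr p \<eta>) \<partial>lborel) \<le> ennreal (I \<eta>)" by metis
  have set_filter: "set (filter (\<lambda>j. j \<in> \<eta>) js) = \<eta>" for \<eta> using js(2) by auto
  have dist: "distinct (filter (\<lambda>j. j \<in> \<eta>) js)" for \<eta> using js(1) by simp
  define L where "L \<eta> = (2 * 2 powr p \<eta>) ^ CARD('n) * I \<eta>" for \<eta>
  have L0: "L \<eta> \<ge> 0" for \<eta> using I(1)[of \<eta>] by (simp add: L_def)
  define r where "r = p UNIV"
  have r: "r > 1" using assms(7)[of UNIV] by (simp add: r_def)
  define K where "K = 1 + (\<Sum>\<eta>\<in>UNIV. L \<eta>) + I UNIV powr (1 / r) + 2 ^ CARD('n) * M"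
  have sL: "(\<Sum>\<eta>\<in>UNIV. L \<eta>) \<ge> 0" using L0 by (intro sum_nonneg) auto
  have "I UNIV powr (1 / r) \<ge> 0" "2 ^ CARD('n) * M \<ge> 0" using M(1) by auto
  then have K: "K \<ge> 1" "I UNIV powr (1 / r) \<le> K" "2 ^ CARD('n) * M \<le> K" "(\<Sum>\<eta>\<in>UNIV. L \<eta>) \<le> K"
    using sL unfolding K_def by linarith+
  have LK: "L \<eta> \<le> K" for \<eta>
    using member_le_sum[of \<eta> UNIV L] L0 K(4) by auto
  let ?u = "\<lambda>h. coord_diffs h js f"
  have B: "(\<integral>\<^sup>+y. ennreal (norm (?u h y) powr p \<eta>) \<partial>lborel) \<le> ennreal (K * (\<Prod>i\<in>\<eta>. h i) powr p \<eta>)"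
    if h: "\<And>i. h i > 0" for h \<eta>
  proof -
    have "(\<integral>\<^sup>+y. ennreal (norm (?u h y) powr p \<eta>) \<partial>lborel)
      \<le> ennreal ((2 * 2 powr p \<eta>) ^ CARD('n) * (\<Prod>i\<in>\<eta>. h i) powr p \<eta>) * (\<integral>\<^sup>+y. ennreal (norm (g \<eta> y) powr p \<eta>) \<partial>lborel)"
      using full_diff_Lq[of _ f "g \<eta>" js h "p \<eta>", OF g(2) dist js h p1 cf] unfolding set_filter .
    also have "\<dots> \<le> ennreal ((2 * 2 powr p \<eta>) ^ CARD('n) * (\<Prod>i\<in>\<eta>. h i) powr p \<eta>) * ennreal (I \<eta>)"
      by (intro mult_left_mono I) simp
    also have "\<dots> = ennreal (L \<eta> * (\<Prod>i\<in>\<eta>. h i) powr p \<eta>)"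
      using I(1)[of \<eta>] by (simp add: L_def ennreal_mult[symmetric] mult_ac del: ennreal_power)
    also have "\<dots> \<le> ennreal (K * (\<Prod>i\<in>\<eta>. h i) powr p \<eta>)"
      by (intro ennreal_leI mult_right_mono LK) simp
    finally show ?thesis .
  qed
  have D: "AE y in lborel. norm (?u h y) \<le> K * (\<Prod>i\<in>UNIV. h i) powr (1 - 1 / r)"
    if h: "\<And>i. h i > 0" for h
  proof (rule AE_mp[OF AE_off_axes], intro AE_I2 impI)
    fix y :: "real^'n" assume y: "y \<in> off_axes"
    define P where "P = (\<Prod>i\<in>UNIV. h i)"
    have P: "P > 0" unfolding P_def using h by (intro prod_pos) auto
    have ch: "derivative_chain js f (g UNIV)" using g(2)[of UNIV] by simp
    have "ennreal (norm (?u h y) powr r) \<le> ennreal (P powr (r - 1)) * (\<integral>\<^sup>+y. ennreal (norm (g UNIV y) powr r) \<partial>lborel)"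
      using coord_diffs_sup[OF ch js(1) h _ y g(1) cf js(2), of r] r unfolding P_def by simp
    also have "\<dots> \<le> ennreal (P powr (r - 1)) * ennreal (I UNIV)"
      using I(2)[of UNIV] unfolding r_def by (intro mult_left_mono) auto
    also have "\<dots> = ennreal (P powr (r - 1) * I UNIV)" using I(1)[of UNIV] by (simp add: ennreal_mult)
    finally have "norm (?u h y) powr r \<le> P powr (r - 1) * I UNIV"
      using I(1)[of UNIV] by (subst (asm) ennreal_le_iff) auto
    then have "(norm (?u h y) powr r) powr (1 / r) \<le> (P powr (r - 1) * I UNIV) powr (1 / r)"
      using r by (intro powr_mono2) auto
    also have "(norm (?u h y) powr r) powr (1 / r) = norm (?u h y)" using r by (simp add: powr_powr)
    also have "(P powr (r - 1) * I UNIV) powr (1 / r) = P powr (1 - 1 / r) * I UNIV powr (1 / r)"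
      using P r I(1)[of UNIV] by (simp add: powr_mult powr_powr diff_divide_distrib)
    also have "\<dots> \<le> P powr (1 - 1 / r) * K" using K(2) by (intro mult_left_mono) auto
    finally show "norm (?u h y) \<le> K * (\<Prod>i\<in>UNIV. h i) powr (1 - 1 / r)" unfolding P_def by (simp add: mult.commute)
  qed
  have "\<exists>\<delta>>0. \<exists>C>0. \<forall>h. (\<forall>i. h i > 0) \<longrightarrow>
    (\<integral>\<^sup>+y. ennreal ((norm (?u h y))\<^sup>2) \<partial>lborel) \<le> ennreal (C * decay \<delta> h)"
  proof (rule L2_bound[where p = p, OF assms(5,7,9) K(1)])
    show "?u h \<in> borel_measurable lborel" for h using coord_diffs_measurable[OF fb] by simp
    show "(\<integral>\<^sup>+y. ennreal (norm (?u h y) powr p {}) \<partial>lborel) \<le> ennreal K" if "\<And>i. h i > 0" for h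
      using B[of h "{}", OF that] by simp
    show "AE y in lborel. norm (?u h y) \<le> K" for h
      using norm_coord_diffs_le[OF M(2) js] K(3) by (intro AE_I2) (meson order_trans)
  qed (use B D in \<open>simp_all add: r_def\<close>)
  then obtain \<delta> C where "\<delta> > 0" "C > 0" and
    L2: "\<And>h. \<forall>i. h i > 0 \<Longrightarrow> (\<integral>\<^sup>+y. ennreal ((norm (?u h y))\<^sup>2) \<partial>lborel) \<le> ennreal (C * decay \<delta> h)" by blast
  obtain c where "wiener_bound f c"
    using wiener_bound_if_diffs_decay[OF cf f0 js \<open>C > 0\<close> \<open>\<delta> > 0\<close> L2] by blast
  then show ?thesis by (rule wiener_bound_imp_wiener_A)
qed

end
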